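(* Let $\mathcal{A}$ be a finite alphabet and let $X$ be a minimal shift space over $\mathcal{A}$. The following assertions are equivalent: (i) $X$ is dendric; (ii) the sets of return words $\mathcal{R}_X(w)$, $w\in\mathcal{L}(X)$, are tame bases of the free group $F_{\mathcal{A}}$; (iii) the sets of return words $\mathcal{R}_X(w)$, $w\in\mathcal{L}(X)$, are bases of the free group $F_{\mathcal{A}}$.
   Context: Let $\mathcal{A}$ be a finite set (alphabet), $\mathcal{A}^*$ the free monoid on $\mathcal{A}$ (its elements are words), $\varepsilon$ the empty word, $\mathcal{A}^+=\mathcal{A}^*\setminus\{\varepsilon\}$, and $F_{\mathcal{A}}$ the free group generated by $\mathcal{A}$; $\mathcal{A}^*$ is viewed as a subset of $F_{\mathcal{A}}$. The set $\mathcal{A}^{\mathbb{Z}}$ of two-sided infinite words carries the product topology of the discrete topology on $\mathcal{A}$. A shift space (over $\mathcal{A}$) is a closed subset $X\subseteq\mathcal{A}^{\mathbb{Z}}$ invariant under the shift map $(x_n)_{n\in\mathbb{Z}}\mapsto(x_{n+1})_{n\in\mathbb{Z}}$. Its language $\mathcal{L}(X)$ is the set of all finite words, including $\varepsilon$, occurring as factors $x_i\cdots x_j$ of elements $x\in X$. A shift space is minimal (with respect to inclusion of shift spaces) precisely when $\mathcal{L}(X)$ is uniformly recurrent: for every $u\in\mathcal{L}(X)$ there is $n$ such that $u$ is a factor of every word of length $n$ in $\mathcal{L}(X)$. For $w\in\mathcal{L}(X)$, the set of (left) return words to $w$ is $$\mathcal{R}_X(w)=\{r\in\mathcal{A}^+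 \mid rw\in\mathcal{L}(X)\cap w\mathcal{A}^*\setminus \mathcal{A}^+w\mathcal{A}^+\},$$ i.e. the nonempty words $r$ such that $rw\in\mathcal{L}(X)$, $rw$ begins with $w$, and $w$ has no occurrence in $rw$ other than as a prefix and as a suffix. For $w\in\mathcal{L}(X)$ let $E^-_X(w)=\{a\in\mathcal{A}\mid aw\in\mathcal{L}(X)\}$, $E^+_X(w)=\{b\in\mathcal{A}\mid wb\in\mathcal{L}(X)\}$, $E_X(w)=\{(a,b)\in\mathcal{A}\times\mathcal{A}\mid awb\in\mathcal{L}(X)\}$. The extension graph $\mathcal{E}_X(w)$ is the bipartite graph whose vertex set is the disjoint union of $E^-_X(w)$ and $E^+_X(w)$, with an edge between $a\in E^-_X(w)$ and $b\in E^+_X(w)$ if $(a,b)\in E_X(w)$. A word $w\in\mathcal{L}(X)$ is dendric if $\mathcal{E}_X(w)$ is a tree, and $X$ is dendric if every $w\in\mathcal{L}(X)$ is dendric. A basis of $F_{\mathcal{A}}$ is tame if it is obtained by applying to $\mathcal{A}$ a composition of permutations of $\mathcal{A}$ (extended to morphisms) and morphisms of the form $\alpha_{a,b}$ and $\tilde\alpha_{a,b}$ for $a\neq b$ in $\mathcal{A}$, where $\alpha_{a,b}(a)=ab$, $\tilde\alpha_{a,b}(a)=ba$, and $\alpha_{a,b}(c)=\tilde\alpha_{a,b}(c)=c$ for every letter $c\neq a$.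
   Formalization: It is additionally assumed that every letter of A occurs in L(X); without this the claim fails, e.g. for A={a,b} and X={a^Z}, which is minimal and dendric while every R_X(w)={a} is not a basis of F_A. *)

theory Defs
  imports
    "HOL-Analysis.Function_Topology"
    "HOL-Algebra.Group"
    "HOL-Combinatorics.Permutations"
    "Graph_Theory.Graph_Theory"
begin

section \<open>Shift spaces and their languages\<close>

definition shift :: "(int \<Rightarrow> 'a) \<Rightarrow> int \<Rightarrow> 'a" where
  "shift x = (\<lambda>n. x (n + 1))"

definition shift_space :: "'a set \<Rightarrow> (int \<Rightarrow> 'a) set \<Rightarrow> bool" where
  "shift_space A X \<longleftrightarrow>
     closedin (product_topology (\<lambda>_::int. discrete_topology A) UNIV) X \<and> shift ` X = X"

text \<open>The empty set is a shift space, so minimality is taken among the nonempty ones.\<close>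

definition minimal_shift_space :: "'a set \<Rightarrow> (int \<Rightarrow> 'a) set \<Rightarrow> bool" where
  "minimal_shift_space A X \<longleftrightarrow>
     shift_space A X \<and> X \<noteq> {} \<and>
     (\<forall>Y. shift_space A Y \<longrightarrow> Y \<noteq> {} \<longrightarrow> Y \<subseteq> X \<longrightarrow> Y = X)"

text \<open>The interval \<open>[i..j]\<close> is the empty list for \<open>j < i\<close>; this contributes the empty word.\<close>

definition language :: "(int \<Rightarrow> 'a) set \<Rightarrow> 'a list set" where
  "language X = {map x [i..j] | x i j. x \<in> X}"

definition return_words :: "(int \<Rightarrow> 'a) set \<Rightarrow> 'a list \<Rightarrow> 'a list set" where
  "return_words X w =
     {r. r \<noteq> [] \<and> r @ w \<in> language X \<and> (\<exists>u. r @ w = w @ u) \<and>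
         \<not> (\<exists>p s. p \<noteq> [] \<and> s \<noteq> [] \<and> r @ w = p @ w @ s)}"


section \<open>Extension graphs and dendric shift spaces\<close>

definition left_ext :: "(int \<Rightarrow> 'a) set \<Rightarrow> 'a list \<Rightarrow> 'a set" where
  "left_ext X w = {a. a # w \<in> language X}"

definition right_ext :: "(int \<Rightarrow> 'a) set \<Rightarrow> 'a list \<Rightarrow> 'a set" where
  "right_ext X w = {b. w @ [b] \<in> language X}"

definition bi_ext :: "(int \<Rightarrow> 'a) set \<Rightarrow> 'a list \<Rightarrow> ('a \<times> 'a) set" where
  "bi_ext X w = {(a, b). a # w @ [b] \<in> language X}"

text \<open>Undirected graphs are represented by symmetric digraphs.\<close>

definition extension_graph :: "(int \<Rightarrow> 'a) set \<Rightarrow> 'a list \<Rightarrow> ('a + 'a) pair_pre_digraph" where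
  "extension_graph X w =
     \<lparr> pverts = left_ext X w <+> right_ext X w,
       parcs = (\<Union>(a, b) \<in> bi_ext X w. {(Inl a, Inr b), (Inr b, Inl a)}) \<rparr>"

text \<open>
  The constant \<^const>\<open>Digraph_Component.tree\<close> forbids all directed cycles. In a symmetric digraph
  every edge, traversed back and forth, is a directed cycle of length 2, which is not a cycle of the
  undirected graph; the undirected cycles are the directed ones of length at least 3.
\<close>

definition undirected_tree :: "'v pair_pre_digraph \<Rightarrow> bool" where
  "undirected_tree G \<longleftrightarrow>
     Digraph_Component.connected (with_proj G) \<and>
     \<not> (\<exists>p. pre_digraph.cycle (with_proj G) p \<and> 3 \<le> length p)"

definition dendric_word :: "(int \<Rightarrow> 'a) set \<Rightarrow> 'a list \<Rightarrow> bool" where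
  "dendric_word X w \<longleftrightarrow> undirected_tree (extension_graph X w)"

definition dendric :: "(int \<Rightarrow> 'a) set \<Rightarrow> bool" where
  "dendric X \<longleftrightarrow> (\<forall>w \<in> language X. dendric_word X w)"


section \<open>Free groups\<close>

text \<open>
  The elements of the free group on \<open>A\<close> are the reduced words over signed letters, where
  \<open>(True, a)\<close> stands for \<open>a\<close> and \<open>(False, a)\<close> for its inverse.
\<close>

type_synonym 'a sword = "(bool \<times> 'a) list"

definition flip :: "bool \<times> 'a \<Rightarrow> bool \<times> 'a" where
  "flip x = (\<not> fst x, snd x)"

definition reduced :: "'a sword \<Rightarrow> bool" where
  "reduced u \<longleftrightarrow> successively (\<lambda>x y. y \<noteq> flip x) u"

text \<open>For reduced \<open>u\<close>, the word \<open>cancel_cons x u\<close> is the reduced form of \<open>x # u\<close>.\<close>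

fun cancel_cons :: "bool \<times> 'a \<Rightarrow> 'a sword \<Rightarrow> 'a sword" where
  "cancel_cons x [] = [x]"
| "cancel_cons x (y # u) = (if y = flip x then u else x # y # u)"

definition free_group :: "'a set \<Rightarrow> 'a sword monoid" where
  "free_group A =
     \<lparr> carrier = {u. snd ` set u \<subseteq> A \<and> reduced u},
       monoid.mult = (\<lambda>u v. foldr cancel_cons u v),
       monoid.one = [] \<rparr>"

text \<open>The extension of a map \<open>f\<close> from letters to \<open>G\<close> to a homomorphism from the free group to \<open>G\<close>:\<close>

definition lift :: "('g, 'm) monoid_scheme \<Rightarrow> ('a \<Rightarrow> 'g) \<Rightarrow> 'a sword \<Rightarrow> 'g" where
  "lift G f u =
     foldr (\<lambda>(s, a) g. (if s then f a else inv\<^bsub>G\<^esub> (f a)) \<otimes>\<^bsub>G\<^esub> g) u \<one>\<^bsub>G\<^esub>"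

definition free_basis :: "('g, 'm) monoid_scheme \<Rightarrow> 'g set \<Rightarrow> bool" where
  "free_basis G B \<longleftrightarrow> B \<subseteq> carrier G \<and> lift G (\<lambda>b. b) \<in> iso (free_group B) G"

text \<open>The inclusion of the free monoid into the free group:\<close>

definition pos :: "'a list \<Rightarrow> 'a sword" where
  "pos w = map (Pair True) w"


section \<open>Tame bases\<close>

definition alpha :: "'a \<Rightarrow> 'a \<Rightarrow> 'a \<Rightarrow> 'a list" where
  "alpha a b c = (if c = a then [a, b] else [c])"

definition alpha_tilde :: "'a \<Rightarrow> 'a \<Rightarrow> 'a \<Rightarrow> 'a list" where
  "alpha_tilde a b c = (if c = a then [b, a] else [c])"

definition extend :: "'a set \<Rightarrow> ('a \<Rightarrow> 'a list) \<Rightarrow> 'a sword \<Rightarrow> 'a sword" where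
  "extend A f = lift (free_group A) (\<lambda>a. pos (f a))"

inductive_set tame_morphisms :: "'a set \<Rightarrow> ('a sword \<Rightarrow> 'a sword) set" for A :: "'a set" where
  perm: "p permutes A \<Longrightarrow> extend A (\<lambda>a. [p a]) \<in> tame_morphisms A"
| alpha: "\<lbrakk>a \<in> A; b \<in> A; a \<noteq> b\<rbrakk> \<Longrightarrow> extend A (alpha a b) \<in> tame_morphisms A"
| alpha_tilde: "\<lbrakk>a \<in> A; b \<in> A; a \<noteq> b\<rbrakk> \<Longrightarrow> extend A (alpha_tilde a b) \<in> tame_morphisms A"
| comp: "\<lbrakk>\<phi> \<in> tame_morphisms A; \<psi> \<in> tame_morphisms A\<rbrakk> \<Longrightarrow> \<phi> \<circ> \<psi> \<in> tame_morphisms A"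

definition tame_basis :: "'a set \<Rightarrow> 'a sword set \<Rightarrow> bool" where
  "tame_basis A B \<longleftrightarrow>
     free_basis (free_group A) B \<and>
     (\<exists>\<phi> \<in> tame_morphisms A. B = \<phi> ` (\<lambda>a. pos [a]) ` A)"


section \<open>Basic facts on free groups\<close>

lemma flip_flip [simp]: "flip (flip x) = x"
  by (simp add: flip_def)

lemma snd_flip [simp]: "snd (flip x) = snd x"
  by (simp add: flip_def)

lemma flip_neq [simp]: "flip x \<noteq> x" "x \<noteq> flip x"
  by (metis flip_def fst_conv)+

lemma reduced_cancel_cons:
  assumes "reduced u"
  shows "reduced (cancel_cons x u)"
  using assms by (cases u) (auto simp: reduced_def successively_Cons)

lemma reduced_foldr:
  assumes "reduced v"
  shows "reduced (foldr cancel_cons u v)"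
  using assms by (induction u) (auto intro: reduced_cancel_cons)

lemma letters_cancel_cons: "set (cancel_cons x u) \<subseteq> insert x (set u)"
  by (cases u) auto

lemma letters_foldr: "set (foldr cancel_cons u v) \<subseteq> set u \<union> set v"
  using letters_cancel_cons by (induction u) fastforce+

lemma cancel_cons_flip:
  assumes "reduced u"
  shows "cancel_cons (flip x) (cancel_cons x u) = u"
proof (cases u)
  case (Cons y ys)
  show ?thesis
    using assms unfolding Cons by (cases ys) (auto simp: reduced_def)
qed simp

lemma cancel_cons_flip':
  assumes "reduced u"
  shows "cancel_cons x (cancel_cons (flip x) u) = u"
  using cancel_cons_flip[OF assms, of "flip x"] by simp

lemma foldr_cancel_cons:
  assumes "reduced w"
  shows "foldr cancel_cons (cancel_cons x v) w = cancel_cons x (foldr cancel_cons v w)"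
  by (cases v) (simp_all add: cancel_cons_flip' reduced_foldr assms)

lemma foldr_cancel_cons_assoc:
  assumes "reduced w"
  shows "foldr cancel_cons (foldr cancel_cons u v) w = foldr cancel_cons u (foldr cancel_cons v w)"
  by (induction u) (simp_all add: foldr_cancel_cons assms)

lemma foldr_cancel_cons_inverse:
  assumes "reduced u"
  shows "foldr cancel_cons (rev (map flip u)) u = []"
  using assms by (induction u) (auto simp: reduced_def successively_Cons)

lemma group_free_group: "group (free_group A)"
proof (rule groupI)
  fix u v assume "u \<in> carrier (free_group A)" "v \<in> carrier (free_group A)"
  then show "u \<otimes>\<^bsub>free_group A\<^esub> v \<in> carrier (free_group A)"
    using letters_foldr[of u v] by (fastforce simp: free_group_def reduced_foldr)
next
  fix u assume u: "u \<in> carrier (free_group A)"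
  let ?v = "foldr cancel_cons (rev (map flip u)) []"
  have "?v \<in> carrier (free_group A)"
    using u letters_foldr[of "rev (map flip u)" "[]"]
    by (fastforce simp: free_group_def reduced_def intro!: reduced_foldr[unfolded reduced_def])
  moreover have "?v \<otimes>\<^bsub>free_group A\<^esub> u = \<one>\<^bsub>free_group A\<^esub>"
    using u by (simp add: free_group_def foldr_cancel_cons_assoc foldr_cancel_cons_inverse)
  ultimately show "\<exists>v \<in> carrier (free_group A). v \<otimes>\<^bsub>free_group A\<^esub> u = \<one>\<^bsub>free_group A\<^esub>"
    by blast
qed (auto simp: free_group_def reduced_def foldr_cancel_cons_assoc)

lemma lift_hom:
  assumes "group G" and f: "f \<in> A \<rightarrow> carrier G"
  shows "lift G f \<in> hom (free_group A) G"
proof -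
  interpret group G by fact
  define val where "val = (\<lambda>(s, a). if s then f a else inv\<^bsub>G\<^esub> (f a))"
  have L: "lift G f [] = \<one>\<^bsub>G\<^esub>" "lift G f (x # u) = val x \<otimes>\<^bsub>G\<^esub> lift G f u" for x u
    by (auto simp: lift_def val_def split: prod.splits)
  have val: "val x \<in> carrier G" if "snd x \<in> A" for x
    using f that by (cases x) (auto simp: val_def)
  have inv: "val x \<otimes>\<^bsub>G\<^esub> val (flip x) = \<one>\<^bsub>G\<^esub>" if "snd x \<in> A" for x
    using f that by (cases x) (auto simp: val_def flip_def Pi_iff)
  have closed: "lift G f u \<in> carrier G" if "snd ` set u \<subseteq> A" for u
    using that by (induction u) (auto simp: L val)
  have cons: "lift G f (cancel_cons x u) = val x \<otimes>\<^bsub>G\<^esub> lift G f u"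
    if "snd x \<in> A" "snd ` set u \<subseteq> A" for x u
  proof (cases u)
    case (Cons y ys)
    then show ?thesis
      using that by (auto simp: L val closed inv m_assoc[symmetric])
  qed (simp add: L)
  have "lift G f (foldr cancel_cons u v) = lift G f u \<otimes>\<^bsub>G\<^esub> lift G f v"
    if "snd ` set u \<subseteq> A" "snd ` set v \<subseteq> A" for u v
    using that(1)
  proof (induction u)
    case (Cons x u)
    have "snd ` set (foldr cancel_cons u v) \<subseteq> A"
      using letters_foldr[of u v] Cons.prems that(2) by fastforce
    then show ?case
      using Cons that(2) by (auto simp: L cons val closed m_assoc)
  qed (simp add: L closed that)
  then show ?thesis
    by (auto simp: hom_def free_group_def closed)
qed

lemma pos_append: "pos (u @ v) = pos u \<otimes>\<^bsub>free_group A\<^esub> pos v"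
proof -
  have cons: "cancel_cons (True, a) (pos w) = (True, a) # pos w" for a and w :: "'a list"
    by (cases w) (auto simp: pos_def flip_def)
  have "foldr cancel_cons (pos u) (pos v) = pos (u @ v)"
  proof (induction u)
    case (Cons a u)
    have "pos (a # u) = (True, a) # pos u"
      by (simp add: pos_def)
    then show ?case
      using Cons cons[of a "u @ v"] by (simp add: pos_def)
  qed (simp add: pos_def)
  then show ?thesis
    by (simp add: free_group_def)
qed

lemma pos_in_carrier:
  assumes "w \<in> lists A"
  shows "pos w \<in> carrier (free_group A)"
proof -
  have "reduced (pos w)"
    unfolding reduced_def pos_def flip_def
    by (induction w) (auto simp: successively_Cons hd_map)
  then show ?thesis
    using assms by (auto simp: free_group_def pos_def)
qed

end

theory Submission
  imports Defs "HOL-Algebra.Generated_Groups" "HOL-Algebra.Bij" "HOL-Library.Sublist"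
begin

text \<open>
  Connectedness and acyclicity of the extension graph \<open>E(w)\<close> are both used through boolean labellings:
  a graph is connected if labellings that agree along edges are constant, and it is a forest if every
  labelling of the edges is the coboundary of a labelling of the vertices.

  If all return sets are bases, a colouring of \<open>E(w)\<close> that is constant along edges defines a
  homomorphism from the free group to a group with two elements that vanishes on the generating set
  \<open>R(wb)\<close>; hence all \<open>E(w)\<close> are connected. Moreover \<open>|R(w)| = |A| + \<Sigma> m(v)\<close>, where \<open>v\<close> ranges over the
  words that avoid \<open>w\<close> and \<open>m(v)\<close> is the number of edges minus the number of vertices plus one
  of \<open>E(v)\<close>. As \<open>|R(w)| = |A|\<close> and \<open>m \<ge> 0\<close>, all \<open>E(v)\<close> are trees.

  Conversely, if \<open>X\<close> is dendric, then \<open>|R(w)| = |A|\<close> by the same formula, and folding the Rauzy graphs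
  down to order zero shows that \<open>R(w)\<close> generates. In a generating set of \<open>|A|\<close> words of the language,
  replace \<open>yt\<close> or \<open>ty\<close> by \<open>t\<close> as long as possible; each replacement undoes an elementary tame
  morphism. The process ends with a bifix code, and acyclicity implies that the Stallings graph of a
  bifix code contained in the language needs no folding beyond its initial identifications, so that
  it generates only if it consists of letters.
\<close>

section \<open>Connected and acyclic bipartite relations\<close>

text \<open>Labellings with two values link graphs and groups: a labelling of a basis is a
  homomorphism to the group of order two, so ranks are compared by counting such homomorphisms. In
  coboundary form, forests pass to subrelations and can be assembled from a quotient and its fibres.
  This matters because dendricity speaks of extensions by single letters, whereas the Stallings
  argument needs forests with a suffix code on the left and a prefix code on the right. The obstacle
  there is an apparent circle: the left and right parts met along a chain of identified cuts must be
  such codes before acyclicity can be applied to them, and that they are codes is itself a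
  consequence of acyclicity. Induction on the length of the chain breaks the circle, only the two
  ends being new. Return words need not form a bifix code, as \<open>a\<close> and \<open>ab\<close>
  can both be return words to \<open>a\<close>, and the replacements may leave the return words; so
  the reduction to letters is carried out for arbitrary generating subsets of the language of the
  right size.\<close>

definition connected_rel :: "'a set \<Rightarrow> 'b set \<Rightarrow> ('a \<times> 'b) set \<Rightarrow> bool" where
  "connected_rel P Q E \<longleftrightarrow>
     (\<forall>l r. (\<forall>a b. (a, b) \<in> E \<longrightarrow> l a \<longleftrightarrow> r b) \<longrightarrow> (\<exists>c. (\<forall>a \<in> P. l a = c) \<and> (\<forall>b \<in> Q. r b = c)))"

text \<open>Vanishing first cohomology with coefficients of order two. Isolated vertices do not
  matter, so no vertex sets occur. Writing the coboundary as
  \<open>l a \<longleftrightarrow> r b\<close> instead of a difference only complements one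
  side.\<close>

definition forest_rel :: "('a \<times> 'b) set \<Rightarrow> bool" where
  "forest_rel E \<longleftrightarrow>
     (\<forall>f. \<exists>l r. \<forall>a b. (a, b) \<in> E \<longrightarrow> f a b \<longleftrightarrow> (l a \<longleftrightarrow> r b))"

lemma forest_relI:
  assumes "\<And>f. \<exists>l r. \<forall>a b. (a, b) \<in> E \<longrightarrow> f a b \<longleftrightarrow> (l a \<longleftrightarrow> r b)"
  shows "forest_rel E"
  using assms by (simp only: forest_rel_def simp_thms)

lemma forest_relE:
  fixes E :: "('a \<times> 'b) set"
  assumes "forest_rel E"
  obtains l r where "\<And>a b. (a, b) \<in> E \<Longrightarrow> f a b \<longleftrightarrow> (l a \<longleftrightarrow> r b)"
proof -
  have "\<exists>l r. \<forall>a b. (a, b) \<in> E \<longrightarrow> f a b \<longleftrightarrow> (l a \<longleftrightarrow> r b)"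
    using assms by (simp only: forest_rel_def simp_thms)
  then show ?thesis using that by blast
qed

lemma connected_relE:
  fixes l :: "'a \<Rightarrow> bool" and r :: "'b \<Rightarrow> bool"
  assumes "connected_rel P Q E" "\<And>a b. (a, b) \<in> E \<Longrightarrow> l a \<longleftrightarrow> r b"
  obtains c where "\<And>a. a \<in> P \<Longrightarrow> l a = c" "\<And>b. b \<in> Q \<Longrightarrow> r b = c"
proof -
  have "\<exists>c. (\<forall>a \<in> P. l a = c) \<and> (\<forall>b \<in> Q. r b = c)"
    using assms(1)[unfolded connected_rel_def, rule_format, of l r] assms(2) by blast
  then show ?thesis using that by blast
qed

text \<open>The coboundary map from colourings of the vertices (with \<open>a0\<close> uncoloured) to subsets of
  \<open>E\<close> is injective, and it is surjective exactly when \<open>E\<close> forest_rel.\<close>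

lemma connected_rel_card:
  fixes P :: "'a set" and Q :: "'b set"
  assumes fin: "finite P" "finite Q" and E: "E \<subseteq> P \<times> Q" and "P \<noteq> {}" and mono: "connected_rel P Q E"
  shows "card P + card Q \<le> card E + 1" "forest_rel E \<longleftrightarrow> card E + 1 = card P + card Q"
proof -
  obtain a0 where a0: "a0 \<in> P" using \<open>P \<noteq> {}\<close> by blast
  define D where "D = Pow (P - {a0}) \<times> Pow Q"
  define \<delta> where "\<delta> = (\<lambda>(S, T). {(a, b) \<in> E. (a \<in> S) \<noteq> (b \<in> T)})"
  have finE: "finite E" using fin E finite_subset by blast
  have cP: "card P > 0" using a0 fin card_gt_0_iff by blast
  have cD: "card D = 2 ^ (card P - 1 + card Q)"
    using fin a0 by (simp add: D_def card_cartesian_product card_Pow power_add)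
  have inj: "inj_on \<delta> D"
  proof (rule inj_onI, clarify)
    fix S T S' T' assume st: "(S, T) \<in> D" "(S', T') \<in> D" and eq: "\<delta> (S, T) = \<delta> (S', T')"
    have "((a \<in> S) \<noteq> (a \<in> S')) = ((b \<in> T) \<noteq> (b \<in> T'))" if "(a, b) \<in> E" for a b
    proof -
      have "(a, b) \<in> \<delta> (S, T) \<longleftrightarrow> (a, b) \<in> \<delta> (S', T')" by (simp only: eq)
      then show ?thesis using that by (auto simp: \<delta>_def)
    qed
    then obtain c where c: "\<And>a. a \<in> P \<Longrightarrow> ((a \<in> S) \<noteq> (a \<in> S')) = c"
      "\<And>b. b \<in> Q \<Longrightarrow> ((b \<in> T) \<noteq> (b \<in> T')) = c"
      using connected_relE[OF mono, of "\<lambda>a. (a \<in> S) \<noteq> (a \<in> S')" "\<lambda>b. (b \<in> T) \<noteq> (b \<in> T')"] by blast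
    have "c = False" using c(1)[OF a0] st by (auto simp: D_def)
    then show "S = S' \<and> T = T'" using c st by (auto simp: D_def)
  qed
  have sub: "\<delta> ` D \<subseteq> Pow E" by (auto simp: \<delta>_def)
  have cI: "card (\<delta> ` D) = 2 ^ (card P - 1 + card Q)" using card_image[OF inj] cD by simp
  have "(2::nat) ^ (card P - 1 + card Q) \<le> 2 ^ card E"
    using card_mono[OF _ sub] finE cI by (simp add: card_Pow)
  then show "card P + card Q \<le> card E + 1" using cP by simp
  have "forest_rel E \<longleftrightarrow> \<delta> ` D = Pow E"
  proof
    assume sp: "forest_rel E"
    have "F \<in> \<delta> ` D" if "F \<subseteq> E" for F
    proof -
      obtain l r where lr: "\<And>a b. (a, b) \<in> E \<Longrightarrow> ((a, b) \<in> F) \<longleftrightarrow> (l a \<longleftrightarrow> r b)"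
        using forest_relE[OF sp, of "\<lambda>a b. (a, b) \<in> F"] by blast
      \<comment> \<open>Normalised so that \<open>a0\<close> lies outside \<open>S\<close>. The
        coboundary \<open>\<delta>\<close> marks unequal membership while \<open>F\<close> consists
        of the edges where \<open>l\<close> and \<open>r\<close> agree, so \<open>T\<close> uses the
        opposite convention to \<open>S\<close>.\<close>
      define S where "S = {a \<in> P. l a \<noteq> l a0}"
      define T where "T = {b \<in> Q. r b = l a0}"
      have "(S, T) \<in> D" using a0 by (auto simp: S_def T_def D_def)
      moreover have "\<delta> (S, T) = F"
      proof -
        have "(a \<in> S) \<noteq> (b \<in> T) \<longleftrightarrow> (a, b) \<in> F" if "(a, b) \<in> E" for a b
          using lr[OF that] that E by (auto simp: S_def T_def)
        then show ?thesis using that by (auto simp: \<delta>_def)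
      qed
      ultimately show ?thesis by blast
    qed
    then show "\<delta> ` D = Pow E" using sub by blast
  next
    assume eq: "\<delta> ` D = Pow E"
    show "forest_rel E"
      proof (rule forest_relI)
      fix f
      have "{(a, b) \<in> E. f a b} \<in> \<delta> ` D" unfolding eq by blast
      then obtain S T where "\<delta> (S, T) = {(a, b) \<in> E. f a b}" by auto
      then have "\<forall>a b. (a, b) \<in> E \<longrightarrow> f a b \<longleftrightarrow> (a \<in> S \<longleftrightarrow> b \<notin> T)" by (auto simp: \<delta>_def set_eq_iff)
      then show "\<exists>l r. \<forall>a b. (a, b) \<in> E \<longrightarrow> f a b \<longleftrightarrow> (l a \<longleftrightarrow> r b)"
        by (intro exI[of _ "\<lambda>a. a \<in> S"] exI[of _ "\<lambda>b. b \<notin> T"])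
    qed
  qed
  also have "\<dots> \<longleftrightarrow> card (\<delta> ` D) = card (Pow E)"
    using card_subset_eq[OF _ sub] finE by auto
  also have "\<dots> \<longleftrightarrow> card E + 1 = card P + card Q"
    using cI cP finE by (auto simp: card_Pow)
  finally show "forest_rel E \<longleftrightarrow> card E + 1 = card P + card Q" .
qed

lemma forest_rel_subset:
  assumes "forest_rel E" "E' \<subseteq> E"
  shows "forest_rel E'"
proof (rule forest_relI)
  fix f
  obtain l r where "\<And>a b. (a, b) \<in> E \<Longrightarrow> f a b \<longleftrightarrow> (l a \<longleftrightarrow> r b)"
    using forest_relE[OF assms(1), of f] by blast
  then show "\<exists>l r. \<forall>a b. (a, b) \<in> E' \<longrightarrow> f a b \<longleftrightarrow> (l a \<longleftrightarrow> r b)"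
    using assms(2) by (intro exI[of _ l] exI[of _ r]) auto
qed

lemma forest_rel_converse: "forest_rel E \<Longrightarrow> forest_rel (E\<inverse>)"
proof -
  assume "forest_rel E"
  show "forest_rel (E\<inverse>)"
  proof (rule forest_relI)
    fix f :: "'b \<Rightarrow> 'a \<Rightarrow> bool"
    obtain l r where "\<And>a b. (a, b) \<in> E \<Longrightarrow> f b a \<longleftrightarrow> (l a \<longleftrightarrow> r b)"
      using forest_relE[OF \<open>forest_rel E\<close>, of "\<lambda>a b. f b a"] by blast
    then show "\<exists>l r. \<forall>a b. (a, b) \<in> E\<inverse> \<longrightarrow> f a b \<longleftrightarrow> (l a \<longleftrightarrow> r b)"
      by (intro exI[of _ r] exI[of _ l]) auto
  qed
qed

text \<open>On each fibre \<open>f\<close> is a coboundary, but the left labelling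
  \<open>l z\<close> depends on the fibre. Seen as a labelling of the edges \<open>(u, z)\<close> of
  the quotient, this dependence is a coboundary again, and adding its right part to \<open>r\<close>
  gives one labelling of the whole.\<close>

lemma forest_rel_collapse_right:
  assumes E': "forest_rel ((\<lambda>(u, v). (u, \<pi> v)) ` E)"
    and fib: "\<And>z. forest_rel {(u, v) \<in> E. \<pi> v = z}"
  shows "forest_rel E"
proof (rule forest_relI)
  fix f
  have "\<exists>l r. \<forall>u v. (u, v) \<in> E \<longrightarrow> \<pi> v = z \<longrightarrow> f u v \<longleftrightarrow> (l u \<longleftrightarrow> r v)" for z
  proof -
    obtain l r where "\<And>u v. (u, v) \<in> {(u, v) \<in> E. \<pi> v = z} \<Longrightarrow> f u v \<longleftrightarrow> (l u \<longleftrightarrow> r v)"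
      using forest_relE[OF fib[of z], of f] by blast
    then show ?thesis by (intro exI[of _ l] exI[of _ r]) auto
  qed
  then obtain l r where lr: "\<And>z u v. (u, v) \<in> E \<Longrightarrow> \<pi> v = z \<Longrightarrow> f u v \<longleftrightarrow> (l z u \<longleftrightarrow> r z v)"
    by metis
  obtain L R where "\<And>u z. (u, z) \<in> ((\<lambda>(u, v). (u, \<pi> v)) ` E) \<Longrightarrow> l z u \<longleftrightarrow> (L u \<longleftrightarrow> R z)"
    using forest_relE[OF E', of "\<lambda>u z. l z u"] by blast
  then have LR: "(u, v) \<in> E \<Longrightarrow> l (\<pi> v) u \<longleftrightarrow> (L u \<longleftrightarrow> R (\<pi> v))" for u v
    by force
  have "(u, v) \<in> E \<Longrightarrow> f u v \<longleftrightarrow> (L u \<longleftrightarrow> (R (\<pi> v) \<longleftrightarrow> r (\<pi> v) v))" for u v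
    using lr[of u v "\<pi> v"] LR[of u v] by blast
  then show "\<exists>l r. \<forall>a b. (a, b) \<in> E \<longrightarrow> f a b \<longleftrightarrow> (l a \<longleftrightarrow> r b)"
    by (intro exI[of _ L] exI[of _ "\<lambda>v. R (\<pi> v) \<longleftrightarrow> r (\<pi> v) v"]) auto
qed

lemma forest_rel_collapse_left:
  assumes E': "forest_rel ((\<lambda>(u, v). (\<pi> u, v)) ` E)"
    and fib: "\<And>z. forest_rel {(u, v) \<in> E. \<pi> u = z}"
  shows "forest_rel E"
proof -
  have "forest_rel ((E\<inverse>)\<inverse>)"
  proof (rule forest_rel_converse, rule forest_rel_collapse_right[where \<pi> = \<pi>])
    show "forest_rel ((\<lambda>(v, u). (v, \<pi> u)) ` (E\<inverse>))"
      using forest_rel_converse[OF E'] by (rule forest_rel_subset) auto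
    show "forest_rel {(v, u) \<in> E\<inverse>. \<pi> u = z}" for z
      using forest_rel_converse[OF fib[of z]] by (rule forest_rel_subset) auto
  qed
  then show ?thesis by simp
qed

lemma forest_rel_singleton_left: "forest_rel E" if "fst ` E \<subseteq> {x}"
proof (rule forest_relI)
  fix f
  show "\<exists>l r. \<forall>a b. (a, b) \<in> E \<longrightarrow> f a b \<longleftrightarrow> (l a \<longleftrightarrow> r b)"
    using that by (intro exI[of _ "\<lambda>_. True"] exI[of _ "\<lambda>b. f x b"]) force
qed

lemma forest_rel_singleton_right: "forest_rel E" if "snd ` E \<subseteq> {x}"
proof -
  have "forest_rel (E\<inverse>)" using that by (intro forest_rel_singleton_left[of _ x]) force
  then show ?thesis using forest_rel_converse by force
qed

lemma forest_rel_map: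
  assumes E: "forest_rel E" and g: "inj g" and h: "inj h"
  shows "forest_rel ((\<lambda>(a, b). (g a, h b)) ` E)"
proof (rule forest_relI)
  fix f
  obtain l r where lr: "\<And>a b. (a, b) \<in> E \<Longrightarrow> f (g a) (h b) \<longleftrightarrow> (l a \<longleftrightarrow> r b)"
    using forest_relE[OF E, of "\<lambda>a b. f (g a) (h b)"] by blast
  show "\<exists>l r. \<forall>x y. (x, y) \<in> (\<lambda>(a, b). (g a, h b)) ` E \<longrightarrow> f x y \<longleftrightarrow> (l x \<longleftrightarrow> r y)"
    using lr g h by (intro exI[of _ "l \<circ> inv_into UNIV g"] exI[of _ "r \<circ> inv_into UNIV h"]) auto
qed

section \<open>Bipartite relations as undirected graphs\<close>

definition bigraph :: "'a set \<Rightarrow> 'b set \<Rightarrow> ('a \<times> 'b) set \<Rightarrow> ('a + 'b) pair_pre_digraph" where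
  "bigraph P Q E = \<lparr> pverts = P <+> Q, parcs = (\<Union>(a, b) \<in> E. {(Inl a, Inr b), (Inr b, Inl a)}) \<rparr>"

lemma pverts_bigraph [simp]: "pverts (bigraph P Q E) = P <+> Q"
  and mem_parcs_bigraph:
    "g \<in> parcs (bigraph P Q E) \<longleftrightarrow> (\<exists>a b. (a, b) \<in> E \<and> (g = (Inl a, Inr b) \<or> g = (Inr b, Inl a)))"
  by (auto simp: bigraph_def)

lemma wf_digraph_bigraph:
  assumes "E \<subseteq> P \<times> Q"
  shows "wf_digraph (with_proj (bigraph P Q E))"
  using assms by unfold_locales (auto simp: mem_parcs_bigraph)

lemma awalk_bigraph_iff:
  "pre_digraph.awalk (with_proj (bigraph P Q E)) u p v \<longleftrightarrow>
     u \<in> P <+> Q \<and> set p \<subseteq> parcs (bigraph P Q E) \<and> pcas u p v"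
  by (simp add: pre_digraph.awalk_def cas_with_proj_eq)

lemma reachable_bigraph_colour:
  assumes E: "E \<subseteq> P \<times> Q" and reach: "u \<rightarrow>\<^sup>*\<^bsub>with_proj (bigraph P Q E)\<^esub> v"
    and lr: "\<And>a b. (a, b) \<in> E \<Longrightarrow> l a \<longleftrightarrow> r b"
  shows "case_sum l r u \<longleftrightarrow> case_sum l r v"
proof -
  interpret wf_digraph "with_proj (bigraph P Q E)" using E by (rule wf_digraph_bigraph)
  show ?thesis
    using reach
  proof (induction rule: reachable_induct)
    case (step x y)
    then show ?case using lr by (fastforce simp: mem_parcs_bigraph)
  qed simp
qed

lemma reachable_bigraph_edge:
  assumes E: "E \<subseteq> P \<times> Q" and ab: "(a, b) \<in> E"
  shows "u \<rightarrow>\<^sup>*\<^bsub>with_proj (bigraph P Q E)\<^esub> Inl a \<longleftrightarrow> u \<rightarrow>\<^sup>*\<^bsub>with_proj (bigraph P Q E)\<^esub> Inr b"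
proof -
  interpret wf_digraph "with_proj (bigraph P Q E)" using E by (rule wf_digraph_bigraph)
  have "Inl a \<rightarrow>\<^bsub>with_proj (bigraph P Q E)\<^esub> Inr b" "Inr b \<rightarrow>\<^bsub>with_proj (bigraph P Q E)\<^esub> Inl a"
    using ab by (auto simp: mem_parcs_bigraph)
  then show ?thesis using reachable_adj_trans by blast
qed

text \<open>Reachability from a fixed vertex is constant along edges, so it is the labelling to
  which \<open>connected_rel\<close> is applied.\<close>

lemma connected_bigraph_iff:
  assumes E: "E \<subseteq> P \<times> Q" and ne: "P <+> Q \<noteq> {}"
  shows "Digraph_Component.connected (with_proj (bigraph P Q E)) \<longleftrightarrow> connected_rel P Q E"
proof -
  let ?G = "with_proj (bigraph P Q E)"
  interpret wf_digraph ?G using E by (rule wf_digraph_bigraph)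
  have sym: "symmetric ?G" by (auto simp: symmetric_def mem_parcs_bigraph intro!: symI)
  have "Digraph_Component.connected ?G \<longleftrightarrow> (\<forall>u \<in> P <+> Q. \<forall>v \<in> P <+> Q. u \<rightarrow>\<^sup>*\<^bsub>?G\<^esub> v)"
    using ne by (simp add: Digraph_Component.connected_def strongly_connected_def
        reachable_mk_symmetric_eq[OF sym])
  also have "\<dots> \<longleftrightarrow> connected_rel P Q E"
  proof (intro iffI ballI)
    assume conn: "\<forall>u \<in> P <+> Q. \<forall>v \<in> P <+> Q. u \<rightarrow>\<^sup>*\<^bsub>?G\<^esub> v"
    obtain u where u: "u \<in> P <+> Q" using ne by blast
    show "connected_rel P Q E"
      unfolding connected_rel_def
    proof (intro allI impI exI[of _ "case_sum _ _ u"])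
      fix l r assume lr: "\<forall>a b. (a, b) \<in> E \<longrightarrow> l a \<longleftrightarrow> r b"
      have "case_sum l r u \<longleftrightarrow> case_sum l r v" if "v \<in> P <+> Q" for v
        using reachable_bigraph_colour[OF E] conn u that lr by blast
      from this[of "Inl _"] this[of "Inr _"]
      show "(\<forall>a \<in> P. l a = case_sum l r u) \<and> (\<forall>b \<in> Q. r b = case_sum l r u)" by auto
    qed
  next
    fix u v assume conn: "connected_rel P Q E" and uv: "u \<in> P <+> Q" "v \<in> P <+> Q"
    obtain c where c: "\<And>a. a \<in> P \<Longrightarrow> (u \<rightarrow>\<^sup>*\<^bsub>?G\<^esub> Inl a) = c" "\<And>b. b \<in> Q \<Longrightarrow> (u \<rightarrow>\<^sup>*\<^bsub>?G\<^esub> Inr b) = c"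
      using connected_relE[OF conn, of "\<lambda>a. u \<rightarrow>\<^sup>*\<^bsub>?G\<^esub> Inl a" "\<lambda>b. u \<rightarrow>\<^sup>*\<^bsub>?G\<^esub> Inr b"]
        reachable_bigraph_edge[OF E, of _ _ u] by auto
    have "u \<rightarrow>\<^sup>*\<^bsub>?G\<^esub> u" using uv by simp
    then have c using c uv(1) by (elim PlusE) auto
    then show "u \<rightarrow>\<^sup>*\<^bsub>?G\<^esub> v" using c uv(2) by (elim PlusE) auto
  qed
  finally show ?thesis .
qed

text \<open>Take the labelling of edges that distinguishes the first edge of the cycle from all
  others. The vertex labels it comes from are constant along the rest of the cycle, which joins the
  two ends of that edge, yet differ across it.\<close>

lemma forest_rel_imp_no_cycle:
  fixes P :: "'a set" and Q :: "'b set"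
  assumes E: "E \<subseteq> P \<times> Q" and forest: "forest_rel E"
    and cyc: "pre_digraph.cycle (with_proj (bigraph P Q E)) p" and len: "3 \<le> length p"
  shows False
proof -
  let ?G = "with_proj (bigraph P Q E)"
  interpret wf_digraph ?G using E by (rule wf_digraph_bigraph)
  obtain u where u: "awalk u p u" "distinct (tl (awalk_verts u p))"
    using cyc by (auto simp: cycle_def)
  obtain e q where p: "p = e # q" using len by (cases p) auto
  obtain g q' where q: "q = g # q'" using p len by (cases q) auto
  have e: "e \<in> parcs (bigraph P Q E)" "fst e = u" and path: "apath (snd e) q u"
    using u p by (auto simp: awalk_simps apath_def)
  have g: "fst g = snd e" "apath (snd g) q' u" "snd e \<notin> set (awalk_verts (snd g) q')"
    using path q by (auto simp: apath_Cons_iff)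
  obtain a b where ab: "(a, b) \<in> E" "e = (Inl a, Inr b) \<or> e = (Inr b, Inl a)"
    using e by (auto simp: mem_parcs_bigraph)
  \<comment> \<open>This is where length 3 counts: a return along the same edge would close the
    cycle after two steps.\<close>
  have "snd g \<noteq> u"
  proof
    assume "snd g = u"
    then have "q' = []" using g(2) apath_nonempty_ends by blast
    then show False using p q len by simp
  qed
  then have "g \<noteq> (snd e, fst e)" "g \<noteq> e" using e g(3) hd_in_awalk_verts(2)[OF g(2)] by auto
  moreover have "h \<noteq> (snd e, fst e)" "h \<noteq> e" if "h \<in> set q'" for h
  proof -
    have "awalk x s y \<Longrightarrow> h \<in> set s \<Longrightarrow> fst h \<in> set (awalk_verts x s) \<and> snd h \<in> set (awalk_verts x s)"
      for x s y
      by (induction s arbitrary: x) (auto simp: awalk_simps dest: hd_in_awalk_verts)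
    then have "fst h \<in> set (awalk_verts (snd g) q')" "snd h \<in> set (awalk_verts (snd g) q')"
      using that awalkI_apath[OF g(2)] by blast+
    then show "h \<noteq> (snd e, fst e)" "h \<noteq> e" using g(3) by auto
  qed
  ultimately have "h \<noteq> (snd e, fst e)" "h \<noteq> e" if "h \<in> set q" for h
    using that q by (metis set_ConsD)+
  then have avoid: "h \<noteq> (Inl a, Inr b)" "h \<noteq> (Inr b, Inl a)" if "h \<in> set q" for h
    using that ab(2) by fastforce+
  obtain l r where lr: "\<And>x y. (x, y) \<in> E \<Longrightarrow> (x, y) \<noteq> (a, b) \<longleftrightarrow> (l x \<longleftrightarrow> r y)"
    using forest_relE[OF forest, of "\<lambda>x y. (x, y) \<noteq> (a, b)"] by blast
  define \<chi> where "\<chi> = case_sum l r"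
  have "\<chi> (fst h) = \<chi> (snd h)" if "h \<in> set q" for h
  proof -
    have "h \<in> parcs (bigraph P Q E)" using that path by (auto simp: apath_def awalk_def)
    then obtain x y where xy: "(x, y) \<in> E" "h = (Inl x, Inr y) \<or> h = (Inr y, Inl x)"
      by (auto simp: mem_parcs_bigraph)
    then have "(x, y) \<noteq> (a, b)" using avoid[OF that] by blast
    then show ?thesis using lr[OF xy(1)] xy(2) by (auto simp: \<chi>_def)
  qed
  moreover have "awalk x q y \<Longrightarrow> (\<And>h. h \<in> set q \<Longrightarrow> \<chi> (fst h) = \<chi> (snd h)) \<Longrightarrow> \<chi> x = \<chi> y" for x y q
    by (induction q arbitrary: x) (auto simp: awalk_simps)
  ultimately have "\<chi> (snd e) = \<chi> u" using path by (auto simp: apath_def)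
  then show False using lr[OF ab(1)] ab(2) e by (auto simp: \<chi>_def)
qed

text \<open>Without cycles every edge is a bridge, and reachability from \<open>Inl a\<close> after
  deleting \<open>(a, b)\<close> is a vertex labelling that changes exactly across
  \<open>(a, b)\<close>. Every set of edges is a finite sum of such single edges.\<close>

lemma no_cycle_imp_forest_rel:
  fixes P :: "'a set" and Q :: "'b set"
  assumes E: "E \<subseteq> P \<times> Q" and fin: "finite E"
    and nocyc: "\<And>p. pre_digraph.cycle (with_proj (bigraph P Q E)) p \<Longrightarrow> \<not> 3 \<le> length p"
  shows "forest_rel E"
proof (rule forest_relI)
  fix f
  interpret G: wf_digraph "with_proj (bigraph P Q E)" using E by (rule wf_digraph_bigraph)
  have bridge: "\<exists>l r. \<forall>x y. (x, y) \<in> E \<longrightarrow> ((x, y) = (a, b)) \<longleftrightarrow> (l x \<longleftrightarrow> \<not> r y)" if ab: "(a, b) \<in> E" for a b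
  proof -
    let ?E = "E - {(a, b)}"
    have E': "?E \<subseteq> P \<times> Q" using E by blast
    interpret H: wf_digraph "with_proj (bigraph P Q ?E)" using E' by (rule wf_digraph_bigraph)
    have sub: "parcs (bigraph P Q ?E) \<subseteq> parcs (bigraph P Q E)" by (auto simp: mem_parcs_bigraph)
    have "\<not> Inl a \<rightarrow>\<^sup>*\<^bsub>with_proj (bigraph P Q ?E)\<^esub> Inr b"
    proof
      assume "Inl a \<rightarrow>\<^sup>*\<^bsub>with_proj (bigraph P Q ?E)\<^esub> Inr b"
      then obtain q where q: "H.apath (Inl a) q (Inr b)" by (auto simp: H.reachable_apath)
      let ?p = "(Inr b, Inl a) # q"
      have "G.awalk (Inl a) q (Inr b)"
        using q sub by (auto simp: H.apath_def awalk_bigraph_iff)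
      moreover have "(Inr b, Inl a) \<in> parcs (bigraph P Q E)" using ab by (auto simp: mem_parcs_bigraph)
      moreover have "distinct (G.awalk_verts (Inl a) q)"
        using q by (simp add: H.apath_def awalk_verts_with_proj_eq)
      ultimately have "G.cycle ?p"
        by (auto simp: G.cycle_def G.awalk_simps intro!: exI[of _ "Inr b"])
      \<comment> \<open>A path of length 0 would identify the two sides of the graph and one of
        length 1 would be the deleted edge, so the cycle \<open>?p\<close> has length at least
        3.\<close>
      moreover have "2 \<le> length q"
      proof (rule ccontr)
        assume "\<not> 2 \<le> length q"
        then consider "q = []" | g where "q = [g]" by (cases q; cases "tl q") auto
        then show False
        proof cases
          case 1
          then show False using q by (simp add: H.apath_simps)
        next
          case 2
          then show False using q by (auto simp: H.apath_simps mem_parcs_bigraph)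
        qed
      qed
      ultimately show False using nocyc[of ?p] by simp
    qed
    moreover have "Inl a \<rightarrow>\<^sup>*\<^bsub>with_proj (bigraph P Q ?E)\<^esub> Inl a" using ab E by auto
    ultimately show ?thesis
      using reachable_bigraph_edge[OF E', of _ _ "Inl a"]
      by (intro exI[of _ "\<lambda>x. Inl a \<rightarrow>\<^sup>*\<^bsub>with_proj (bigraph P Q ?E)\<^esub> Inl x"]
            exI[of _ "\<lambda>y. Inl a \<rightarrow>\<^sup>*\<^bsub>with_proj (bigraph P Q ?E)\<^esub> Inr y"]) auto
  qed
  have "\<exists>l r. \<forall>x y. (x, y) \<in> E \<longrightarrow> ((x, y) \<in> F) \<longleftrightarrow> (l x \<longleftrightarrow> \<not> r y)" if "finite F" "F \<subseteq> E" for F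
    using that
  proof (induction F rule: finite_induct)
    case empty
    then show ?case by (intro exI[of _ "\<lambda>_. True"]) auto
  next
    case (insert e F)
    obtain a b where e: "e = (a, b)" by force
    obtain l r where lr: "\<And>x y. (x, y) \<in> E \<Longrightarrow> ((x, y) \<in> F) \<longleftrightarrow> (l x \<longleftrightarrow> \<not> r y)" using insert by auto
    obtain l' r' where lr': "\<And>x y. (x, y) \<in> E \<Longrightarrow> ((x, y) = e) \<longleftrightarrow> (l' x \<longleftrightarrow> \<not> r' y)"
      using bridge[of a b] insert.prems e by auto
    have "((x, y) \<in> insert e F) \<longleftrightarrow> ((l x \<longleftrightarrow> l' x) \<longleftrightarrow> \<not> (r y \<longleftrightarrow> r' y))" if "(x, y) \<in> E" for x y
      using lr[OF that] lr'[OF that] insert.hyps by (metis insert_iff)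
    then show ?case
      by (intro exI[of _ "\<lambda>x. l x \<longleftrightarrow> l' x"] exI[of _ "\<lambda>y. r y \<longleftrightarrow> r' y"]) blast
  qed
  from this[of "{(x, y) \<in> E. f x y}"] fin
  have "\<exists>l r. \<forall>x y. (x, y) \<in> E \<longrightarrow> f x y \<longleftrightarrow> (l x \<longleftrightarrow> \<not> r y)" by (auto intro: rev_finite_subset)
  then obtain l r where "\<And>x y. (x, y) \<in> E \<Longrightarrow> f x y \<longleftrightarrow> (l x \<longleftrightarrow> \<not> r y)" by blast
  then show "\<exists>l r. \<forall>x y. (x, y) \<in> E \<longrightarrow> f x y \<longleftrightarrow> (l x \<longleftrightarrow> r y)"
    by (intro exI[of _ l] exI[of _ "\<lambda>y. \<not> r y"]) auto
qed

theorem undirected_tree_bigraph_iff: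
  assumes "E \<subseteq> P \<times> Q" "finite E" "P \<noteq> {}"
  shows "undirected_tree (bigraph P Q E) \<longleftrightarrow> connected_rel P Q E \<and> forest_rel E"
  using connected_bigraph_iff[OF assms(1)] forest_rel_imp_no_cycle[OF assms(1)]
    no_cycle_imp_forest_rel[OF assms(1,2)] assms(3)
  unfolding undirected_tree_def by (metis Plus_eq_empty_conv)

section \<open>Uniform recurrence\<close>

text \<open>Start and natural length instead of two integer bounds: factors then split by
  \<open>window_add\<close>.\<close>

definition window :: "(int \<Rightarrow> 'a) \<Rightarrow> int \<Rightarrow> nat \<Rightarrow> 'a list" where
  "window x i n = map (\<lambda>k. x (i + int k)) [0..<n]"

lemma length_window [simp]: "length (window x i n) = n"
  by (simp add: window_def)

lemma nth_window [simp]: "k < n \<Longrightarrow> window x i n ! k = x (i + int k)"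
  by (simp add: window_def)

lemma window_0 [simp]: "window x i 0 = []"
  by (simp add: window_def)

lemma window_add: "window x i (m + n) = window x i m @ window x (i + int m) n"
  by (rule nth_equalityI) (auto simp: nth_append algebra_simps of_nat_diff)

lemma window_1 [simp]: "window x i (Suc 0) = [x i]"
  by (simp add: window_def)

lemma language_eq_windows: "language X = {window x i n |x i n. x \<in> X}"
proof -
  have "map x [i..j] = window x i (nat (j - i + 1))" for x :: "int \<Rightarrow> 'a" and i j
    by (rule nth_equalityI) auto
  moreover have "window x i n = map x [i..i + int n - 1]" for x :: "int \<Rightarrow> 'a" and i n
    by (rule nth_equalityI) auto
  ultimately show ?thesis unfolding language_def by fast
qed

lemma windowI: "x \<in> X \<Longrightarrow> window x i n \<in> language X"
  by (auto simp: language_eq_windows)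

lemma languageE:
  assumes "w \<in> language X"
  obtains x i where "x \<in> X" "w = window x i (length w)"
  using assms by (auto simp: language_eq_windows)

lemma language_factor:
  assumes "p @ w @ s \<in> language X"
  shows "w \<in> language X"
proof -
  obtain x i where x: "x \<in> X" "p @ w @ s = window x i (length p + (length w + length s))"
    using assms by (auto elim: languageE)
  then have "w = window x (i + int (length p)) (length w)"
    unfolding window_add by simp
  then show ?thesis using x by (metis windowI)
qed

lemma language_appendD1: "u @ v \<in> language X \<Longrightarrow> u \<in> language X"
  using language_factor[of "[]" u v] by simp

lemma language_appendD2: "u @ v \<in> language X \<Longrightarrow> v \<in> language X"
  using language_factor[of u v "[]"] by simp

lemma language_ConsD: "a # v \<in> language X \<Longrightarrow> v \<in> language X"
  using language_appendD2[of "[a]" v] by simp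

lemma extend_right: "w \<in> language X \<Longrightarrow> \<exists>b. w @ [b] \<in> language X"
proof -
  assume "w \<in> language X"
  then obtain x i where x: "x \<in> X" "w = window x i (length w)" by (rule languageE)
  then have "w @ [x (i + int (length w))] = window x i (length w + 1)"
    unfolding window_add by simp
  then show ?thesis using x windowI by metis
qed

lemma extend_left: "w \<in> language X \<Longrightarrow> \<exists>a. a # w \<in> language X"
proof -
  assume "w \<in> language X"
  then obtain x i where x: "x \<in> X" "w = window x i (length w)" by (rule languageE)
  then have "x (i - 1) # w = window x (i - 1) (1 + length w)"
    unfolding window_add by simp
  then show ?thesis using x windowI by metis
qed

lemma extend_right_many: "w \<in> language X \<Longrightarrow> \<exists>s. length s = n \<and> w @ s \<in> language X"
proof (induction n)
  case (Suc n)
  then obtain s where s: "length s = n" "w @ s \<in> language X" by blast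
  then obtain b where "(w @ s) @ [b] \<in> language X" using extend_right by blast
  then show ?case using s by (intro exI[of _ "s @ [b]"]) auto
qed simp

lemma shift_space_translate:
  assumes "shift ` X = X" "x \<in> X"
  shows "(\<lambda>n. x (n + k)) \<in> X"
proof -
  have pos: "(\<lambda>n. x (n + int m)) \<in> X" if "x \<in> X" for x m
  proof (induction m)
    case (Suc m)
    have "(\<lambda>n. x (n + int (Suc m))) = shift (\<lambda>n. x (n + int m))"
      by (auto simp: shift_def algebra_simps)
    then show ?case using Suc assms(1) by (metis imageI)
  qed (simp add: that)
  \<comment> \<open>Translating backwards uses only that \<open>shift\<close> maps \<open>X\<close>
    onto itself, which supplies preimages.\<close>
  have neg: "\<exists>y \<in> X. (\<lambda>n. y (n + int m)) = x" if "x \<in> X" for x m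
  proof (induction m)
    case (Suc m)
    then obtain y where y: "y \<in> X" "(\<lambda>n. y (n + int m)) = x" by blast
    then obtain z where z: "z \<in> X" "y = shift z" using assms(1) by blast
    then have "(\<lambda>n. z (n + int (Suc m))) = x" using y by (auto simp: shift_def algebra_simps)
    then show ?case using z by blast
  qed (use that in auto)
  show ?thesis
  proof (cases "k \<ge> 0")
    case True
    then show ?thesis using pos[OF assms(2), of "nat k"] by simp
  next
    case False
    obtain y where y: "y \<in> X" "(\<lambda>n. y (n + int (nat (- k)))) = x" using neg[OF assms(2)] by blast
    then have "(\<lambda>n. x (n + k)) = y" using False by auto
    then show ?thesis using y by simp
  qed
qed

text \<open>Every letter has to occur in \<open>X\<close>: dendricity does not see the letters of
  \<open>A\<close> that do not, while words in the remaining letters could not generate the free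
  group on \<open>A\<close>.\<close>

locale minimal_shift =
  fixes A :: "'a set" and X :: "(int \<Rightarrow> 'a) set"
  assumes finite_A: "finite A"
    and minimal: "minimal_shift_space A X"
    and letters_in: "a \<in> A \<Longrightarrow> [a] \<in> language X"
begin

abbreviation "L \<equiv> language X"

lemma X_nonempty: "X \<noteq> {}"
  and closed: "closedin (product_topology (\<lambda>_::int. discrete_topology A) UNIV) X"
  and shift_X: "shift ` X = X"
  using minimal by (auto simp: minimal_shift_space_def shift_space_def)

lemma X_in_A: "x \<in> X \<Longrightarrow> x i \<in> A"
  using closedin_subset[OF closed] by (auto simp: PiE_iff)

lemma language_letters: "w \<in> L \<Longrightarrow> set w \<subseteq> A"
  using X_in_A by (auto simp: language_eq_windows window_def)

lemma Nil_in_language: "[] \<in> L"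
  using X_nonempty windowI[of _ X 0 0] by auto

lemma finite_language_length: "finite {w \<in> L. length w \<le> n}"
  by (rule finite_subset[OF _ finite_lists_length_le[OF finite_A, of n]]) (use language_letters in auto)

lemma closedin_avoiding:
  "closedin (product_topology (\<lambda>_::int. discrete_topology A) UNIV) {x \<in> X. window x i n \<noteq> w}"
proof -
  let ?T = "product_topology (\<lambda>_::int. discrete_topology A) UNIV"
  have cyl: "openin ?T {x \<in> topspace ?T. x j = a}" for j a
  proof -
    have "{x \<in> topspace ?T. x j = a} = {x \<in> topspace ?T. x j \<in> A \<inter> {a}}"
      by (auto simp: PiE_iff)
    moreover have "openin ?T \<dots>"
      by (rule openin_continuous_map_preimage[OF continuous_map_product_projection]) auto
    ultimately show ?thesis by simp
  qed
  have "openin ?T {x \<in> topspace ?T. window x i n = w}"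
  proof (cases "length w = n")
    case True
    have "{x \<in> topspace ?T. window x i n = w} =
        topspace ?T \<inter> (\<Inter>k \<in> {..<n}. {x \<in> topspace ?T. x (i + int k) = w ! k})"
      using True by (auto simp: list_eq_iff_nth_eq)
    moreover have "openin ?T \<dots>"
    proof (cases "n = 0")
      case False
      then show ?thesis using cyl by (intro openin_Int openin_topspace openin_INT2) auto
    qed (use openin_topspace[of ?T] in simp)
    ultimately show ?thesis by simp
  next
    case False
    then have "{x \<in> topspace ?T. window x i n = w} = {}" by auto
    then show ?thesis by (metis openin_empty)
  qed
  then have "closedin ?T (X - {x \<in> topspace ?T. window x i n = w})"
    by (rule closedin_diff[OF closed])
  moreover have "X - {x \<in> topspace ?T. window x i n = w} = {x \<in> X. window x i n \<noteq> w}"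
    using closedin_subset[OF closed] by auto
  ultimately show ?thesis by simp
qed

text \<open>If arbitrarily long words avoid \<open>w\<close>, then by compactness so does some bi-infinite word; the
  points avoiding \<open>w\<close> then form a proper nonempty shift space.\<close>

theorem uniformly_recurrent:
  assumes w: "w \<in> L"
  shows "\<exists>N. \<forall>v \<in> L. N \<le> length v \<longrightarrow> (\<exists>p s. v = p @ w @ s)"
proof (rule ccontr)
  assume "\<not> ?thesis"
  then have bad: "\<exists>v \<in> L. N \<le> length v \<and> (\<nexists>p s. v = p @ w @ s)" for N by blast
  let ?T = "product_topology (\<lambda>_::int. discrete_topology A) UNIV"
  let ?n = "length w"
  define C where "C = (\<lambda>m::nat. {x \<in> X. \<forall>i \<in> {- int m..int m}. window x i ?n \<noteq> w})"
  define Y where "Y = {x \<in> X. \<forall>i. window x i ?n \<noteq> w}"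
  have "(\<Inter>m. C m) \<noteq> {}"
  proof (rule compact_space_imp_nest)
    show "compact_space ?T"
      using finite_A by (simp add: compact_space_product_topology compact_space_discrete_topology)
    show "closedin ?T (C m)" for m
    proof -
      have "C m = (\<Inter>i \<in> {- int m..int m}. {x \<in> X. window x i ?n \<noteq> w})" by (auto simp: C_def)
      then show ?thesis using closedin_avoiding by (auto intro: closedin_INT)
    qed
    show "decseq C"
      by (auto simp: decseq_def C_def)
    show "C m \<noteq> {}" for m
    proof -
      obtain v where v: "v \<in> L" "2 * m + ?n + 1 \<le> length v" "\<nexists>p s. v = p @ w @ s" using bad by blast
      obtain x i where x: "x \<in> X" "v = window x i (length v)" using v(1) by (rule languageE)
      \<comment> \<open>Recentring moves the start of \<open>v\<close> to \<open>- int m\<close>, so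
        the window at each \<open>j\<close> in \<open>{- int m..int m}\<close> lies within
        \<open>v\<close>.\<close>
      define y where "y = (\<lambda>k. x (k + (i + int m)))"
      have "y \<in> X" unfolding y_def by (rule shift_space_translate[OF shift_X x(1)])
      moreover have "window y j ?n \<noteq> w" if "j \<in> {- int m..int m}" for j
      proof
        assume eq: "window y j ?n = w"
        define k where "k = nat (int m + j)"
        have k: "int k = int m + j" "k + ?n \<le> length v" using that v(2) by (auto simp: k_def)
        have "v = window x i (k + (?n + (length v - k - ?n)))" using x(2) k(2) by simp
        moreover have "window x (i + int k) ?n = window y j ?n"
          by (simp add: y_def window_def k(1) algebra_simps)
        ultimately show False using v(3) eq unfolding window_add by auto
      qed
      ultimately show ?thesis by (auto simp: C_def)
    qed
  qed
  moreover have INT: "(\<Inter>m. C m) = Y"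
  proof -
    have "window x i ?n \<noteq> w" if "\<forall>m. x \<in> C m" for x i
    proof -
      have "i \<in> {- int (nat \<bar>i\<bar>)..int (nat \<bar>i\<bar>)}" by auto
      then show ?thesis using that unfolding C_def by blast
    qed
    then show ?thesis by (auto simp: Y_def C_def)
  qed
  ultimately have "Y \<noteq> {}" by simp
  moreover have "closedin ?T Y"
  proof -
    have "Y = (\<Inter>i. {x \<in> X. window x i ?n \<noteq> w})" by (auto simp: Y_def)
    then show ?thesis using closedin_avoiding by (auto intro: closedin_INT)
  qed
  moreover have "shift ` Y = Y"
  proof
    have sh: "window (\<lambda>n. x (n + k)) i ?n = window x (i + k) ?n" for x :: "int \<Rightarrow> 'a" and i k
      by (simp add: window_def algebra_simps)
    have tr: "(\<lambda>n. x (n + k)) \<in> Y" if "x \<in> Y" for x k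
      using that shift_space_translate[OF shift_X] by (auto simp: Y_def sh)
    show "shift ` Y \<subseteq> Y" using tr[of _ 1] by (auto simp: shift_def)
    show "Y \<subseteq> shift ` Y"
    proof
      fix x assume "x \<in> Y"
      then have "(\<lambda>n. x (n + - 1)) \<in> Y" by (rule tr)
      moreover have "x = shift (\<lambda>n. x (n + - 1))" by (auto simp: shift_def)
      ultimately show "x \<in> shift ` Y" by blast
    qed
  qed
  moreover have "Y \<subseteq> X" by (auto simp: Y_def)
  ultimately have "Y = X"
    using minimal by (auto simp: minimal_shift_space_def shift_space_def)
  obtain x i where "x \<in> X" "w = window x i ?n" using w by (rule languageE)
  moreover have "x \<in> Y" using \<open>x \<in> X\<close> \<open>Y = X\<close> by simp
  then have "\<forall>i. window x i ?n \<noteq> w" by (simp add: Y_def)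
  ultimately show False by metis
qed

lemma recurrence_bound:
  assumes "w \<in> L"
  obtains N where "\<And>v. v \<in> L \<Longrightarrow> N \<le> length v \<Longrightarrow> \<exists>p s. v = p @ w @ s"
  using uniformly_recurrent[OF assms] by blast

end

section \<open>Generators and bases of free groups\<close>

abbreviation gen :: "'a \<Rightarrow> 'a sword" where
  "gen a \<equiv> pos [a]"

lemma gen_in_carrier: "a \<in> A \<Longrightarrow> gen a \<in> carrier (free_group A)"
  by (simp add: pos_in_carrier)

lemma pos_Cons: "pos (a # w) = gen a \<otimes>\<^bsub>free_group A\<^esub> pos w"
  using pos_append[of "[a]" w A] by simp

lemma pos_Nil: "pos [] = \<one>\<^bsub>free_group A\<^esub>"
  by (simp add: pos_def free_group_def)

lemma inj_pos: "inj pos"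
  by (rule injI) (simp add: pos_def inj_map_eq_map inj_on_def)

lemma free_group_induct [consumes 1, case_names one gen inv_gen]:
  assumes u: "u \<in> carrier (free_group A)"
    and one: "P \<one>\<^bsub>free_group A\<^esub>"
    and gen: "\<And>a u. a \<in> A \<Longrightarrow> u \<in> carrier (free_group A) \<Longrightarrow> P u \<Longrightarrow> P (gen a \<otimes>\<^bsub>free_group A\<^esub> u)"
    and inv_gen: "\<And>a u. a \<in> A \<Longrightarrow> u \<in> carrier (free_group A) \<Longrightarrow> P u \<Longrightarrow>
      P (inv\<^bsub>free_group A\<^esub> (gen a) \<otimes>\<^bsub>free_group A\<^esub> u)"
  shows "P u"
  using u
proof (induction u)
  case Nil
  then show ?case using one by (simp add: free_group_def)
next
  case (Cons x u)
  interpret G: group "free_group A" by (rule group_free_group)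
  obtain s a where x: "x = (s, a)" by force
  have red: "reduced (x # u)" and a: "a \<in> A" using Cons.prems x by (auto simp: free_group_def)
  then have u: "u \<in> carrier (free_group A)"
    using Cons.prems by (auto simp: free_group_def reduced_def successively_Cons)
  have "cancel_cons x u = x # u"
    using red by (cases u) (auto simp: reduced_def)
  then have xu: "x # u = [x] \<otimes>\<^bsub>free_group A\<^esub> u" by (simp add: free_group_def)
  show ?case
  proof (cases s)
    case True
    then show ?thesis using gen[OF a u Cons.IH[OF u]] xu x by (simp add: pos_def)
  next
    case False
    have "inv\<^bsub>free_group A\<^esub> (gen a) = [x]"
    proof (rule G.inv_equality)
      show "[x] \<otimes>\<^bsub>free_group A\<^esub> gen a = \<one>\<^bsub>free_group A\<^esub>"
        using False x by (simp add: free_group_def pos_def flip_def)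
      show "[x] \<in> carrier (free_group A)" using x a by (simp add: free_group_def reduced_def)
    qed (rule gen_in_carrier[OF a])
    then show ?thesis using inv_gen[OF a u Cons.IH[OF u]] xu by simp
  qed
qed

lemma generate_gens: "generate (free_group A) (gen ` A) = carrier (free_group A)"
proof
  interpret G: group "free_group A" by (rule group_free_group)
  show "generate (free_group A) (gen ` A) \<subseteq> carrier (free_group A)"
    by (rule G.generate_incl) (auto intro: gen_in_carrier)
  show "carrier (free_group A) \<subseteq> generate (free_group A) (gen ` A)"
  proof
    fix u assume "u \<in> carrier (free_group A)"
    then show "u \<in> generate (free_group A) (gen ` A)"
    proof (induction rule: free_group_induct)
      case (gen a u)
      then show ?case by (auto intro!: generate.eng intro: generate.incl)
    next
      case (inv_gen a u)
      then show ?case by (auto intro!: generate.eng intro: generate.inv)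
    qed (rule generate.one)
  qed
qed

lemma hom_eq_on_generate:
  assumes G: "group G" and H: "group H" and h: "h \<in> hom G H" and k: "k \<in> hom G H"
    and S: "S \<subseteq> carrier G" and eq: "\<And>s. s \<in> S \<Longrightarrow> h s = k s" and u: "u \<in> generate G S"
  shows "h u = k u"
proof -
  interpret h: group_hom G H h using G H h by (simp add: group_hom_def group_hom_axioms_def)
  interpret k: group_hom G H k using G H k by (simp add: group_hom_def group_hom_axioms_def)
  show ?thesis
    using u
  proof (induction rule: generate.induct)
    case (inv s)
    then have "s \<in> carrier G" "h s = k s" using S eq by auto
    then show ?case by simp
  next
    case (eng u v)
    then show ?case using group.generate_in_carrier[OF G S] by simp
  qed (simp_all add: eq)
qed

lemma lift_gen:
  assumes "group G" "f a \<in> carrier G"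
  shows "lift G f (gen a) = f a"
proof -
  interpret group G by fact
  show ?thesis using assms by (simp add: lift_def pos_def)
qed

lemma free_group_hom_eqI:
  assumes H: "group H" and h: "h \<in> hom (free_group A) H" and k: "k \<in> hom (free_group A) H"
    and eq: "\<And>a. a \<in> A \<Longrightarrow> h (gen a) = k (gen a)" and u: "u \<in> carrier (free_group A)"
  shows "h u = k u"
  by (rule hom_eq_on_generate[OF group_free_group H h k, of "gen ` A"])
    (use eq u in \<open>auto simp: generate_gens intro: gen_in_carrier\<close>)

lemma free_group_endo_eq_id:
  assumes h: "h \<in> hom (free_group A) (free_group A)" and eq: "\<And>a. a \<in> A \<Longrightarrow> h (gen a) = gen a"
    and u: "u \<in> carrier (free_group A)"
  shows "h u = u"
  using free_group_hom_eqI[OF group_free_group h, of "\<lambda>x. x"] eq u by (simp add: hom_def Pi_def)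

section \<open>Homomorphisms to the group with two elements\<close>

text \<open>Equivalence as multiplication makes \<open>True\<close> the unit, so that agreement of
  labels is literally a product.\<close>

definition Z2 :: "bool monoid" where
  "Z2 = \<lparr>carrier = UNIV, monoid.mult = (\<longleftrightarrow>), monoid.one = True\<rparr>"

lemma group_Z2: "group Z2"
  by (rule groupI) (auto simp: Z2_def)

lemma carrier_Z2 [simp]: "carrier Z2 = UNIV"
  and mult_Z2 [simp]: "x \<otimes>\<^bsub>Z2\<^esub> y \<longleftrightarrow> (x \<longleftrightarrow> y)"
  and one_Z2 [simp]: "\<one>\<^bsub>Z2\<^esub> = True"
  by (auto simp: Z2_def)

lemma lift_Z2_hom: "lift Z2 f \<in> hom (free_group A) Z2"
  by (rule lift_hom[OF group_Z2]) auto

lemma lift_Z2_gen: "lift Z2 f (gen a) = f a"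
  by (rule lift_gen[OF group_Z2]) auto

section \<open>Universal property and rank of free bases\<close>

lemma free_basis_generates:
  assumes "group G" and B: "free_basis G B"
  shows "generate G B = carrier G"
proof
  interpret G: group G by fact
  have sub: "B \<subseteq> carrier G" and iso: "lift G (\<lambda>b. b) \<in> iso (free_group B) G"
    using B by (auto simp: free_basis_def)
  show "generate G B \<subseteq> carrier G" by (rule G.generate_incl[OF sub])
  have hom: "lift G (\<lambda>b. b) \<in> hom (free_group B) G" using iso by (simp add: iso_def)
  interpret h: group_hom "free_group B" G "lift G (\<lambda>b. b)"
    using hom group_free_group \<open>group G\<close> by (simp add: group_hom_def group_hom_axioms_def)
  have "lift G (\<lambda>b. b) u \<in> generate G B" if "u \<in> carrier (free_group B)" for u
    using that
  proof (induction rule: free_group_induct)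
    case one
    then show ?case using generate.one[of G] by simp
  next
    case (gen b u)
    then have "lift G (\<lambda>b. b) (gen b) = b" using sub by (intro lift_gen[OF \<open>group G\<close>]) auto
    then show ?case using gen by (simp add: gen_in_carrier generate.eng generate.incl)
  next
    case (inv_gen b u)
    then have "lift G (\<lambda>b. b) (gen b) = b" using sub by (intro lift_gen[OF \<open>group G\<close>]) auto
    then show ?case using inv_gen by (simp add: gen_in_carrier generate.eng generate.inv)
  qed
  moreover have "carrier G = lift G (\<lambda>b. b) ` carrier (free_group B)"
    using iso by (simp add: iso_def bij_betw_def)
  ultimately show "carrier G \<subseteq> generate G B" by auto
qed

text \<open>The inverse of the isomorphism from the free group on \<open>B\<close> sends each
  \<open>b\<close> to a letter, and \<open>f\<close> extends from letters by
  \<open>lift\<close>.\<close>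

lemma free_basis_extend:
  assumes "group G" "group H" and B: "free_basis G B" and f: "f \<in> B \<rightarrow> carrier H"
  obtains \<psi> where "\<psi> \<in> hom G H" "\<And>b. b \<in> B \<Longrightarrow> \<psi> b = f b"
proof -
  interpret F: group "free_group B" by (rule group_free_group)
  have sub: "B \<subseteq> carrier G" and iso: "lift G (\<lambda>b. b) \<in> iso (free_group B) G"
    using B by (auto simp: free_basis_def)
  define k where "k = inv_into (carrier (free_group B)) (lift G (\<lambda>b. b))"
  have k: "k \<in> hom G (free_group B)"
    using F.iso_set_sym[OF iso] by (simp add: k_def iso_def)
  have kb: "k b = gen b" if "b \<in> B" for b
  proof -
    have "lift G (\<lambda>b. b) (gen b) = b" using that sub by (intro lift_gen[OF \<open>group G\<close>]) auto
    moreover have "inj_on (lift G (\<lambda>b. b)) (carrier (free_group B))"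
      using iso by (simp add: iso_def bij_betw_def)
    ultimately show ?thesis
      using inv_into_f_f[OF _ gen_in_carrier[OF that]] unfolding k_def by fastforce
  qed
  have "lift H f \<circ> k \<in> hom G H"
    using k lift_hom[OF \<open>group H\<close> f] by (rule hom_compose)
  moreover have "(lift H f \<circ> k) b = f b" if "b \<in> B" for b
    using that f kb lift_gen[OF \<open>group H\<close>, of f b] by auto
  ultimately show ?thesis using that by blast
qed

text \<open>There are 2^|A| homomorphisms to \<open>Z2\<close>, one for each subset of
  \<open>A\<close>, and they are determined by their values on a generating set.\<close>

lemma card_generators_ge:
  assumes fin: "finite A" "finite B" and B: "B \<subseteq> carrier (free_group A)"
    and gB: "generate (free_group A) B = carrier (free_group A)"
  shows "card A \<le> card B"
proof -
  define res where "res = (\<lambda>S. {b \<in> B. lift Z2 (\<lambda>a. a \<in> S) b})"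
  have "inj_on res (Pow A)"
  proof (rule inj_onI)
    fix S T assume ST: "S \<in> Pow A" "T \<in> Pow A" and eq: "res S = res T"
    have "lift Z2 (\<lambda>a. a \<in> S) u = lift Z2 (\<lambda>a. a \<in> T) u" if "u \<in> carrier (free_group A)" for u
      by (rule hom_eq_on_generate[OF group_free_group group_Z2 lift_Z2_hom lift_Z2_hom B])
        (use that gB eq in \<open>auto simp: res_def\<close>)
    then have "a \<in> S \<longleftrightarrow> a \<in> T" if "a \<in> A" for a
      using gen_in_carrier[OF that] by (metis lift_Z2_gen)
    then show "S = T" using ST by blast
  qed
  then have "card (Pow A) \<le> card (Pow B)"
    using fin by (intro card_inj_on_le[of res]) (auto simp: res_def)
  then show ?thesis using fin by (simp add: card_Pow)
qed

text \<open>By freeness every labelling of \<open>B\<close> extends to a homomorphism to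
  \<open>Z2\<close>, so restricting the homomorphisms coded by subsets of \<open>A\<close> reaches
  all subsets of \<open>B\<close>.\<close>

lemma card_free_basis:
  assumes fin: "finite A" "finite B" and B: "free_basis (free_group A) B"
  shows "card B = card A"
proof (rule antisym)
  have sub: "B \<subseteq> carrier (free_group A)" using B by (simp add: free_basis_def)
  show "card A \<le> card B"
    by (rule card_generators_ge[OF fin sub free_basis_generates[OF group_free_group B]])
  define res where "res = (\<lambda>S. {b \<in> B. lift Z2 (\<lambda>a. a \<in> S) b})"
  have "Pow B \<subseteq> res ` Pow A"
  proof
    fix T assume T: "T \<in> Pow B"
    obtain \<psi> where \<psi>: "\<psi> \<in> hom (free_group A) Z2" "\<And>b. b \<in> B \<Longrightarrow> \<psi> b = (b \<in> T)"
      using free_basis_extend[OF group_free_group group_Z2 B, of "\<lambda>b. b \<in> T"] by auto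
    define S where "S = {a \<in> A. \<psi> (gen a)}"
    have "lift Z2 (\<lambda>a. a \<in> S) u = \<psi> u" if "u \<in> carrier (free_group A)" for u
      by (rule free_group_hom_eqI[OF group_Z2 lift_Z2_hom \<psi>(1) _ that]) (simp add: lift_Z2_gen S_def)
    then have "res S = T" using T \<psi>(2) sub by (auto simp: res_def)
    moreover have "S \<in> Pow A" by (auto simp: S_def)
    ultimately show "T \<in> res ` Pow A" by blast
  qed
  then have "card (Pow B) \<le> card (Pow A)" using fin by (intro surj_card_le) auto
  then show "card B \<le> card A" using fin by (simp add: card_Pow)
qed

section \<open>Tame morphisms are automorphisms\<close>

lemma extend_hom:
  assumes "\<And>a. a \<in> A \<Longrightarrow> set (f a) \<subseteq> A"
  shows "extend A f \<in> hom (free_group A) (free_group A)"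
  unfolding extend_def using assms by (intro lift_hom[OF group_free_group]) (auto intro!: pos_in_carrier)

lemma extend_gen:
  assumes "a \<in> A" "set (f a) \<subseteq> A"
  shows "extend A f (gen a) = pos (f a)"
  unfolding extend_def by (rule lift_gen[OF group_free_group]) (use assms in \<open>auto intro!: pos_in_carrier\<close>)

lemma free_group_isoI:
  assumes h: "h \<in> hom (free_group A) (free_group A)" and k: "k \<in> hom (free_group A) (free_group A)"
    and kh: "\<And>a. a \<in> A \<Longrightarrow> k (h (gen a)) = gen a" and hk: "\<And>a. a \<in> A \<Longrightarrow> h (k (gen a)) = gen a"
  shows "h \<in> iso (free_group A) (free_group A)"
proof -
  have "k (h u) = u" if "u \<in> carrier (free_group A)" for u
    using free_group_endo_eq_id[OF hom_compose[OF h k] _ that] kh by simp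
  moreover have "h (k u) = u" if "u \<in> carrier (free_group A)" for u
    using free_group_endo_eq_id[OF hom_compose[OF k h] _ that] hk by simp
  ultimately have "bij_betw h (carrier (free_group A)) (carrier (free_group A))"
    using h k by (intro bij_betw_byWitness[where f' = k]) (auto simp: hom_def)
  then show ?thesis using h by (simp add: iso_def)
qed

lemma set_alpha: "set (alpha a b c) \<subseteq> {a, b, c}" "set (alpha_tilde a b c) \<subseteq> {a, b, c}"
  by (auto simp: alpha_def alpha_tilde_def)

lemma tame_morphism_iso:
  assumes "\<phi> \<in> tame_morphisms A"
  shows "\<phi> \<in> iso (free_group A) (free_group A)"
  using assms
proof (induction rule: tame_morphisms.induct)
  case (perm p)
  have in_A: "a \<in> A \<Longrightarrow> p a \<in> A" "a \<in> A \<Longrightarrow> inv_into UNIV p a \<in> A" for a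
    using perm by (auto simp: permutes_in_image permutes_inv)
  show ?case
    by (rule free_group_isoI[where k = "extend A (\<lambda>a. [inv_into UNIV p a])"])
      (use perm in_A in \<open>auto intro!: extend_hom simp: extend_gen permutes_inverses\<close>)
next
  case (alpha a b)
  interpret G: group "free_group A" by (rule group_free_group)
  \<comment> \<open>The inverse sends \<open>a\<close> to \<open>a\<close> times the inverse of
    \<open>b\<close>. This is no positive word, so it is given by \<open>lift\<close> and not by
    \<open>extend\<close>.\<close>
  let ?f = "\<lambda>c. if c = a then gen a \<otimes>\<^bsub>free_group A\<^esub> inv\<^bsub>free_group A\<^esub> (gen b) else gen c"
  have h: "extend A (alpha a b) \<in> hom (free_group A) (free_group A)"
    using alpha set_alpha by (intro extend_hom) fastforce
  have k: "lift (free_group A) ?f \<in> hom (free_group A) (free_group A)"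
    using alpha by (intro lift_hom[OF group_free_group]) (auto simp: gen_in_carrier)
  interpret h: group_hom "free_group A" "free_group A" "extend A (alpha a b)"
    using h by unfold_locales
  interpret k: group_hom "free_group A" "free_group A" "lift (free_group A) ?f"
    using k by unfold_locales
  have kg: "lift (free_group A) ?f (gen c) = ?f c" if "c \<in> A" for c
    using that alpha by (intro lift_gen[OF group_free_group]) (auto simp: gen_in_carrier)
  have hg: "extend A (alpha a b) (gen c) = (if c = a then gen a \<otimes>\<^bsub>free_group A\<^esub> gen b else gen c)" if "c \<in> A" for c
    using that alpha extend_gen[of c A "alpha a b"] set_alpha[of a b c]
    by (auto simp: alpha_def pos_Cons[of a "[b]" A])
  show ?case
    by (rule free_group_isoI[OF h k])
      (use alpha in \<open>auto simp: hg kg gen_in_carrier G.m_assoc\<close>)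
next
  case (alpha_tilde a b)
  interpret G: group "free_group A" by (rule group_free_group)
  let ?f = "\<lambda>c. if c = a then inv\<^bsub>free_group A\<^esub> (gen b) \<otimes>\<^bsub>free_group A\<^esub> gen a else gen c"
  have h: "extend A (alpha_tilde a b) \<in> hom (free_group A) (free_group A)"
    using alpha_tilde set_alpha by (intro extend_hom) fastforce
  have k: "lift (free_group A) ?f \<in> hom (free_group A) (free_group A)"
    using alpha_tilde by (intro lift_hom[OF group_free_group]) (auto simp: gen_in_carrier)
  interpret h: group_hom "free_group A" "free_group A" "extend A (alpha_tilde a b)"
    using h by unfold_locales
  interpret k: group_hom "free_group A" "free_group A" "lift (free_group A) ?f"
    using k by unfold_locales
  have kg: "lift (free_group A) ?f (gen c) = ?f c" if "c \<in> A" for c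
    using that alpha_tilde by (intro lift_gen[OF group_free_group]) (auto simp: gen_in_carrier)
  have hg: "extend A (alpha_tilde a b) (gen c) = (if c = a then gen b \<otimes>\<^bsub>free_group A\<^esub> gen a else gen c)" if "c \<in> A" for c
    using that alpha_tilde extend_gen[of c A "alpha_tilde a b"] set_alpha[of a b c]
    by (auto simp: alpha_tilde_def pos_Cons[of b "[a]" A])
  show ?case
    by (rule free_group_isoI[OF h k])
      (use alpha_tilde in \<open>auto simp: hg kg gen_in_carrier G.m_assoc[symmetric]\<close>)
next
  case (comp \<phi> \<psi>)
  then show ?case using iso_set_trans by blast
qed

text \<open>\<open>lift\<close> starts from the free group on the set of images,
  \<open>\<phi>\<close> from that on \<open>A\<close>. Renaming each \<open>a\<close> to the letter
  for \<open>\<phi> (gen a)\<close> gives a surjection \<open>\<theta>\<close> with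
  \<open>lift\<close> after \<open>\<theta>\<close> equal to \<open>\<phi>\<close>, so bijectivity
  passes from \<open>\<phi>\<close> to \<open>lift\<close>.\<close>

lemma iso_image_gens_free_basis:
  assumes \<phi>: "\<phi> \<in> iso (free_group A) (free_group A)"
  shows "free_basis (free_group A) (\<phi> ` gen ` A)"
proof -
  let ?F = "free_group A" and ?B = "\<phi> ` gen ` A"
  let ?lift = "lift ?F (\<lambda>b. b)" and ?\<theta> = "lift (free_group ?B) (\<lambda>a. gen (\<phi> (gen a)))"
  have \<phi>_hom: "\<phi> \<in> hom ?F ?F" and \<phi>_bij: "bij_betw \<phi> (carrier ?F) (carrier ?F)"
    using \<phi> by (auto simp: iso_def)
  have sub: "?B \<subseteq> carrier ?F" using \<phi>_hom gen_in_carrier by (force simp: hom_def)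
  have lift: "?lift \<in> hom (free_group ?B) ?F" using sub by (intro lift_hom[OF group_free_group]) auto
  have \<theta>: "?\<theta> \<in> hom ?F (free_group ?B)"
    by (intro lift_hom[OF group_free_group]) (auto intro: gen_in_carrier)
  have \<theta>_gen: "?\<theta> (gen a) = gen (\<phi> (gen a))" if "a \<in> A" for a
    using that by (intro lift_gen[OF group_free_group]) (auto intro: gen_in_carrier)
  have lift_gen_B: "?lift (gen b) = b" if "b \<in> ?B" for b
    using that sub by (intro lift_gen[OF group_free_group]) blast
  have comp: "?lift (?\<theta> u) = \<phi> u" if "u \<in> carrier ?F" for u
    using free_group_hom_eqI[OF group_free_group hom_compose[OF \<theta> lift] \<phi>_hom _ that] \<theta>_gen lift_gen_B
    by auto
  interpret \<theta>: group_hom ?F "free_group ?B" ?\<theta>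
    using \<theta> by (simp add: group_free_group group_hom_def group_hom_axioms_def)
  have \<theta>_surj: "\<exists>u \<in> carrier ?F. ?\<theta> u = v" if "v \<in> carrier (free_group ?B)" for v
    using that
  proof (induction rule: free_group_induct)
    case one
    then show ?case using \<theta>.hom_one by blast
  next
    case (gen b v)
    then obtain u a where u: "u \<in> carrier ?F" "?\<theta> u = v" "a \<in> A" "b = \<phi> (gen a)" by blast
    then have "?\<theta> (gen a \<otimes>\<^bsub>?F\<^esub> u) = gen b \<otimes>\<^bsub>free_group ?B\<^esub> v" by (simp add: gen_in_carrier \<theta>_gen)
    then show ?case using u gen_in_carrier[OF u(3)] by (intro bexI[of _ "gen a \<otimes>\<^bsub>?F\<^esub> u"]) simp_all
  next
    case (inv_gen b v)
    then obtain u a where u: "u \<in> carrier ?F" "?\<theta> u = v" "a \<in> A" "b = \<phi> (gen a)" by blast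
    then have "?\<theta> (inv\<^bsub>?F\<^esub> (gen a) \<otimes>\<^bsub>?F\<^esub> u) = inv\<^bsub>free_group ?B\<^esub> (gen b) \<otimes>\<^bsub>free_group ?B\<^esub> v"
      by (simp add: gen_in_carrier \<theta>_gen)
    then show ?case using u gen_in_carrier[OF u(3)]
      by (intro bexI[of _ "inv\<^bsub>?F\<^esub> (gen a) \<otimes>\<^bsub>?F\<^esub> u"]) simp_all
  qed
  have "inj_on ?lift (carrier (free_group ?B))"
  proof (rule inj_onI)
    fix v v' assume vv: "v \<in> carrier (free_group ?B)" "v' \<in> carrier (free_group ?B)" "?lift v = ?lift v'"
    then obtain u u' where u: "u \<in> carrier ?F" "u' \<in> carrier ?F" "?\<theta> u = v" "?\<theta> u' = v'" using \<theta>_surj by meson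
    then have "\<phi> u = \<phi> u'" using comp vv(3) by metis
    then show "v = v'" using u \<phi>_bij by (auto simp: bij_betw_def inj_on_def)
  qed
  moreover have "?lift ` carrier (free_group ?B) = carrier ?F"
  proof
    show "?lift ` carrier (free_group ?B) \<subseteq> carrier ?F" using lift by (auto simp: hom_def)
    show "carrier ?F \<subseteq> ?lift ` carrier (free_group ?B)"
    proof
      fix x assume "x \<in> carrier ?F"
      then obtain u where u: "u \<in> carrier ?F" "x = \<phi> u" using \<phi>_bij by (auto simp: bij_betw_def)
      show "x \<in> ?lift ` carrier (free_group ?B)"
        by (rule image_eqI[of _ _ "?\<theta> u"]) (simp_all only: u comp \<theta>.hom_closed)
    qed
  qed
  ultimately show ?thesis
    using lift sub by (simp add: free_basis_def iso_def bij_betw_def)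
qed

lemma tame_basisI:
  assumes "\<phi> \<in> tame_morphisms A" "B = \<phi> ` gen ` A"
  shows "tame_basis A B"
  using assms iso_image_gens_free_basis[OF tame_morphism_iso] unfolding tame_basis_def by auto

section \<open>Return words and decompositions into them\<close>

context minimal_shift
begin

abbreviation "R \<equiv> return_words X"

lemma return_wordD:
  assumes "r \<in> R w"
  shows "r \<noteq> []" "r @ w \<in> L" "\<exists>u. r @ w = w @ u"
    "\<And>p s. r @ w = p @ w @ s \<Longrightarrow> p = [] \<or> s = []"
  using assms by (auto simp: return_words_def)

lemma return_word_letters: "r \<in> R w \<Longrightarrow> set r \<subseteq> A"
  using language_letters[of "r @ w"] by (auto dest: return_wordD(2))

lemma return_words_Nil: "R [] = (\<lambda>a. [a]) ` A"
proof -
  have single: "\<exists>a \<in> A. r = [a]" if ret: "r \<in> R []" for r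
  proof -
    obtain a s where r: "r = a # s" using return_wordD(1)[OF ret] by (cases r) auto
    then have "s = []" using return_wordD(4)[OF ret, of "[a]" s] by simp
    then show ?thesis using return_word_letters[OF ret] r by simp
  qed
  have "[a] \<in> R []" if "a \<in> A" for a
    using letters_in[OF that] by (auto simp: return_words_def append_eq_Cons_conv Cons_eq_append_conv)
  then show ?thesis using single by auto
qed

text \<open>If \<open>g\<close> is neither empty nor a return word, \<open>g @ w\<close> has an
  inner occurrence of \<open>w\<close>, which splits \<open>g\<close> into two shorter words of the
  same kind. Thus the words leading from one occurrence of \<open>w\<close> to another are
  concatenations of return words.\<close>

lemma returns_induct [consumes 2, case_names Nil return append]:
  assumes "g @ w \<in> L" "prefix w (g @ w)"
    and "P []"
    and "\<And>r. r \<in> R w \<Longrightarrow> P r"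
    and "\<And>p q. p @ q @ w \<in> L \<Longrightarrow> prefix w (p @ w) \<Longrightarrow> prefix w (q @ w) \<Longrightarrow> prefix (p @ w) (p @ q @ w) \<Longrightarrow>
           P p \<Longrightarrow> P q \<Longrightarrow> P (p @ q)"
  shows "P g"
  using assms(1,2)
proof (induction "length g" arbitrary: g rule: less_induct)
  case less
  consider "g = []" | "g \<in> R w" | "g \<noteq> []" "g \<notin> R w" by blast
  then show ?case
  proof cases
    case 3
    obtain u where u: "g @ w = w @ u" using less.prems by (auto simp: prefix_def)
    then obtain p s where ps: "p \<noteq> []" "s \<noteq> []" "g @ w = p @ w @ s"
      using 3 less.prems by (auto simp: return_words_def)
    then have len: "length p < length g" by (auto dest: arg_cong[of _ _ length])
    define q where "q = drop (length p) g"
    have g: "g = p @ q"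
    proof -
      have "take (length p) (g @ w) = p" using ps(3) by simp
      then show ?thesis using len unfolding q_def by (metis append_take_drop_id less_imp_le_nat take_append diff_is_0_eq take0 append_Nil2)
    qed
    have qw: "q @ w = w @ s" using ps(3) g by simp
    have "p @ w = take (length p + length w) (w @ u)" using ps(3) u by simp
    then have pw: "prefix w (p @ w)" by (simp add: prefix_def)
    have pqL: "p @ q @ w \<in> L" using less.prems g by simp
    have "P p"
    proof (rule less.hyps[OF len _ pw])
      show "p @ w \<in> L" using pqL language_appendD1[of "p @ w" s X] qw by simp
    qed
    moreover have "P q"
    proof (rule less.hyps)
      show "length q < length g" using g ps(1) by simp
      show "q @ w \<in> L" using pqL language_appendD2 by blast
      show "prefix w (q @ w)" using qw by (simp add: prefix_def)
    qed
    ultimately show ?thesis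
      using assms(5)[OF pqL pw] qw g by (simp add: prefix_def)
  qed (use assms(3,4) in auto)
qed

section \<open>Counting return words\<close>

text \<open>One minus the Euler characteristic of the extension graph, the \<open>m(v)\<close> of
  the overview. It is an integer because it is negative for a disconnected forest.\<close>

definition excess :: "'a list \<Rightarrow> int" where
  "excess v = int (card (bi_ext X v)) - int (card (left_ext X v)) - int (card (right_ext X v)) + 1"

lemma right_ext_subset: "right_ext X v \<subseteq> A"
  using language_letters by (force simp: right_ext_def)

lemma left_ext_subset: "left_ext X v \<subseteq> A"
  using language_letters by (force simp: left_ext_def)

lemma bi_ext_subset: "bi_ext X v \<subseteq> left_ext X v \<times> right_ext X v"
  using language_appendD1[of "_ # v" "[_]" X] language_ConsD
  by (auto simp: bi_ext_def left_ext_def right_ext_def)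

lemma finite_ext [simp]: "finite (right_ext X v)" "finite (left_ext X v)" "finite (bi_ext X v)"
  using right_ext_subset left_ext_subset bi_ext_subset finite_A finite_subset
  by (metis, metis, metis finite_SigmaI)

lemma left_ext_nonempty: "v \<in> L \<Longrightarrow> left_ext X v \<noteq> {}"
  using extend_left by (force simp: left_ext_def)

lemma right_ext_Nil: "right_ext X [] = A"
  using right_ext_subset[of "[]"] letters_in by (auto simp: right_ext_def)

lemma sum_right_ext_left: "(\<Sum>a \<in> left_ext X v. card (right_ext X (a # v))) = card (bi_ext X v)"
proof -
  have "bi_ext X v = Sigma (left_ext X v) (\<lambda>a. right_ext X (a # v))"
    using language_appendD1[of "_ # v" "[_]" X] by (auto simp: bi_ext_def left_ext_def right_ext_def)
  then show ?thesis by simp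
qed

lemma finite_avoiding:
  assumes "w \<in> L"
  shows "finite {v \<in> L. \<not> sublist w v}"
proof -
  obtain N where N: "\<And>v. v \<in> L \<Longrightarrow> N \<le> length v \<Longrightarrow> \<exists>p s. v = p @ w @ s"
    using recurrence_bound[OF assms] by blast
  have "length v \<le> N" if "v \<in> L" "\<not> sublist w v" for v
    using N[OF that(1)] that(2) unfolding sublist_def by (meson nle_le)
  then have "{v \<in> L. \<not> sublist w v} \<subseteq> {v \<in> L. length v \<le> N}" by blast
  then show ?thesis using finite_language_length finite_subset by blast
qed

text \<open>For nonempty \<open>w\<close>, the inner nodes of the tree of right extensions that
  starts at \<open>w\<close> and stops when \<open>w\<close> recurs; its leaves are the words
  \<open>r @ w\<close> with \<open>r\<close> a return word.\<close>

definition first_occurrences :: "'a list \<Rightarrow> 'a list set" where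
  "first_occurrences w = {v \<in> L. prefix w v \<and> \<not> sublist w (tl v)}"

lemma finite_first_occurrences:
  assumes w: "w \<in> L" "w \<noteq> []"
  shows "finite (first_occurrences w)"
proof -
  have "first_occurrences w \<subseteq> (\<lambda>(a, v). a # v) ` (A \<times> {v \<in> L. \<not> sublist w v})"
  proof
    fix v assume v: "v \<in> first_occurrences w"
    then obtain a u where "v = a # u" using w by (cases v) (auto simp: first_occurrences_def)
    then show "v \<in> (\<lambda>(a, v). a # v) ` (A \<times> {v \<in> L. \<not> sublist w v})"
      using v language_letters[of v] language_ConsD[of a u X] by (force simp: first_occurrences_def)
  qed
  then show ?thesis using finite_avoiding[OF w(1)] finite_A by (meson finite_SigmaI finite_imageI finite_subset)
qed

lemma right_extensions_first_occurrences:
  assumes w: "w \<in> L" "w \<noteq> []"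
  shows "(\<lambda>(v, b). v @ [b]) ` Sigma (first_occurrences w) (right_ext X) =
    (first_occurrences w - {w}) \<union> (\<lambda>r. r @ w) ` R w" (is "?I = ?J")
proof
  show "?I \<subseteq> ?J"
  proof clarify
    fix v b assume v: "v \<in> first_occurrences w" and b: "b \<in> right_ext X v"
      and not_ret: "v @ [b] \<notin> (\<lambda>r. r @ w) ` R w"
    obtain a t where at: "v = a # t" using v w by (cases v) (auto simp: first_occurrences_def)
    obtain u where u: "v = w @ u" using v by (auto simp: first_occurrences_def prefix_def)
    have vb: "v @ [b] \<in> L" using b by (simp add: right_ext_def)
    have nt: "\<not> sublist w t" using v at by (simp add: first_occurrences_def)
    have "\<not> sublist w (t @ [b])"
    proof
      assume "sublist w (t @ [b])"
      then obtain p s where ps: "t @ [b] = p @ w @ s" by (auto simp: sublist_def)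
      \<comment> \<open>\<open>t\<close> avoids \<open>w\<close>, so a new occurrence has to use the
        added letter \<open>b\<close>.\<close>
      have "s = []"
      proof (rule ccontr)
        assume "s \<noteq> []"
        then have "t = p @ w @ butlast s" using ps by (metis append_assoc butlast_append butlast_snoc)
        then show False using nt by (auto simp: sublist_def)
      qed
      then have eq: "v @ [b] = (a # p) @ w" using ps at by simp
      have "a # p \<in> R w"
        unfolding return_words_def
      proof (intro CollectI conjI)
        show "(a # p) @ w \<in> L" using vb eq by simp
        show "\<exists>u. (a # p) @ w = w @ u" using eq u by (metis append_assoc)
        show "\<not> (\<exists>p' s'. p' \<noteq> [] \<and> s' \<noteq> [] \<and> (a # p) @ w = p' @ w @ s')"
        proof clarify
          fix p' s' assume ps': "p' \<noteq> []" "s' \<noteq> []" "(a # p) @ w = p' @ w @ s'"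
          then have "v = p' @ w @ butlast s'" using eq by (metis append_assoc butlast_append butlast_snoc)
          then have "t = tl p' @ w @ butlast s'" using at ps'(1) by (cases p') auto
          then show False using nt by (auto simp: sublist_def)
        qed
      qed simp
      then show False using not_ret eq by force
    qed
    then show "v @ [b] \<in> first_occurrences w - {w}"
      using vb at u prefixI[of "v @ [b]" w "u @ [b]"] by (auto simp: first_occurrences_def)
  qed
  show "?J \<subseteq> ?I"
  proof
    fix y assume "y \<in> ?J"
    \<comment> \<open>Common to both parts of \<open>?J\<close>: removing the last letter leaves a
      word whose only occurrence of \<open>w\<close> is the prefix, the parent of \<open>y\<close>
      in the tree.\<close>
    then have "y \<in> L \<and> (\<exists>u. u \<noteq> [] \<and> y = w @ u) \<and> \<not> sublist w (tl (butlast y))"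
    proof
      assume y: "y \<in> first_occurrences w - {w}"
      then obtain u where u: "y = w @ u" by (auto simp: first_occurrences_def prefix_def)
      have "\<not> sublist w (butlast (tl y))"
      proof
        assume "sublist w (butlast (tl y))"
        moreover have "sublist (butlast (tl y)) (tl y)" by (simp add: prefixeq_butlast)
        ultimately show False using y sublist_order.order_trans by (auto simp: first_occurrences_def)
      qed
      then show ?thesis using y u by (auto simp: first_occurrences_def butlast_tl)
    next
      assume "y \<in> (\<lambda>r. r @ w) ` R w"
      then obtain r where r: "r \<in> R w" "y = r @ w" by blast
      then obtain u where u: "r @ w = w @ u" using return_wordD(3) by blast
      have "u \<noteq> []" using u return_wordD(1)[OF r(1)] by auto
      moreover have "\<not> sublist w (tl (butlast y))"
      proof
        assume "sublist w (tl (butlast y))"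
        then obtain p s where ps: "tl (butlast y) = p @ w @ s" by (auto simp: sublist_def)
        moreover have "butlast y \<noteq> []" using ps w by (cases "butlast y") auto
        ultimately have "y = (hd y # p) @ w @ (s @ [last y])"
          by (cases y rule: rev_cases; cases "butlast y") (auto simp: hd_append)
        then show False using return_wordD(4)[OF r(1), of "hd y # p" "s @ [last y]"] r(2) by simp
      qed
      moreover have "y \<in> L" using return_wordD(2)[OF r(1)] r(2) by simp
      ultimately show ?thesis using r(2) u by simp
    qed
    then obtain u where u: "y \<in> L" "u \<noteq> []" "y = w @ u" "\<not> sublist w (tl (butlast y))" by blast
    have "y = butlast y @ [last y]" using u(2,3) by (metis append_butlast_last_id append_is_Nil_conv)
    moreover have "butlast y = w @ butlast u" using u by (simp add: butlast_append)
    moreover have "butlast y \<in> L" using u(1) calculation(1) language_appendD1 by metis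
    ultimately have "(butlast y, last y) \<in> Sigma (first_occurrences w) (right_ext X)"
      using u by (auto simp: first_occurrences_def right_ext_def)
    then show "y \<in> ?I" using \<open>y = butlast y @ [last y]\<close> by force
  qed
qed

text \<open>Counting the edges of a finite tree: every node but the root \<open>w\<close> is the
  child of exactly one inner node.\<close>

lemma sum_first_occurrences:
  assumes w: "w \<in> L" "w \<noteq> []"
  shows "finite (R w)"
    "(\<Sum>v \<in> first_occurrences w. card (right_ext X v)) + 1 = card (first_occurrences w) + card (R w)"
proof -
  let ?T = "first_occurrences w" and ?C = "(\<lambda>r. r @ w) ` R w"
  have fin: "finite ?T" by (rule finite_first_occurrences[OF w])
  have un: "(\<lambda>(v, b). v @ [b]) ` Sigma ?T (right_ext X) = (?T - {w}) \<union> ?C"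
    by (rule right_extensions_first_occurrences[OF w])
  have "finite ((?T - {w}) \<union> ?C)"
    unfolding un[symmetric] using fin by auto
  then have finC: "finite ?C" by simp
  moreover have injC: "inj_on (\<lambda>r. r @ w) (R w)" by (auto simp: inj_on_def)
  ultimately show "finite (R w)" using finite_imageD by blast
  have disj: "(?T - {w}) \<inter> ?C = {}"
  proof -
    have "r @ w \<notin> ?T" if "r \<in> R w" for r
    proof -
      have "tl (r @ w) = tl r @ w" using return_wordD(1)[OF that] by (cases r) auto
      then show ?thesis by (auto simp: first_occurrences_def)
    qed
    then show ?thesis by blast
  qed
  have wT: "w \<in> ?T"
  proof -
    have "\<not> sublist w (tl w)" using w(2) sublist_length_le[of w "tl w"] by (cases w) auto
    then show ?thesis using w by (simp add: first_occurrences_def)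
  qed
  have "(\<Sum>v \<in> ?T. card (right_ext X v)) = card (Sigma ?T (right_ext X))"
    using fin by simp
  also have "\<dots> = card ((\<lambda>(v, b). v @ [b]) ` Sigma ?T (right_ext X))"
    by (rule card_image[symmetric]) (auto simp: inj_on_def)
  also have "\<dots> = card (?T - {w}) + card ?C"
    unfolding un using fin finC disj by (intro card_Un_disjoint) auto
  finally show "(\<Sum>v \<in> ?T. card (right_ext X v)) + 1 = card ?T + card (R w)"
    using fin wT card_image[OF injC] card_Suc_Diff1[OF fin wT] by simp
qed

lemma finite_return_words: "w \<in> L \<Longrightarrow> finite (R w)"
  using sum_first_occurrences(1) return_words_Nil finite_A by (cases "w = []") auto

text \<open>The words avoiding \<open>w\<close> are the proper suffixes of the words in \<^term>\<open>first_occurrences w\<close>.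
  Extending all of them to the left and summing the number of right extensions telescopes.\<close>

theorem card_return_words:
  assumes w: "w \<in> L" "w \<noteq> []"
  shows "int (card (R w)) = int (card A) + (\<Sum>v \<in> {v \<in> L. \<not> sublist w v}. excess v)"
proof -
  let ?V = "{v \<in> L. \<not> sublist w v}" and ?T = "first_occurrences w"
  define \<rho> where "\<rho> = (\<lambda>v. int (card (right_ext X v)) - 1)"
  have finV: "finite ?V" by (rule finite_avoiding[OF w(1)])
  have finT: "finite ?T" by (rule finite_first_occurrences[OF w])
  \<comment> \<open>A letter in front of a word avoiding \<open>w\<close> either keeps it so or
    creates one occurrence of \<open>w\<close>, as a prefix. Only the empty word arises in no such
    way.\<close>
  have un: "(\<lambda>(v, a). a # v) ` Sigma ?V (left_ext X) = (?V - {[]}) \<union> ?T" (is "?I = ?J")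
  proof
    show "?I \<subseteq> ?J"
      by (auto simp: left_ext_def first_occurrences_def sublist_Cons_right)
    show "?J \<subseteq> ?I"
    proof
      fix y assume y: "y \<in> ?J"
      then obtain a v where av: "y = a # v" using w(2) by (cases y) (auto simp: first_occurrences_def)
      then have "y \<in> L" "\<not> sublist w v" using y by (auto simp: first_occurrences_def sublist_Cons_right)
      then have "(v, a) \<in> Sigma ?V (left_ext X)" using av language_ConsD by (auto simp: left_ext_def)
      then show "y \<in> ?I" using av by force
    qed
  qed
  have disj: "(?V - {[]}) \<inter> ?T = {}"
    by (auto simp: first_occurrences_def)
  \<comment> \<open>Both sides are the number of edges minus the number of left vertices of the
    extension graph of \<open>v\<close>.\<close>
  have "\<rho> v + excess v = (\<Sum>a \<in> left_ext X v. \<rho> (a # v))" for v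
    using sum_right_ext_left[of v, THEN arg_cong[of _ _ int]]
    by (simp add: \<rho>_def excess_def sum_subtractf)
  then have "(\<Sum>v \<in> ?V. \<rho> v + excess v) = (\<Sum>v \<in> ?V. \<Sum>a \<in> left_ext X v. \<rho> (a # v))" by simp
  also have "\<dots> = (\<Sum>(v, a) \<in> Sigma ?V (left_ext X). \<rho> (a # v))"
    using finV by (simp add: sum.Sigma)
  also have "\<dots> = sum \<rho> ((\<lambda>(v, a). a # v) ` Sigma ?V (left_ext X))"
    by (subst sum.reindex) (auto simp: inj_on_def case_prod_unfold)
  also have "\<dots> = sum \<rho> (?V - {[]}) + sum \<rho> ?T"
    unfolding un using finV finT disj by (intro sum.union_disjoint) auto
  \<comment> \<open>The term of the empty word is the one that does not cancel; it contributes
    \<open>card A - 1\<close>.\<close>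
  also have "sum \<rho> (?V - {[]}) = sum \<rho> ?V - \<rho> []"
    using finV w(2) Nil_in_language by (simp add: sum_diff1)
  finally have "sum \<rho> ?T = \<rho> [] + (\<Sum>v \<in> ?V. excess v)"
    by (simp add: sum.distrib)
  moreover have "sum \<rho> ?T = int (card (R w)) - 1"
    using sum_first_occurrences(2)[OF w, THEN arg_cong[of _ _ int]]
    by (simp add: \<rho>_def sum_subtractf)
  ultimately show ?thesis by (simp add: \<rho>_def right_ext_Nil)
qed

end

context minimal_shift
begin

section \<open>Return words generate when all extension graphs are connected\<close>

lemma pos_return_words_in_carrier: "pos ` R w \<subseteq> carrier (free_group A)"
  using return_word_letters by (blast intro: pos_in_carrier)

text \<open>The words \<open>y\<close> of length \<open>n + 1\<close> are the edges, labelled by their first letter, of the Rauzy graph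
  of order \<open>n\<close>.\<close>

definition coset_labelling :: "'a sword set \<Rightarrow> nat \<Rightarrow> ('a list \<Rightarrow> 'a sword set) \<Rightarrow> bool" where
  "coset_labelling H n c \<longleftrightarrow>
     (\<forall>u \<in> L. length u = n \<longrightarrow> (\<exists>g \<in> carrier (free_group A). c u = H #>\<^bsub>free_group A\<^esub> g)) \<and>
     (\<forall>y \<in> L. length y = Suc n \<longrightarrow> c (tl y) = c (butlast y) #>\<^bsub>free_group A\<^esub> gen (hd y))"

text \<open>For an edge \<open>(a, b)\<close> of the extension graph of \<open>v\<close>, the label
  of \<open>v @ [b]\<close> is that of \<open>a # v\<close> moved by \<open>gen a\<close>, whatever
  \<open>b\<close> is. Connectedness hence makes the label of \<open>v @ [b]\<close> independent of
  \<open>b\<close>, and it can be handed down to \<open>v\<close>.\<close>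

lemma coset_labelling_descend:
  assumes conn: "\<And>v. v \<in> L \<Longrightarrow> connected_rel (left_ext X v) (right_ext X v) (bi_ext X v)"
    and c: "coset_labelling H (Suc n) c"
  shows "\<exists>c. coset_labelling H n c"
proof -
  let ?F = "free_group A"
  have edge: "c (v @ [b]) = c (a # v) #>\<^bsub>?F\<^esub> gen a" if "a # v @ [b] \<in> L" "length v = n" for a v b
    using c that unfolding coset_labelling_def by (auto dest!: bspec[of _ _ "a # v @ [b]"])
  have const: "c (v @ [b]) = c (v @ [b'])"
    if v: "v \<in> L" "length v = n" and b: "b \<in> right_ext X v" "b' \<in> right_ext X v" for v b b'
  proof -
    \<comment> \<open>Comparing with one fixed coset turns the labels into truth values.\<close>
    define l where "l = (\<lambda>a. c (a # v) #>\<^bsub>?F\<^esub> gen a = c (v @ [b']))"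
    define r where "r = (\<lambda>d. c (v @ [d]) = c (v @ [b']))"
    have lr: "l a \<longleftrightarrow> r d" if "(a, d) \<in> bi_ext X v" for a d
      using edge[of a v d] that v(2) by (simp add: l_def r_def bi_ext_def)
    have "r b = r b'"
    proof (rule connected_relE[OF conn[OF v(1)] lr])
      fix k assume "\<And>d. d \<in> right_ext X v \<Longrightarrow> r d = k"
      then show ?thesis using b by simp
    qed
    then show ?thesis by (simp add: r_def)
  qed
  define c' where "c' = (\<lambda>v. c (v @ [SOME b. b \<in> right_ext X v]))"
  have c': "c' v = c (v @ [b])" if "v \<in> L" "length v = n" "b \<in> right_ext X v" for v b
    unfolding c'_def using that by (intro const) (auto intro: someI)
  have "coset_labelling H n c'"
    unfolding coset_labelling_def
  proof (intro conjI ballI impI)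
    fix u assume u: "u \<in> L" "length u = n"
    then obtain b where b: "b \<in> right_ext X u" using extend_right by (force simp: right_ext_def)
    then have "c' u = c (u @ [b])" using c' u by blast
    moreover have "u @ [b] \<in> L" using b by (simp add: right_ext_def)
    ultimately show "\<exists>g \<in> carrier ?F. c' u = H #>\<^bsub>?F\<^esub> g"
      using c u(2) by (auto simp: coset_labelling_def)
  next
    fix y assume y: "y \<in> L" "length y = Suc n"
    obtain a z where az: "y = a # z" using y by (cases y) auto
    obtain b where b: "y @ [b] \<in> L" using extend_right[OF y(1)] by blast
    have y_eq: "y = butlast y @ [last y]" using y(2) by (metis Zero_not_Suc append_butlast_last_id list.size(3))
    have "z \<in> L" "b \<in> right_ext X z"
      using y b az language_ConsD[of a] by (auto simp: right_ext_def)
    then have "c' (tl y) = c (z @ [b])" using c' y az by simp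
    also have "\<dots> = c y #>\<^bsub>?F\<^esub> gen a"
      using edge[of a z b] b az y by simp
    also have "c y = c' (butlast y)"
    proof -
      have "butlast y \<in> L" using y_eq y(1) language_appendD1 by metis
      moreover have "last y \<in> right_ext X (butlast y)" using y_eq y(1) by (simp add: right_ext_def)
      ultimately show ?thesis using c'[of "butlast y" "last y"] y(2) y_eq by simp
    qed
    finally show "c' (tl y) = c' (butlast y) #>\<^bsub>?F\<^esub> gen (hd y)" using az by simp
  qed
  then show ?thesis by blast
qed

text \<open>At order 0 the graph has one vertex with a loop for each letter, so a single coset of
  \<open>H\<close> is stable under right multiplication by everything.\<close>

lemma generated_by_coset_labelling_Nil:
  assumes H: "subgroup H (free_group A)" and c: "coset_labelling H 0 c"
  shows "H = carrier (free_group A)"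
proof -
  let ?F = "free_group A"
  interpret G: group ?F by (rule group_free_group)
  obtain g where g: "g \<in> carrier ?F" "c [] = H #>\<^bsub>?F\<^esub> g"
    using c Nil_in_language by (auto simp: coset_labelling_def)
  have fix_gen: "H #>\<^bsub>?F\<^esub> g #>\<^bsub>?F\<^esub> gen a = H #>\<^bsub>?F\<^esub> g" if "a \<in> A" for a
    using c letters_in[OF that] g(2) by (auto simp: coset_labelling_def)
  have Hg: "H #>\<^bsub>?F\<^esub> g \<subseteq> carrier ?F" using subgroup.subset[OF H] g(1) by (rule G.r_coset_subset_G)
  have fix_inv: "H #>\<^bsub>?F\<^esub> g #>\<^bsub>?F\<^esub> inv\<^bsub>?F\<^esub> (gen a) = H #>\<^bsub>?F\<^esub> g" if "a \<in> A" for a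
    using G.coset_mult_assoc[OF Hg gen_in_carrier[OF that] G.inv_closed[OF gen_in_carrier[OF that]]]
      fix_gen[OF that] gen_in_carrier[OF that] Hg by (simp add: G.coset_mult_one)
  have fix_all: "H #>\<^bsub>?F\<^esub> g #>\<^bsub>?F\<^esub> u = H #>\<^bsub>?F\<^esub> g" if "u \<in> carrier ?F" for u
    using that
  proof (induction rule: free_group_induct)
    case one
    then show ?case using Hg by (simp add: G.coset_mult_one)
  next
    case (gen a u)
    then show ?case
      using G.coset_mult_assoc[OF Hg gen_in_carrier[of a A], of u] fix_gen[of a] by simp
  next
    case (inv_gen a u)
    then show ?case
      using G.coset_mult_assoc[OF Hg G.inv_closed[OF gen_in_carrier[of a A]], of u] fix_inv[of a] by simp
  qed
  have "h \<in> H" if h: "h \<in> carrier ?F" for h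
  proof -
    \<comment> \<open>Chosen so that \<open>g\<close> times \<open>u\<close> is \<open>h\<close>
      times \<open>g\<close>, which turns stability of the coset into
      \<open>h \<in> H\<close>.\<close>
    define u where "u = inv\<^bsub>?F\<^esub> g \<otimes>\<^bsub>?F\<^esub> (h \<otimes>\<^bsub>?F\<^esub> g)"
    have u: "u \<in> carrier ?F" using h g(1) by (simp add: u_def)
    have "g \<otimes>\<^bsub>?F\<^esub> u = h \<otimes>\<^bsub>?F\<^esub> g"
      using h g(1) by (simp add: u_def G.m_assoc[symmetric])
    moreover have "g \<otimes>\<^bsub>?F\<^esub> u \<in> H #>\<^bsub>?F\<^esub> g #>\<^bsub>?F\<^esub> u"
    proof -
      have "x \<otimes>\<^bsub>?F\<^esub> u \<in> S #>\<^bsub>?F\<^esub> u" if "x \<in> S" for x S using that by (auto simp: r_coset_def)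
      then show ?thesis using G.rcos_self[OF g(1) H] by blast
    qed
    ultimately have "h \<otimes>\<^bsub>?F\<^esub> g \<in> H #>\<^bsub>?F\<^esub> g" using fix_all[OF u] by simp
    then obtain k where "k \<in> H" "h \<otimes>\<^bsub>?F\<^esub> g = k \<otimes>\<^bsub>?F\<^esub> g" by (auto simp: r_coset_def)
    then show ?thesis using h g(1) subgroup.mem_carrier[OF H] by (metis G.right_cancel)
  qed
  then show ?thesis using subgroup.subset[OF H] by blast
qed

text \<open>A word with an occurrence of \<open>w\<close> after the prefix \<open>p\<close> is
  labelled by the coset of the inverse of \<open>p\<close>. Another occurrence changes
  \<open>p\<close> by a concatenation of return words, hence not the coset.\<close>

lemma coset_labelling_return_words:
  assumes w: "w \<in> L"
  shows "\<exists>n c. coset_labelling (generate (free_group A) (pos ` R w)) n c"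
proof -
  let ?F = "free_group A" and ?H = "generate (free_group A) (pos ` R w)"
  interpret G: group ?F by (rule group_free_group)
  have subH: "?H \<subseteq> carrier ?F" by (rule G.generate_incl[OF pos_return_words_in_carrier])
  have H: "subgroup ?H ?F" by (rule G.generate_is_subgroup[OF pos_return_words_in_carrier])
  obtain N where N: "\<And>v. v \<in> L \<Longrightarrow> N \<le> length v \<Longrightarrow> \<exists>p s. v = p @ w @ s"
    using recurrence_bound[OF w] by blast
  have posL: "pos p \<in> carrier ?F" if "p @ v \<in> L" for p v
    using language_letters[OF that] by (auto intro!: pos_in_carrier)
  have ret: "pos g \<in> ?H" if "g @ w \<in> L" "prefix w (g @ w)" for g
    using that
  proof (induction g rule: returns_induct)
    case Nil
    then show ?case using generate.one[of ?F] by (simp add: pos_Nil[of A])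
  next
    case (return r)
    then show ?case by (simp add: generate.incl)
  next
    case (append p q)
    then show ?case by (simp add: pos_append[of p q A] generate.eng)
  qed
  have coset_eq: "?H #>\<^bsub>?F\<^esub> inv\<^bsub>?F\<^esub> (pos p) = ?H #>\<^bsub>?F\<^esub> inv\<^bsub>?F\<^esub> (pos p')"
    if eq: "p @ w @ s = p' @ w @ s'" and pL: "p @ w @ s \<in> L" and le: "length p \<le> length p'" for p s p' s'
  proof -
    obtain g where g: "p' = p @ g"
      using eq le by (metis append_eq_append_conv_if append_take_drop_id)
    then have gw: "w @ s = g @ w @ s'" using eq by simp
    have "g @ w @ s' \<in> L" using pL gw language_appendD2 by metis
    then have gL: "g @ w \<in> L" using language_appendD1[of "g @ w" s' X] by simp
    have "prefix w (g @ w)"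
      using gw by (metis append_assoc prefixI prefix_length_prefix length_append le_add2)
    then have gH: "pos g \<in> ?H" by (rule ret[OF gL])
    have car: "pos p \<in> carrier ?F" "pos g \<in> carrier ?F" using posL pL gL by blast+
    have "?H #>\<^bsub>?F\<^esub> inv\<^bsub>?F\<^esub> (pos p') = ?H #>\<^bsub>?F\<^esub> (inv\<^bsub>?F\<^esub> (pos g) \<otimes>\<^bsub>?F\<^esub> inv\<^bsub>?F\<^esub> (pos p))"
      using car by (simp add: g pos_append[of p g A] G.inv_mult_group)
    also have "\<dots> = ?H #>\<^bsub>?F\<^esub> inv\<^bsub>?F\<^esub> (pos g) #>\<^bsub>?F\<^esub> inv\<^bsub>?F\<^esub> (pos p)"
      using car subH by (simp add: G.coset_mult_assoc)
    also have "?H #>\<^bsub>?F\<^esub> inv\<^bsub>?F\<^esub> (pos g) = ?H"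
      using gH H by (intro G.coset_join2) (auto simp: car subgroup.m_inv_closed)
    finally show ?thesis ..
  qed
  define c where "c = (\<lambda>u. ?H #>\<^bsub>?F\<^esub> inv\<^bsub>?F\<^esub> (pos (SOME p. \<exists>s. u = p @ w @ s)))"
  have c: "c (p @ w @ s) = ?H #>\<^bsub>?F\<^esub> inv\<^bsub>?F\<^esub> (pos p)" if L: "p @ w @ s \<in> L" for p s
  proof -
    obtain s' where s': "p @ w @ s = (SOME p'. \<exists>s'. p @ w @ s = p' @ w @ s') @ w @ s'"
      using someI[of "\<lambda>p'. \<exists>s'. p @ w @ s = p' @ w @ s'" p] by blast
    show ?thesis
    proof (cases "length p \<le> length (SOME p'. \<exists>s'. p @ w @ s = p' @ w @ s')")
      case True
      then show ?thesis unfolding c_def using coset_eq[OF s' L] by simp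
    next
      case False
      have "(SOME p'. \<exists>s'. p @ w @ s = p' @ w @ s') @ w @ s' \<in> L" using L s' by simp
      then show ?thesis unfolding c_def using coset_eq[OF s'[symmetric]] False by simp
    qed
  qed
  \<comment> \<open>Order \<open>Suc N\<close> rather than \<open>N\<close>: an edge has length
    \<open>N + 2\<close>, so that \<open>w\<close> still occurs after both end letters are removed,
    and one occurrence serves both ends of the edge.\<close>
  have "coset_labelling ?H (Suc N) c"
    unfolding coset_labelling_def
  proof (intro conjI ballI impI)
    fix u assume u: "u \<in> L" "length u = Suc N"
    then obtain p s where ps: "u = p @ w @ s" using N[of u] by auto
    then show "\<exists>g \<in> carrier ?F. c u = ?H #>\<^bsub>?F\<^esub> g" using c u posL by blast
  next
    fix y assume y: "y \<in> L" "length y = Suc (Suc N)"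
    obtain a z where az: "y = a # z" using y by (cases y) auto
    obtain z' b where zb: "z = z' @ [b]" using az y by (cases z rule: rev_cases) auto
    have "z \<in> L" using y(1) language_ConsD[of a z X] by (simp add: az)
    then have "z' \<in> L" using zb language_appendD1 by blast
    then obtain p s where ps: "z' = p @ w @ s" using N[of z'] y az zb by auto
    have aL: "(a # p) @ w @ s \<in> L" "p @ w @ (s @ [b]) \<in> L"
      using y(1) \<open>z \<in> L\<close> az zb ps language_appendD1[of "a # z'" "[b]" X] by auto
    have "a \<in> A" using language_letters[OF y(1)] az by simp
    have car: "gen a \<in> carrier ?F" "pos p \<in> carrier ?F"
      using gen_in_carrier[OF \<open>a \<in> A\<close>] posL aL(2) by blast+
    have "c (tl y) = ?H #>\<^bsub>?F\<^esub> inv\<^bsub>?F\<^esub> (pos p)" using c[OF aL(2)] az zb ps by simp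
    moreover have "c (butlast y) = ?H #>\<^bsub>?F\<^esub> inv\<^bsub>?F\<^esub> (pos (a # p))"
      using c[OF aL(1)] az zb ps by (simp add: butlast_append)
    moreover have "inv\<^bsub>?F\<^esub> (pos (a # p)) \<otimes>\<^bsub>?F\<^esub> gen a = inv\<^bsub>?F\<^esub> (pos p)"
      using car by (simp add: pos_Cons[of a p A] G.inv_mult_group G.m_assoc)
    moreover have "pos (a # p) \<in> carrier ?F" using car by (simp add: pos_Cons[of a p A])
    ultimately show "c (tl y) = c (butlast y) #>\<^bsub>?F\<^esub> gen (hd y)"
      using az car subH by (simp add: G.coset_mult_assoc)
  qed
  then show ?thesis by blast
qed

theorem generate_return_words:
  assumes conn: "\<And>v. v \<in> L \<Longrightarrow> connected_rel (left_ext X v) (right_ext X v) (bi_ext X v)"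
    and w: "w \<in> L"
  shows "generate (free_group A) (pos ` R w) = carrier (free_group A)"
proof -
  interpret G: group "free_group A" by (rule group_free_group)
  let ?H = "generate (free_group A) (pos ` R w)"
  obtain n c where "coset_labelling ?H n c" using coset_labelling_return_words[OF w] by blast
  then have "\<exists>c. coset_labelling ?H 0 c"
  proof (induction n arbitrary: c)
    case (Suc n)
    then show ?case using coset_labelling_descend[OF conn] by blast
  qed blast
  then show ?thesis
    using generated_by_coset_labelling_Nil G.generate_is_subgroup[OF pos_return_words_in_carrier] by blast
qed

section \<open>Return words that are bases force dendricity\<close>

text \<open>A colouring of the extension graph of \<open>w\<close> that is constant along edges defines a homomorphism to
  \<^const>\<open>Z2\<close> recording whether the first and the last colour along a return word agree. It
  vanishes on return words to any \<open>wb\<close>; these generate, so it vanishes on the return words to \<open>w\<close>.\<close>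

lemma bases_imp_connected:
  assumes bases: "\<And>w. w \<in> L \<Longrightarrow> free_basis (free_group A) (pos ` R w)" and w: "w \<in> L"
  shows "connected_rel (left_ext X w) (right_ext X w) (bi_ext X w)"
  unfolding connected_rel_def
proof (intro allI impI)
  fix l r :: "'a \<Rightarrow> bool" assume lr: "\<forall>a b. (a, b) \<in> bi_ext X w \<longrightarrow> l a \<longleftrightarrow> r b"
  let ?F = "free_group A"
  have nth_w: "(g @ w @ [b]) ! length w = (if g = [] then b else (g @ w) ! length w)" for g b
    by (auto simp: nth_append simp flip: append_assoc)
  \<comment> \<open>Compares the colour of the letter after the initial \<open>w\<close> of
    \<open>q @ w\<close> with that of the letter before the final \<open>w\<close>, for a return
    word \<open>q\<close>.\<close>
  define f where "f = (\<lambda>g. r ((inv_into UNIV pos g @ w) ! length w) \<longleftrightarrow> l (last (inv_into UNIV pos g)))"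
  obtain \<psi> where \<psi>: "\<psi> \<in> hom ?F Z2" "\<And>g. g \<in> pos ` R w \<Longrightarrow> \<psi> g = f g"
    using free_basis_extend[OF group_free_group group_Z2 bases[OF w], of f] by auto
  interpret \<psi>: group_hom ?F Z2 \<psi>
    using \<psi>(1) by (simp add: group_free_group group_Z2 group_hom_def group_hom_axioms_def)
  have \<psi>_ret: "\<psi> (pos q) \<longleftrightarrow> (r ((q @ w) ! length w) \<longleftrightarrow> l (last q))" if "q \<in> R w" for q
    using \<psi>(2)[of "pos q"] that by (simp add: f_def inv_f_f[OF inj_pos])
  \<comment> \<open>The last letter of a return word and the letter \<open>b\<close> after the final
    \<open>w\<close> form an edge, so \<open>l\<close> may be replaced by \<open>r b\<close>. In
    this form the values telescope along a concatenation.\<close>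
  have key: "\<forall>b. g @ w @ [b] \<in> L \<longrightarrow> \<psi> (pos g) \<longleftrightarrow> (r ((g @ w @ [b]) ! length w) \<longleftrightarrow> r b)"
    if "g @ w \<in> L" "prefix w (g @ w)" for g
    using that
  proof (induction g rule: returns_induct)
    case Nil
    show ?case using \<psi>.hom_one by (simp add: pos_Nil[of A])
  next
    case (return q)
    show ?case
    proof (intro allI impI)
      fix b assume b: "q @ w @ [b] \<in> L"
      have q: "q = butlast q @ [last q]" using return_wordD(1)[OF return] by simp
      then have "butlast q @ ((last q # w) @ [b]) @ [] \<in> L" using b by (metis append.assoc append_Cons append_Nil append_Nil2)
      then have "(last q, b) \<in> bi_ext X w" using language_factor by (fastforce simp: bi_ext_def)
      then have "l (last q) \<longleftrightarrow> r b" using lr by blast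
      then show "\<psi> (pos q) \<longleftrightarrow> (r ((q @ w @ [b]) ! length w) \<longleftrightarrow> r b)"
        using \<psi>_ret[OF return] nth_w[of q b] return_wordD(1)[OF return] by simp
    qed
  next
    case (append p q)
    show ?case
    proof (intro allI impI)
      fix b assume b: "(p @ q) @ w @ [b] \<in> L"
      \<comment> \<open>The letter after the occurrence of \<open>w\<close> where \<open>p\<close>
        and \<open>q\<close> meet; \<open>r d\<close> enters both factors and cancels.\<close>
      define d where "d = (q @ w @ [b]) ! length w"
      have "prefix (w @ [d]) (q @ w @ [b])"
      proof -
        have "prefix w (q @ w @ [b])" using append.hyps(3) prefix_order.trans by (metis append_assoc prefixI)
        then obtain t where t: "q @ w @ [b] = w @ t" by (auto simp: prefix_def)
        then have "t \<noteq> []" by (auto dest: arg_cong[of _ _ length])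
        then show ?thesis using t d_def by (cases t) (auto simp: prefix_def nth_append)
      qed
      then obtain t where t: "q @ w @ [b] = w @ d # t" by (auto simp: prefix_def)
      have "p @ w @ [d] \<in> L" using b t language_appendD1[of "p @ w @ [d]" t X] by simp
      then have p: "\<psi> (pos p) \<longleftrightarrow> (r ((p @ w @ [d]) ! length w) \<longleftrightarrow> r d)" using append.IH(1) by blast
      have "q @ w @ [b] \<in> L" using b language_appendD2[of p "q @ w @ [b]" X] by simp
      then have q: "\<psi> (pos q) \<longleftrightarrow> (r d \<longleftrightarrow> r b)" using append.IH(2) d_def by blast
      have car: "pos p \<in> carrier ?F" "pos q \<in> carrier ?F"
        using language_letters[OF b] by (auto intro!: pos_in_carrier)
      have "\<psi> (pos (p @ q)) \<longleftrightarrow> (\<psi> (pos p) \<longleftrightarrow> \<psi> (pos q))"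
        using car by (simp add: pos_append[of p q A])
      moreover have "((p @ q) @ w @ [b]) ! length w = (p @ w @ [d]) ! length w"
        using t by (simp add: nth_append)
      ultimately show "\<psi> (pos (p @ q)) \<longleftrightarrow> (r (((p @ q) @ w @ [b]) ! length w) \<longleftrightarrow> r b)"
        using p q by auto
    qed
  qed
  obtain b0 where b0: "w @ [b0] \<in> L" using extend_right[OF w] by blast
  have "\<psi> u" if "u \<in> carrier ?F" for u
  proof -
    \<comment> \<open>Along a return word to \<open>w @ [b0]\<close> the first and the last
      \<open>w\<close> are both followed by \<open>b0\<close>, so the telescoped value is trivial;
      these words generate.\<close>
    have "\<psi> u = (\<lambda>_. \<one>\<^bsub>Z2\<^esub>) u"
    proof (rule hom_eq_on_generate[OF group_free_group group_Z2 \<psi>(1)])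
      show "(\<lambda>_. \<one>\<^bsub>Z2\<^esub>) \<in> hom ?F Z2" by (simp add: hom_def)
      show "pos ` R (w @ [b0]) \<subseteq> carrier ?F" by (rule pos_return_words_in_carrier)
      show "u \<in> generate ?F (pos ` R (w @ [b0]))"
        using that free_basis_generates[OF group_free_group bases[OF b0]] by simp
    next
      fix s assume "s \<in> pos ` R (w @ [b0])"
      then obtain q where q: "q \<in> R (w @ [b0])" "s = pos q" by blast
      have qL: "q @ w @ [b0] \<in> L" using return_wordD(2)[OF q(1)] by simp
      obtain t where t: "q @ w @ [b0] = (w @ [b0]) @ t" using return_wordD(3)[OF q(1)] by auto
      have "prefix w (q @ w)"
        using t by (metis append_assoc prefixI prefix_length_prefix length_append le_add2)
      moreover have "q @ w \<in> L" using qL language_appendD1[of "q @ w" "[b0]" X] by simp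
      ultimately have "\<psi> (pos q) \<longleftrightarrow> (r ((q @ w @ [b0]) ! length w) \<longleftrightarrow> r b0)" using key qL by blast
      then show "\<psi> s = \<one>\<^bsub>Z2\<^esub>" using q t by (simp add: nth_append)
    qed
    then show ?thesis by simp
  qed
  then have all: "r ((g @ w @ [b]) ! length w) \<longleftrightarrow> r b" if "g @ w @ [b] \<in> L" "prefix w (g @ w)" for g b
  proof -
    have "pos g \<in> carrier ?F" using language_letters[OF that(1)] by (auto intro!: pos_in_carrier)
    moreover have "g @ w \<in> L" using language_appendD1[of "g @ w" "[b]" X] that(1) by simp
    ultimately show ?thesis using key[OF _ that(2)] that(1) \<open>\<And>u. u \<in> carrier ?F \<Longrightarrow> \<psi> u\<close> by blast
  qed
  have r_const: "r b = r b0" if b: "b \<in> right_ext X w" for b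
  proof -
    \<comment> \<open>By recurrence \<open>w @ [b]\<close> occurs to the right of
      \<open>w @ [b0]\<close>, and \<open>g\<close> leads from one to the other.\<close>
    obtain N where N: "\<And>v. v \<in> L \<Longrightarrow> N \<le> length v \<Longrightarrow> \<exists>p s. v = p @ (w @ [b]) @ s"
      using recurrence_bound[of "w @ [b]"] b by (auto simp: right_ext_def)
    obtain e where e: "length e = N" "(w @ [b0]) @ e \<in> L" using extend_right_many[OF b0] by blast
    then have "e \<in> L" using language_appendD2 by blast
    then obtain p s where ps: "e = p @ (w @ [b]) @ s" using N e(1) by blast
    define g where "g = w @ [b0] @ p"
    have "g @ w @ [b] \<in> L"
      using e(2) ps language_appendD1[of "g @ w @ [b]" s X] by (simp add: g_def)
    then have "r ((g @ w @ [b]) ! length w) \<longleftrightarrow> r b" by (rule all) (simp add: g_def)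
    then show ?thesis by (simp add: g_def nth_append)
  qed
  have "l a = r b0" if a: "a \<in> left_ext X w" for a
  proof -
    obtain b where "(a # w) @ [b] \<in> L" using a extend_right[of "a # w" X] by (auto simp: left_ext_def)
    then have "(a, b) \<in> bi_ext X w" by (simp add: bi_ext_def)
    then show ?thesis using lr r_const[of b] bi_ext_subset by blast
  qed
  then show "\<exists>c. (\<forall>a \<in> left_ext X w. l a = c) \<and> (\<forall>b \<in> right_ext X w. r b = c)"
    using r_const by blast
qed

section \<open>Dendricity in terms of the excess\<close>

lemma dendric_word_iff:
  assumes "w \<in> L"
  shows "dendric_word X w \<longleftrightarrow>
    connected_rel (left_ext X w) (right_ext X w) (bi_ext X w) \<and> forest_rel (bi_ext X w)"
proof -
  have "extension_graph X w = bigraph (left_ext X w) (right_ext X w) (bi_ext X w)"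
    by (simp add: extension_graph_def bigraph_def)
  then show ?thesis
    using undirected_tree_bigraph_iff[OF bi_ext_subset] left_ext_nonempty[OF assms]
    by (simp add: dendric_word_def)
qed

lemma connected_excess:
  assumes "w \<in> L" "connected_rel (left_ext X w) (right_ext X w) (bi_ext X w)"
  shows "0 \<le> excess w" "forest_rel (bi_ext X w) \<longleftrightarrow> excess w = 0"
  using connected_rel_card[OF _ _ bi_ext_subset left_ext_nonempty[OF assms(1)] assms(2)]
  by (auto simp: excess_def)

theorem bases_imp_dendric:
  assumes bases: "\<And>w. w \<in> L \<Longrightarrow> free_basis (free_group A) (pos ` R w)"
  shows "dendric X"
  unfolding dendric_def
proof
  fix v assume v: "v \<in> L"
  \<comment> \<open>\<open>a # v\<close> is longer than \<open>v\<close>, so \<open>v\<close> is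
    among the words avoiding it and its excess enters the sum for \<open>R (a # v)\<close>.\<close>
  obtain a where a: "a # v \<in> L" using extend_left[OF v] by blast
  have conn: "connected_rel (left_ext X u) (right_ext X u) (bi_ext X u)" if "u \<in> L" for u
    using bases that by (rule bases_imp_connected)
  have "card (pos ` R (a # v)) = card A"
    using finite_A finite_return_words[OF a] bases[OF a] by (intro card_free_basis) auto
  then have "card (R (a # v)) = card A"
    using card_image[OF inj_on_subset[OF inj_pos]] by (metis subset_UNIV)
  then have "(\<Sum>u \<in> {u \<in> L. \<not> sublist (a # v) u}. excess u) = 0"
    using card_return_words[OF a] by simp
  then have "\<forall>u \<in> {u \<in> L. \<not> sublist (a # v) u}. excess u = 0"
    using finite_avoiding[OF a] conn connected_excess(1) by (subst (asm) sum_nonneg_eq_0_iff) auto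
  moreover have "\<not> sublist (a # v) v" using sublist_length_le by fastforce
  ultimately have "excess v = 0" using v by blast
  then show "dendric_word X v"
    using dendric_word_iff[OF v] conn[OF v] connected_excess(2)[OF v conn[OF v]] by blast
qed

lemma dendric_card_return_words:
  assumes dend: "dendric X" and w: "w \<in> L"
  shows "card (R w) = card A"
proof (cases "w = []")
  case True
  then show ?thesis by (simp add: return_words_Nil card_image inj_on_def)
next
  case False
  have "excess v = 0" if "v \<in> L" for v
    using dend that dendric_word_iff[OF that] connected_excess[OF that] by (auto simp: dendric_def)
  then show ?thesis using card_return_words[OF w False] by simp
qed

end

section \<open>Generalised extension graphs of dendric shifts are forests\<close>

definition prefix_code :: "'a list set \<Rightarrow> bool" where
  "prefix_code S \<longleftrightarrow> (\<forall>u \<in> S. \<forall>v \<in> S. prefix u v \<longrightarrow> u = v)"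

definition suffix_code :: "'a list set \<Rightarrow> bool" where
  "suffix_code S \<longleftrightarrow> (\<forall>u \<in> S. \<forall>v \<in> S. suffix u v \<longrightarrow> u = v)"

lemma prefix_codeD: "prefix_code S \<Longrightarrow> u \<in> S \<Longrightarrow> v \<in> S \<Longrightarrow> prefix u v \<Longrightarrow> u = v"
  by (simp add: prefix_code_def)

lemma suffix_codeD: "suffix_code S \<Longrightarrow> u \<in> S \<Longrightarrow> v \<in> S \<Longrightarrow> suffix u v \<Longrightarrow> u = v"
  by (simp add: suffix_code_def)

lemma prefix_code_rev: "prefix_code (rev ` S) \<longleftrightarrow> suffix_code S"
  by (auto simp: prefix_code_def suffix_code_def suffix_to_prefix)

lemma suffix_code_rev: "suffix_code (rev ` S) \<longleftrightarrow> prefix_code S"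
  using prefix_code_rev[of "rev ` S"] by (simp add: image_image)

lemma suffix_code_Nil: "suffix_code S \<Longrightarrow> [] \<in> S \<Longrightarrow> S = {[]}"
  by (auto dest: suffix_codeD[of S "[]"])

lemma prefix_code_Nil: "prefix_code S \<Longrightarrow> [] \<in> S \<Longrightarrow> S = {[]}"
  by (auto dest: prefix_codeD[of S "[]"])

text \<open>By maximality of the length, a word of \<open>U\<close> ending in \<open>u'\<close> has
  just one letter more and is itself shortened to \<open>u'\<close>, so \<open>u'\<close> ends no
  other word that remains.\<close>

lemma suffix_code_shorten:
  fixes U :: "'a list set" and u' :: "'a list"
  defines "\<pi> \<equiv> \<lambda>u. if \<exists>a. u = a # u' then u' else u"
  assumes fin: "finite U" and U: "suffix_code U" and u: "x # u' \<in> U"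
    and max: "\<And>v. v \<in> U \<Longrightarrow> length v \<le> Suc (length u')"
  shows "suffix_code (\<pi> ` U)" "sum length (\<pi> ` U) < sum length U" "u' \<notin> U"
proof -
  show notin: "u' \<notin> U"
    using suffix_codeD[OF U _ u, of u'] by (auto simp: suffix_def)
  have le: "length (\<pi> v) \<le> length v" for v by (auto simp: \<pi>_def)
  have "sum length (\<pi> ` U) \<le> sum (length \<circ> \<pi>) U" by (rule sum_image_le[OF fin]) simp
  also have "\<dots> < sum length U"
    using fin le u by (intro sum_strict_mono_ex1) (auto simp: \<pi>_def intro!: bexI[of _ "x # u'"])
  finally show "sum length (\<pi> ` U) < sum length U" .
  have dich: "\<pi> v = u' \<and> (\<exists>a. v = a # u') \<or> \<pi> v = v \<and> (\<nexists>a. v = a # u')" for v by (auto simp: \<pi>_def)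
  show "suffix_code (\<pi> ` U)"
    unfolding suffix_code_def
  proof (clarify)
    fix v w assume vw: "v \<in> U" "w \<in> U" "suffix (\<pi> v) (\<pi> w)"
    consider "\<pi> v = u'" "\<pi> w = u'" | "\<pi> v = u'" "\<pi> w = w" "\<nexists>a. w = a # u'"
      | a where "\<pi> v = v" "\<pi> w = u'" "w = a # u'" "\<nexists>a. v = a # u'" | "\<pi> v = v" "\<pi> w = w"
      using dich[of v] dich[of w] by blast
    then show "\<pi> v = \<pi> w"
    proof cases
      case 2
      then obtain t where t: "w = t @ u'" using vw(3) by (auto simp: suffix_def)
      then have "length t \<le> 1" using max[OF vw(2)] by simp
      then show ?thesis using t 2 by (cases t) auto
    next
      case (3 a)
      then have "suffix v w" using vw(3) by (auto simp: suffix_def)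
      then show ?thesis using suffix_codeD[OF U vw(1,2)] 3 by blast
    next
      case 4
      then show ?thesis using suffix_codeD[OF U vw(1,2)] vw(3) by simp
    qed simp
  qed
qed

lemma prefix_code_shorten:
  fixes V :: "'a list set" and v' :: "'a list"
  defines "\<pi> \<equiv> \<lambda>v. if \<exists>b. v = v' @ [b] then v' else v"
  assumes fin: "finite V" and V: "prefix_code V" and v: "v' @ [x] \<in> V"
    and max: "\<And>v. v \<in> V \<Longrightarrow> length v \<le> Suc (length v')"
  shows "prefix_code (\<pi> ` V)" "sum length (\<pi> ` V) < sum length V" "v' \<notin> V"
proof -
  let ?\<rho> = "\<lambda>u. if \<exists>a. u = a # rev v' then rev v' else u"
  have len: "sum length (rev ` S) = sum length S" for S :: "'a list set"
    by (subst sum.reindex) auto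
  have rev: "rev (\<pi> v) = ?\<rho> (rev v)" for v
    by (auto simp: \<pi>_def rev_swap)
  have im: "rev ` \<pi> ` V = ?\<rho> ` rev ` V" by (simp only: image_image rev)
  have hyps: "finite (rev ` V)" "suffix_code (rev ` V)" "x # rev v' \<in> rev ` V"
    "\<And>u. u \<in> rev ` V \<Longrightarrow> length u \<le> Suc (length (rev v'))"
    using fin V v max by (auto simp: suffix_code_rev image_iff intro!: bexI[of _ "v' @ [x]"])
  note sh = suffix_code_shorten[OF hyps]
  show "prefix_code (\<pi> ` V)" using sh(1) unfolding im[symmetric] suffix_code_rev .
  show "sum length (\<pi> ` V) < sum length V" using sh(2) unfolding im[symmetric] len .
  show "v' \<notin> V" using sh(3) by auto
qed

context minimal_shift
begin

text \<open>Siblings \<open>a # u'\<close> of a longest word are collapsed to \<open>u'\<close>. The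
  fibre over \<open>u'\<close> is part of the extension graph of \<open>u' @ w\<close>, the other
  fibres have at most one left vertex, and the quotient belongs to a code of smaller total length.
  The middle word \<open>w\<close> is what lets the next theorem use this for its own
  fibres.\<close>

lemma forest_suffix_code_letters:
  assumes forest: "\<And>v. forest_rel (bi_ext X v)" and "finite U" "suffix_code U"
  shows "forest_rel {(u, v). u \<in> U \<and> length v = 1 \<and> u @ w @ v \<in> L}"
  using assms(2,3)
proof (induction "sum length U" arbitrary: U rule: less_induct)
  case less
  let ?E = "{(u, v). u \<in> U \<and> length v = 1 \<and> u @ w @ v \<in> L}"
  have letters: "forest_rel ((\<lambda>(a, b). (a # z, [b])) ` bi_ext X (z @ w))" for z
    by (rule forest_rel_map[OF forest]) (auto simp: inj_def)
  consider "[] \<in> U" | "[] \<notin> U" "\<forall>u \<in> U. length u \<le> 1" | u where "u \<in> U" "length u > 1" by force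
  then show ?case
  proof cases
    case 1
    then have "U = {[]}" using less.prems suffix_code_Nil by blast
    then show ?thesis by (intro forest_rel_singleton_left[of _ "[]"]) auto
  next
    case 2
    have "?E \<subseteq> (\<lambda>(a, b). (a # [], [b])) ` bi_ext X ([] @ w)"
    proof clarify
      fix u v assume uv: "u \<in> U" "length v = 1" "u @ w @ v \<in> L"
      then have "length u = 1" using 2 by (metis One_nat_def le_antisym length_0_conv less_one not_less)
      then obtain a b where "u = [a]" "v = [b]" using uv(2) by (auto simp: length_Suc_conv)
      then show "(u, v) \<in> (\<lambda>(a, b). (a # [], [b])) ` bi_ext X ([] @ w)"
        using uv(3) by (auto simp: bi_ext_def)
    qed
    then show ?thesis using letters[of "[]"] forest_rel_subset by blast
  next
    case (3 u)
    define m where "m = Max (length ` U)"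
    have m: "\<And>v. v \<in> U \<Longrightarrow> length v \<le> m" using less.prems(1) by (auto simp: m_def)
    have "m \<in> length ` U" unfolding m_def using less.prems(1) 3(1) by (intro Max_in) auto
    then obtain u0 where u0: "u0 \<in> U" "length u0 = m" by blast
    then obtain x u' where xu: "u0 = x # u'" using m[OF 3(1)] 3(2) by (cases u0) auto
    define \<pi> where "\<pi> = (\<lambda>u. if \<exists>a. u = a # u' then u' else u)"
    have max: "\<And>v. v \<in> U \<Longrightarrow> length v \<le> Suc (length u')" using m u0(2) xu by simp
    note sh = suffix_code_shorten[OF less.prems u0(1)[unfolded xu] max, folded \<pi>_def]
    show ?thesis
    proof (rule forest_rel_collapse_left[where \<pi> = \<pi>])
      have "forest_rel {(u, v). u \<in> \<pi> ` U \<and> length v = 1 \<and> u @ w @ v \<in> L}"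
        using less.hyps[OF sh(2)] less.prems(1) sh(1) by blast
      moreover have "\<pi> u @ w @ v \<in> L" if "u @ w @ v \<in> L" for u v
        using that language_ConsD[of _ "u' @ w @ v" X] by (auto simp: \<pi>_def)
      ultimately show "forest_rel ((\<lambda>(u, v). (\<pi> u, v)) ` ?E)"
        by (auto elim!: forest_rel_subset)
    next
      fix z
      show "forest_rel {(u, v) \<in> ?E. \<pi> u = z}"
      proof (cases "z = u'")
        case True
        have "{(u, v) \<in> ?E. \<pi> u = z} \<subseteq> (\<lambda>(a, b). (a # u', [b])) ` bi_ext X (u' @ w)"
        proof clarify
          fix u v assume uv: "u \<in> U" "length v = 1" "u @ w @ v \<in> L" "z = \<pi> u"
          then obtain a b where "u = a # u'" "v = [b]"
            using True sh(3) by (auto simp: \<pi>_def length_Suc_conv split: if_splits)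
          then show "(u, v) \<in> (\<lambda>(a, b). (a # u', [b])) ` bi_ext X (u' @ w)"
            using uv(3) by (auto simp: bi_ext_def)
        qed
        then show ?thesis using letters[of u'] forest_rel_subset by blast
      next
        case False
        then show ?thesis
          by (intro forest_rel_singleton_left[of _ z]) (auto simp: \<pi>_def split: if_splits)
      qed
    qed
  qed
qed

text \<open>The same collapse on the right. The fibre over \<open>v'\<close> now has a whole suffix
  code on the left and single letters on the right, which is the preceding lemma with
  \<open>v'\<close> in the middle.\<close>

theorem forest_suffix_prefix_code:
  assumes forest: "\<And>v. forest_rel (bi_ext X v)" and U: "finite U" "suffix_code U" and "finite V" "prefix_code V"
  shows "forest_rel {(u, v). u \<in> U \<and> v \<in> V \<and> u @ v \<in> L}"
  using assms(4,5)
proof (induction "sum length V" arbitrary: V rule: less_induct)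
  case less
  let ?E = "{(u, v). u \<in> U \<and> v \<in> V \<and> u @ v \<in> L}"
  note letters = forest_suffix_code_letters[OF forest U]
  consider "[] \<in> V" | "[] \<notin> V" "\<forall>v \<in> V. length v \<le> 1" | v where "v \<in> V" "length v > 1" by force
  then show ?case
  proof cases
    case 1
    then have "V = {[]}" using less.prems prefix_code_Nil by blast
    then show ?thesis by (intro forest_rel_singleton_right[of _ "[]"]) auto
  next
    case 2
    have "length v = 1" if "v \<in> V" for v
      using 2 that by (metis One_nat_def le_antisym length_0_conv less_one not_less)
    then show ?thesis using letters[of "[]"] by (auto elim!: forest_rel_subset)
  next
    case (3 v)
    define m where "m = Max (length ` V)"
    have m: "\<And>v. v \<in> V \<Longrightarrow> length v \<le> m" using less.prems(1) by (auto simp: m_def)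
    have "m \<in> length ` V" unfolding m_def using less.prems(1) 3(1) by (intro Max_in) auto
    then obtain v0 where v0: "v0 \<in> V" "length v0 = m" by blast
    then obtain v' x where vx: "v0 = v' @ [x]" using m[OF 3(1)] 3(2) by (cases v0 rule: rev_cases) auto
    define \<pi> where "\<pi> = (\<lambda>v. if \<exists>b. v = v' @ [b] then v' else v)"
    have max: "\<And>v. v \<in> V \<Longrightarrow> length v \<le> Suc (length v')" using m v0(2) vx by simp
    note sh = prefix_code_shorten[OF less.prems v0(1)[unfolded vx] max, folded \<pi>_def]
    show ?thesis
    proof (rule forest_rel_collapse_right[where \<pi> = \<pi>])
      have "forest_rel {(u, v). u \<in> U \<and> v \<in> \<pi> ` V \<and> u @ v \<in> L}"
        using less.hyps[OF sh(2)] less.prems(1) sh(1) by blast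
      moreover have "u @ \<pi> v \<in> L" if "u @ v \<in> L" for u v
        using that language_appendD1[of "u @ v'" "[_]" X] by (auto simp: \<pi>_def)
      ultimately show "forest_rel ((\<lambda>(u, v). (u, \<pi> v)) ` ?E)"
        by (auto elim!: forest_rel_subset)
    next
      fix z
      show "forest_rel {(u, v) \<in> ?E. \<pi> v = z}"
      proof (cases "z = v'")
        case True
        have "forest_rel ((\<lambda>(u, s). (u, v' @ s)) ` {(u, s). u \<in> U \<and> length s = 1 \<and> u @ v' @ s \<in> L})"
          using forest_rel_map[OF letters[of v'], of "\<lambda>u. u" "\<lambda>s. v' @ s"] by (simp add: inj_def)
        moreover have "{(u, v) \<in> ?E. \<pi> v = z} \<subseteq>
          (\<lambda>(u, s). (u, v' @ s)) ` {(u, s). u \<in> U \<and> length s = 1 \<and> u @ v' @ s \<in> L}"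
        proof clarify
          fix u v assume uv: "u \<in> U" "v \<in> V" "u @ v \<in> L" "z = \<pi> v"
          then obtain b where "v = v' @ [b]"
            using True sh(3) by (auto simp: \<pi>_def split: if_splits)
          then show "(u, v) \<in> (\<lambda>(u, s). (u, v' @ s)) ` {(u, s). u \<in> U \<and> length s = 1 \<and> u @ v' @ s \<in> L}"
            using uv by (intro image_eqI[of _ _ "(u, [b])"]) auto
        qed
        ultimately show ?thesis by (rule forest_rel_subset)
      next
        case False
        then show ?thesis
          by (intro forest_rel_singleton_right[of _ z]) (auto simp: \<pi>_def split: if_splits)
      qed
    qed
  qed
qed

end

section \<open>Bifix codes in dendric languages\<close>

text \<open>\<open>L\<close> is an arbitrary set with the acyclicity that dendric languages have, so
  that the locale is closed under reversal. Each statement on right parts thereby gives the mirrored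
  one on left parts.\<close>

locale bifix_code =
  fixes Y L :: "'a list set"
  assumes finite_Y: "finite Y"
    and prefix_code_Y: "prefix_code Y" and suffix_code_Y: "suffix_code Y"
    and factors: "p @ w @ s \<in> Y \<Longrightarrow> w \<in> L"
    and forest: "finite U \<Longrightarrow> finite V \<Longrightarrow> suffix_code U \<Longrightarrow> prefix_code V \<Longrightarrow>
      forest_rel {(u, v). u \<in> U \<and> v \<in> V \<and> u @ v \<in> L}"
begin

lemma bifix_code_rev: "bifix_code (rev ` Y) (rev ` L)"
proof
  show "finite (rev ` Y)" "prefix_code (rev ` Y)" "suffix_code (rev ` Y)"
    using finite_Y prefix_code_Y suffix_code_Y by (auto simp: prefix_code_rev suffix_code_rev)
  show "w \<in> rev ` L" if in_Y: "p @ w @ s \<in> rev ` Y" for p w s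
  proof -
    obtain y where y: "y \<in> Y" "p @ w @ s = rev y" using in_Y by blast
    then have "y = rev s @ rev w @ rev p" by (metis append_assoc rev_append rev_rev_ident)
    then have "rev w \<in> L" using y(1) factors by blast
    then show ?thesis by (metis image_eqI rev_rev_ident)
  qed
  show "forest_rel {(u, v). u \<in> U \<and> v \<in> V \<and> u @ v \<in> rev ` L}"
    if UV: "finite U" "finite V" "suffix_code U" "prefix_code V" for U V
  proof -
    let ?E = "{(v, u). v \<in> rev ` V \<and> u \<in> rev ` U \<and> v @ u \<in> L}"
    have "forest_rel ?E" using UV by (intro forest) (auto simp: prefix_code_rev suffix_code_rev)
    then have "forest_rel ((\<lambda>(u, v). (rev u, rev v)) ` (?E\<inverse>))"
      by (intro forest_rel_map forest_rel_converse) (auto simp: inj_def)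
    moreover have "{(u, v). u \<in> U \<and> v \<in> V \<and> u @ v \<in> rev ` L} \<subseteq> (\<lambda>(u, v). (rev u, rev v)) ` (?E\<inverse>)"
    proof clarify
      fix u v y assume uv: "u \<in> U" "v \<in> V" "y \<in> L" "u @ v = rev y"
      then have "rev v @ rev u \<in> L" by (metis rev_append rev_rev_ident)
      then show "(u, v) \<in> (\<lambda>(u, v). (rev u, rev v)) ` (?E\<inverse>)"
        using uv by (intro image_eqI[of _ _ "(rev u, rev v)"]) auto
    qed
    ultimately show ?thesis by (rule forest_rel_subset)
  qed
qed

section \<open>Cuts of code words and chains of identified cuts\<close>

definition cuts :: "('a list \<times> 'a list) set" where
  "cuts = {(p, s). p @ s \<in> Y}"

definition inner_cuts :: "('a list \<times> 'a list) set" where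
  "inner_cuts = {(p, s) \<in> cuts. p \<noteq> [] \<and> s \<noteq> []}"

text \<open>In the bouquet of loops spelling the words of \<open>Y\<close>, cuts are the vertices,
  and these are the identifications forced at once by the base point: being reached from it by the
  same word or leading to it by the same word.\<close>

definition share :: "'a list \<times> 'a list \<Rightarrow> 'a list \<times> 'a list \<Rightarrow> bool" where
  "share c d \<longleftrightarrow> fst c = fst d \<or> snd c = snd d"

definition chain :: "('a list \<times> 'a list) list \<Rightarrow> bool" where
  "chain cs \<longleftrightarrow> set cs \<subseteq> inner_cuts \<and> successively share cs"

lemma chain_Cons: "chain (c # cs) \<longleftrightarrow> c \<in> inner_cuts \<and> chain cs \<and> (cs \<noteq> [] \<longrightarrow> share c (hd cs))"
  by (cases cs) (auto simp: chain_def)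

lemma chain_append: "chain (cs @ ds) \<longleftrightarrow> chain cs \<and> chain ds \<and> (cs \<noteq> [] \<longrightarrow> ds \<noteq> [] \<longrightarrow> share (last cs) (hd ds))"
  by (auto simp: chain_def successively_append_iff)

lemma chain_rev: "chain cs \<Longrightarrow> chain (rev cs)"
proof -
  assume "chain cs"
  moreover have eq: "(\<lambda>c d. share d c) = share" by (auto simp: share_def fun_eq_iff)
  ultimately show ?thesis unfolding chain_def successively_rev set_rev eq by simp
qed

lemma chain_const:
  assumes "chain cs" "\<And>c. c \<in> set cs \<Longrightarrow> l (fst c) = r (snd c)" "c \<in> set cs" "d \<in> set cs"
  shows "r (snd c) = r (snd d)"
proof -
  have "r (snd c) = r (snd (hd cs))" if "c \<in> set cs" for c
    using assms(1,2) that
  proof (induction cs arbitrary: c)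
    case (Cons e cs)
    show ?case
    proof (cases "c = e \<or> cs = []")
      case False
      then have "chain cs" "c \<in> set cs" "share e (hd cs)" "hd cs \<in> set cs"
        using Cons.prems(1,3) by (auto simp: chain_Cons)
      moreover have "r (snd c) = r (snd (hd cs))"
        by (rule Cons.IH) (use calculation Cons.prems(2) in auto)
      moreover have "r (snd (hd cs)) = r (snd e)"
        using \<open>share e (hd cs)\<close> Cons.prems(2)[of e] Cons.prems(2)[of "hd cs"] \<open>hd cs \<in> set cs\<close>
        unfolding share_def by (metis list.set_intros)
      ultimately show ?thesis by simp
    qed (use Cons.prems in auto)
  qed simp
  then show ?thesis using assms(3,4) by metis
qed

lemma inner_cut_factors:
  assumes "(p, s @ t) \<in> inner_cuts"
  shows "p @ s \<in> L"
  using assms factors[of "[]" "p @ s" t] by (simp add: inner_cuts_def cuts_def)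

text \<open>If the right parts \<open>s\<close> and \<open>t\<close> of the end cuts were comparable, the function telling whether
  \<open>u @ s \<in> Y\<close> would extend over the forest obtained by merging \<open>t\<close> into \<open>s\<close>; but it separates \<open>s\<close>
  from \<open>t\<close>.\<close>

lemma chain_ends_prefix:
  assumes chain: "chain cs" and "cs \<noteq> []"
    and tl: "suffix_code (fst ` set (tl cs))" "prefix_code (snd ` set (tl cs))"
    and bl: "prefix_code (snd ` set (butlast cs))"
    and st: "prefix (snd (hd cs)) (snd (last cs))"
  shows "snd (hd cs) = snd (last cs)"
proof (rule ccontr)
  assume neq: "snd (hd cs) \<noteq> snd (last cs)"
  define s t where "s = snd (hd cs)" and "t = snd (last cs)"
  obtain c cs' where cs: "cs = c # cs'" using \<open>cs \<noteq> []\<close> by (cases cs) auto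
  have ne: "cs' \<noteq> []" using neq cs by auto
  have last: "last cs = last cs'" "last cs' \<in> set cs'" using cs ne by auto
  have t_tl: "t \<in> snd ` set (tl cs)" using last cs by (auto simp: t_def)
  have s_tl: "s \<notin> snd ` set (tl cs)"
    using prefix_codeD[OF tl(2) _ t_tl] st neq by (auto simp: s_def t_def)
  \<comment> \<open>\<open>s\<close> is not a right part of the tail, so the first two cuts share
    their left part. The left parts are thus those of the tail, a suffix code by assumption.\<close>
  have "share c (hd cs')" "hd cs' \<in> set cs'" using chain cs ne by (auto simp: chain_Cons)
  moreover have "snd c \<noteq> snd (hd cs')" using s_tl cs calculation(2) by (auto simp: s_def)
  ultimately have "fst c = fst (hd cs')" by (simp add: share_def)
  then have "fst ` set cs = fst ` set (tl cs)" using cs \<open>hd cs' \<in> set cs'\<close> by auto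
  then have U: "suffix_code (fst ` set cs)" using tl(1) by simp
  define V where "V = snd ` set (butlast cs)"
  have cs_last: "cs = butlast cs @ [last cs]" using \<open>cs \<noteq> []\<close> by simp
  have s_V: "s \<in> V" using cs ne by (simp add: V_def s_def)
  have t_V: "t \<notin> V" using prefix_codeD[OF bl s_V[unfolded V_def]] st neq by (auto simp: V_def s_def t_def)
  let ?E = "{(u, v). u \<in> fst ` set cs \<and> v \<in> V \<and> u @ v \<in> L}"
  have "forest_rel ?E" using U bl by (intro forest) (auto simp: V_def)
  then obtain l r where lr: "\<And>u v. (u, v) \<in> ?E \<Longrightarrow> (v = s \<longrightarrow> u @ s \<in> Y) \<longleftrightarrow> (l u \<longleftrightarrow> r v)"
    using forest_relE[of ?E "\<lambda>u v. v = s \<longrightarrow> u @ s \<in> Y"] by blast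
  \<comment> \<open>A cut \<open>(p, t)\<close> has no edge at \<open>t\<close>, which is outside
    \<open>V\<close>; instead there is an edge from \<open>p\<close> to the proper prefix
    \<open>s\<close> of \<open>t\<close>, where \<open>p @ s \<notin> Y\<close>. Hence the value
    opposite to \<open>r s\<close>.\<close>
  define m where "m = (\<lambda>v. if v = t then \<not> r s else r v)"
  have "l (fst d) = m (snd d)" if d: "d \<in> set cs" for d
  proof -
    obtain p v where pv: "d = (p, v)" by force
    have in_Y: "p @ v \<in> Y" and inner: "(p, v) \<in> inner_cuts"
      using d pv chain by (auto simp: chain_def inner_cuts_def cuts_def)
    have p: "p \<in> fst ` set cs" using d pv by force
    show ?thesis
    proof (cases "v = t")
      case True
      obtain x where x: "t = s @ x" "x \<noteq> []" using st neq by (auto simp: s_def t_def prefix_def)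
      have "p @ s \<in> L" using inner True x inner_cut_factors by blast
      then have "(p, s) \<in> ?E" using p s_V by simp
      moreover have "p @ s \<notin> Y"
        using prefix_codeD[OF prefix_code_Y _ in_Y, of "p @ s"] True x by auto
      ultimately have "l p \<longleftrightarrow> \<not> r s" using lr[of p s] by auto
      then show ?thesis using pv True by (simp add: m_def)
    next
      case False
      have "set cs = insert (last cs) (set (butlast cs))"
        using arg_cong[OF cs_last, of set] by simp
      moreover have "d \<noteq> last cs" using False pv unfolding t_def by (metis snd_conv)
      ultimately have "d \<in> set (butlast cs)" using d by blast
      then have "v \<in> V" using pv by (force simp: V_def)
      moreover have "p @ v \<in> L" using inner inner_cut_factors[of p v "[]"] by simp
      ultimately have "l p \<longleftrightarrow> r v" using lr[of p v] p in_Y by auto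
      then show ?thesis using pv False by (simp add: m_def)
    qed
  qed
  then have "m s = m t"
    using chain_const[OF chain, of l m "hd cs" "last cs"] \<open>cs \<noteq> []\<close> by (simp add: s_def t_def)
  then show False using neq by (auto simp: m_def s_def t_def)
qed

definition flip_cut :: "'a list \<times> 'a list \<Rightarrow> 'a list \<times> 'a list" where
  "flip_cut c = (rev (snd c), rev (fst c))"

lemma chain_flip:
  assumes "chain cs"
  shows "bifix_code.chain (rev ` Y) (map flip_cut cs)"
proof -
  interpret r: bifix_code "rev ` Y" "rev ` L" by (rule bifix_code_rev)
  have "flip_cut c \<in> r.inner_cuts" if "c \<in> inner_cuts" for c
    using that unfolding r.inner_cuts_def r.cuts_def inner_cuts_def cuts_def flip_cut_def
    by (auto simp: image_iff intro!: bexI[of _ "fst c @ snd c"])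
  moreover have "r.share (flip_cut c) (flip_cut d) \<longleftrightarrow> share c d" for c d
    by (auto simp: r.share_def share_def flip_cut_def)
  ultimately show ?thesis
    using assms by (auto simp: r.chain_def chain_def successively_map)
qed

text \<open>Any two cuts of the chain lie together in its tail or in its front part, where induction
  applies, unless they are its two ends. For the ends, \<open>chain_ends_prefix\<close> is used four
  times: for the chain and its reversal, each also in the mirror image that exchanges left and right
  parts.\<close>

lemma chain_codes:
  assumes "chain cs"
  shows "suffix_code (fst ` set cs) \<and> prefix_code (snd ` set cs)"
  using assms
proof (induction "length cs" arbitrary: cs rule: less_induct)
  case less
  show ?case
  proof (cases "cs = []")
    case True
    then show ?thesis by (simp add: suffix_code_def prefix_code_def)
  next
    case False
    then have cs: "cs = hd cs # tl cs" "cs = butlast cs @ [last cs]" by auto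
    have "chain (tl cs)" using less.prems cs(1) chain_Cons by metis
    then have tl: "suffix_code (fst ` set (tl cs))" "prefix_code (snd ` set (tl cs))"
      using less.hyps[of "tl cs"] False by auto
    have "chain (butlast cs)" using less.prems cs(2) chain_append by metis
    then have bl: "suffix_code (fst ` set (butlast cs))" "prefix_code (snd ` set (butlast cs))"
      using less.hyps[of "butlast cs"] False by auto
    have crev: "chain (rev cs)" using less.prems by (rule chain_rev)
    interpret r: bifix_code "rev ` Y" "rev ` L" by (rule bifix_code_rev)
    have fst_flip: "fst ` set (map flip_cut ds) = rev ` snd ` set ds"
      and snd_flip: "snd ` set (map flip_cut ds) = rev ` fst ` set ds" for ds
      by (simp_all add: image_image flip_cut_def)
    have tl_rev: "tl (rev ds) = rev (butlast ds)" "butlast (rev ds) = rev (tl ds)" for ds :: "'b list"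
      by (metis butlast_rev rev_rev_ident, simp add: butlast_rev)
    have set_tl: "set cs = insert (hd cs) (set (tl cs))"
      using arg_cong[OF cs(1), of set] by simp
    have set_bl: "set cs = insert (last cs) (set (butlast cs))"
      using arg_cong[OF cs(2), of set] by simp
    have ends: "prefix (snd (hd cs)) (snd (last cs)) \<Longrightarrow> snd (hd cs) = snd (last cs)"
      using chain_ends_prefix[OF less.prems False tl bl(2)] .
    have ends_rev: "prefix (snd (last cs)) (snd (hd cs)) \<Longrightarrow> snd (last cs) = snd (hd cs)"
      using chain_ends_prefix[OF crev] False tl bl by (simp add: tl_rev hd_rev last_rev)
    have ends': "suffix (fst (last cs)) (fst (hd cs)) \<Longrightarrow> fst (last cs) = fst (hd cs)"
      using r.chain_ends_prefix[OF chain_flip[OF crev]] False tl bl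
      by (simp only: map_tl[symmetric] map_butlast[symmetric] fst_flip snd_flip tl_rev set_rev
          prefix_code_rev suffix_code_rev)
        (simp add: hd_map last_map flip_cut_def hd_rev last_rev suffix_to_prefix)
    have ends_rev': "suffix (fst (hd cs)) (fst (last cs)) \<Longrightarrow> fst (hd cs) = fst (last cs)"
      using r.chain_ends_prefix[OF chain_flip[OF less.prems]] False tl bl
      by (simp only: map_tl[symmetric] map_butlast[symmetric] fst_flip snd_flip tl_rev set_rev
          prefix_code_rev suffix_code_rev)
        (simp add: hd_map last_map flip_cut_def suffix_to_prefix)
    have pair: "(c \<in> set (tl cs) \<and> d \<in> set (tl cs)) \<or> (c \<in> set (butlast cs) \<and> d \<in> set (butlast cs)) \<or>
      (c = hd cs \<and> d = last cs) \<or> (c = last cs \<and> d = hd cs) \<or> c = d"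
      if "c \<in> set cs" "d \<in> set cs" for c d
    proof -
      have "x = hd cs \<or> x \<in> set (tl cs)" "x = last cs \<or> x \<in> set (butlast cs)" if "x \<in> set cs" for x
        using that set_tl set_bl by fast+
      moreover have "tl cs = [] \<or> hd cs \<in> set (butlast cs)"
        by (cases cs; cases "tl cs") auto
      moreover have "set (tl cs) = {} \<or> last cs \<in> set (tl cs)"
        by (cases cs; cases "tl cs") auto
      ultimately show ?thesis using that by (metis empty_iff set_empty)
    qed
    show ?thesis
    proof
      show "prefix_code (snd ` set cs)"
        unfolding prefix_code_def
      proof clarify
        fix p s p' s' assume cd: "(p, s) \<in> set cs" "(p', s') \<in> set cs" "prefix (snd (p, s)) (snd (p', s'))"
        show "snd (p, s) = snd (p', s')"
          using pair[OF cd(1,2)]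
        proof (elim disjE conjE)
          assume "(p, s) \<in> set (tl cs)" "(p', s') \<in> set (tl cs)"
          then show ?thesis using prefix_codeD[OF tl(2) imageI imageI] cd(3) by blast
        next
          assume "(p, s) \<in> set (butlast cs)" "(p', s') \<in> set (butlast cs)"
          then show ?thesis using prefix_codeD[OF bl(2) imageI imageI] cd(3) by blast
        qed (use cd(3) ends ends_rev in \<open>simp_all\<close>)
      qed
      show "suffix_code (fst ` set cs)"
        unfolding suffix_code_def
      proof clarify
        fix p s p' s' assume cd: "(p, s) \<in> set cs" "(p', s') \<in> set cs" "suffix (fst (p, s)) (fst (p', s'))"
        show "fst (p, s) = fst (p', s')"
          using pair[OF cd(1,2)]
        proof (elim disjE conjE)
          assume "(p, s) \<in> set (tl cs)" "(p', s') \<in> set (tl cs)"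
          then show ?thesis using suffix_codeD[OF tl(1) imageI imageI] cd(3) by blast
        next
          assume "(p, s) \<in> set (butlast cs)" "(p', s') \<in> set (butlast cs)"
          then show ?thesis using suffix_codeD[OF bl(1) imageI imageI] cd(3) by blast
        qed (use cd(3) ends' ends_rev' in \<open>simp_all\<close>)
      qed
    qed
  qed
qed

text \<open>The classes of \<open>sim\<close> are the vertices of the Stallings graph of the subgroup generated by \<open>Y\<close>.\<close>

definition sim :: "'a list \<times> 'a list \<Rightarrow> 'a list \<times> 'a list \<Rightarrow> bool" where
  "sim c d \<longleftrightarrow> (\<exists>cs. chain cs \<and> cs \<noteq> [] \<and> hd cs = c \<and> last cs = d) \<or>
     (c \<in> cuts - inner_cuts \<and> d \<in> cuts - inner_cuts)"

lemma sim_inner_iff: "sim c d \<Longrightarrow> c \<in> inner_cuts \<longleftrightarrow> d \<in> inner_cuts"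
  unfolding sim_def chain_def by (metis DiffD2 hd_in_set last_in_set subsetD)

lemma sim_refl: "c \<in> cuts \<Longrightarrow> sim c c"
  by (cases "c \<in> inner_cuts") (auto simp: sim_def chain_def intro!: exI[of _ "[c]"])

lemma sim_sym: "sim c d \<Longrightarrow> sim d c"
  unfolding sim_def by (metis chain_rev hd_rev last_rev rev_is_Nil_conv)

lemma sim_trans:
  assumes "sim c d" "sim d e"
  shows "sim c e"
proof (cases "d \<in> inner_cuts")
  case True
  then obtain cs ds where "chain cs" "cs \<noteq> []" "hd cs = c" "last cs = d"
    "chain ds" "ds \<noteq> []" "hd ds = d" "last ds = e"
    using assms unfolding sim_def by blast
  then have "chain (cs @ ds) \<and> cs @ ds \<noteq> [] \<and> hd (cs @ ds) = c \<and> last (cs @ ds) = e"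
    by (auto simp: chain_append share_def)
  then show ?thesis unfolding sim_def by blast
next
  case False
  then have "c \<notin> inner_cuts" "e \<notin> inner_cuts" using assms sim_inner_iff by blast+
  moreover have "c \<in> cuts - inner_cuts" "e \<in> cuts - inner_cuts"
    using assms calculation unfolding sim_def chain_def by (metis hd_in_set last_in_set subsetD)+
  ultimately show ?thesis by (simp add: sim_def)
qed

lemma sim_share_inner:
  assumes "c \<in> inner_cuts" "d \<in> inner_cuts" "share c d"
  shows "sim c d"
  unfolding sim_def using assms by (intro disjI1 exI[of _ "[c, d]"]) (simp add: chain_def)

lemma cut_neq_inner: "(p, s) \<in> cuts \<Longrightarrow> (p, s) \<notin> inner_cuts \<longleftrightarrow> p = [] \<or> s = []"
  by (auto simp: inner_cuts_def)

lemma sim_share_left: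
  assumes "(p, s) \<in> cuts" "(p, t) \<in> cuts"
  shows "sim (p, s) (p, t)"
proof (cases "p = [] \<or> s = [] \<or> t = []")
  \<comment> \<open>The prefix code keeps trivial cuts apart from inner ones: if \<open>p\<close>
    itself is in \<open>Y\<close>, no longer word of \<open>Y\<close> begins with
    \<open>p\<close>.\<close>
  case True
  then have "p = [] \<or> (s = [] \<and> t = [])"
    using assms prefix_codeD[OF prefix_code_Y, of p "p @ s"] prefix_codeD[OF prefix_code_Y, of p "p @ t"]
    by (auto simp: cuts_def)
  then show ?thesis using assms by (auto simp: sim_def cut_neq_inner)
next
  case False
  then show ?thesis using assms by (intro sim_share_inner) (auto simp: inner_cuts_def share_def)
qed

lemma sim_share_right:
  assumes "(p, s) \<in> cuts" "(q, s) \<in> cuts"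
  shows "sim (p, s) (q, s)"
proof (cases "p = [] \<or> q = [] \<or> s = []")
  case True
  then have "s = [] \<or> (p = [] \<and> q = [])"
    using assms suffix_codeD[OF suffix_code_Y, of s "p @ s"] suffix_codeD[OF suffix_code_Y, of s "q @ s"]
    by (auto simp: cuts_def suffix_def)
  then show ?thesis using assms by (auto simp: sim_def cut_neq_inner)
next
  case False
  then show ?thesis using assms by (intro sim_share_inner) (auto simp: inner_cuts_def share_def)
qed

text \<open>Determinism of the quotient, by which no further folding occurs. Along a chain joining
  the two cuts, all right parts beginning with \<open>a\<close> are cut down to \<open>[a]\<close>;
  acyclicity then shows that reading \<open>a\<close> leads into the class of
  \<open>(p @ [a], s)\<close> from both ends or from neither.\<close>

lemma sim_step:
  assumes cuts: "(p, a # s) \<in> cuts" "(p', a # s') \<in> cuts" and sim: "sim (p, a # s) (p', a # s')"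
  shows "sim (p @ [a], s) (p' @ [a], s')"
proof (cases "(p, a # s) \<in> inner_cuts")
  case False
  then have "p = []" "p' = []" using cuts sim sim_inner_iff by (auto simp: inner_cuts_def)
  then show ?thesis using cuts sim_share_left[of "[a]" s s'] by (simp add: cuts_def)
next
  case True
  then obtain cs where cs: "chain cs" "cs \<noteq> []" "hd cs = (p, a # s)" "last cs = (p', a # s')"
    using sim unfolding sim_def by blast
  have codes: "suffix_code (fst ` set cs)" "prefix_code (snd ` set cs)" using chain_codes[OF cs(1)] by auto
  define V where "V = insert [a] {v \<in> snd ` set cs. v \<noteq> [] \<and> hd v \<noteq> a}"
  have V: "prefix_code V"
    unfolding prefix_code_def
  proof (intro ballI impI)
    fix u v assume uv: "u \<in> V" "v \<in> V" "prefix u v"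
    show "u = v"
    proof (cases "u = [a] \<or> v = [a]")
      case True
      then show ?thesis using uv by (cases u; cases v) (auto simp: V_def)
    next
      case False
      then show ?thesis using uv prefix_codeD[OF codes(2)] by (auto simp: V_def)
    qed
  qed
  let ?E = "{(u, v). u \<in> fst ` set cs \<and> v \<in> V \<and> u @ v \<in> L}"
  \<comment> \<open>At a cut \<open>(q, a # t)\<close>, the left part \<open>q\<close> and the right
    part \<open>a # t\<close> each determine the class reached by \<open>a\<close>, so
    \<open>f q [a]\<close> and \<open>P t\<close> agree there. Off \<open>[a]\<close>,
    \<open>f\<close> is true, so that \<open>l\<close> and \<open>r\<close> simply agree.\<close>
  define f where "f = (\<lambda>u v. v = [a] \<longrightarrow> (\<exists>t. (u, a # t) \<in> cuts \<and> sim (u @ [a], t) (p @ [a], s)))"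
  define P where "P = (\<lambda>t. \<exists>q. (q, a # t) \<in> cuts \<and> sim (q @ [a], t) (p @ [a], s))"
  have "forest_rel ?E" using codes V by (intro forest) (auto simp: V_def)
  then obtain l r where lr: "\<And>u v. (u, v) \<in> ?E \<Longrightarrow> f u v \<longleftrightarrow> (l u \<longleftrightarrow> r v)"
    using forest_relE[of ?E f] by blast
  \<comment> \<open>All right parts beginning with \<open>a\<close> share the value
    \<open>r [a]\<close>; \<open>P\<close> corrects it so that \<open>m\<close> agrees with
    \<open>l\<close> along the chain.\<close>
  define m where "m = (\<lambda>v. if hd v = a then (r [a] \<longleftrightarrow> P (tl v)) else r v)"
  have "l (fst d) = m (snd d)" if d: "d \<in> set cs" for d
  proof -
    obtain q v where qv: "d = (q, v)" by force
    have inner: "(q, v) \<in> inner_cuts" using d qv cs(1) by (auto simp: chain_def)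
    have q: "q \<in> fst ` set cs" using d qv by force
    have v_ne: "v \<noteq> []" using inner by (simp add: inner_cuts_def)
    show ?thesis
    proof (cases "hd v = a")
      case True
      then obtain t where t: "v = a # t" using v_ne by (cases v) auto
      have "q @ [a] \<in> L" using inner inner_cut_factors[of q "[a]" t] t by simp
      then have "(q, [a]) \<in> ?E" using q by (simp add: V_def)
      then have "f q [a] \<longleftrightarrow> (l q \<longleftrightarrow> r [a])" by (rule lr)
      moreover have "f q [a] \<longleftrightarrow> P t"
      proof -
        have qt: "(q, a # t) \<in> cuts" using inner t by (simp add: inner_cuts_def)
        then have qt': "(q @ [a], t) \<in> cuts" by (simp add: cuts_def)
        show ?thesis
        proof
          assume "f q [a]"
          then obtain t' where t': "(q, a # t') \<in> cuts" "sim (q @ [a], t') (p @ [a], s)" by (auto simp: f_def)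
          then have "sim (q @ [a], t) (q @ [a], t')"
            using qt' by (intro sim_share_left) (auto simp: cuts_def)
          then show "P t" using t'(2) qt sim_trans unfolding P_def by blast
        next
          assume "P t"
          then obtain q' where q': "(q', a # t) \<in> cuts" "sim (q' @ [a], t) (p @ [a], s)" by (auto simp: P_def)
          then have "sim (q @ [a], t) (q' @ [a], t)"
            using qt' by (intro sim_share_right) (auto simp: cuts_def)
          then show "f q [a]" using q'(2) qt sim_trans unfolding f_def by blast
        qed
      qed
      ultimately show ?thesis using qv t by (auto simp: m_def)
    next
      case False
      have "q @ v \<in> L" using inner inner_cut_factors[of q v "[]"] by simp
      moreover have "v \<in> V" using False v_ne d qv by (force simp: V_def)
      ultimately have "f q v \<longleftrightarrow> (l q \<longleftrightarrow> r v)" using q by (intro lr) simp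
      moreover have "f q v" using False by (auto simp: f_def)
      ultimately show ?thesis using qv False by (simp add: m_def)
    qed
  qed
  moreover have "(p, a # s) \<in> set cs" "(p', a # s') \<in> set cs"
    using hd_in_set[OF cs(2)] last_in_set[OF cs(2)] cs(3,4) by simp_all
  ultimately have "m (a # s) = m (a # s')"
    using chain_const[OF cs(1), of l m "(p, a # s)" "(p', a # s')"] by simp
  then have "P s = P s'" by (auto simp: m_def)
  moreover have "P s" using cuts(1) by (auto simp: P_def cuts_def intro!: exI[of _ p] sim_refl)
  ultimately obtain q where q: "(q, a # s') \<in> cuts" "sim (q @ [a], s') (p @ [a], s)" by (auto simp: P_def)
  then have "sim (q @ [a], s') (p' @ [a], s')"
    using cuts(2) by (intro sim_share_right) (auto simp: cuts_def)
  then show ?thesis using q(2) sim_sym sim_trans by blast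
qed

lemma sim_flip:
  assumes "sim c d"
  shows "bifix_code.sim (rev ` Y) (flip_cut c) (flip_cut d)"
proof -
  interpret r: bifix_code "rev ` Y" "rev ` L" by (rule bifix_code_rev)
  have cut: "flip_cut c \<in> r.cuts \<longleftrightarrow> c \<in> cuts" for c
    unfolding r.cuts_def cuts_def flip_cut_def
    by (cases c) (auto simp: image_iff rev_swap simp flip: rev_append)
  then have inner: "flip_cut c \<in> r.inner_cuts \<longleftrightarrow> c \<in> inner_cuts" for c
    using cut[of c] by (cases c) (auto simp: r.inner_cuts_def inner_cuts_def flip_cut_def)
  show ?thesis
    using assms unfolding sim_def r.sim_def
  proof (elim disjE exE conjE)
    fix cs assume "chain cs" "cs \<noteq> []" "hd cs = c" "last cs = d"
    then show "(\<exists>cs. r.chain cs \<and> cs \<noteq> [] \<and> hd cs = flip_cut c \<and> last cs = flip_cut d) \<or>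
      flip_cut c \<in> r.cuts - r.inner_cuts \<and> flip_cut d \<in> r.cuts - r.inner_cuts"
      using chain_flip by (intro disjI1 exI[of _ "map flip_cut cs"]) (auto simp: hd_map last_map)
  qed (simp add: cut inner)
qed

end

lemma rev_rev_image: "rev ` rev ` S = S"
  by (simp add: image_image)

context bifix_code
begin

text \<open>Codeterminism, obtained from \<open>sim_step\<close> for the reversed code.\<close>

lemma sim_step_back:
  assumes cuts: "(p @ [a], s) \<in> cuts" "(p' @ [a], s') \<in> cuts" and sim: "sim (p @ [a], s) (p' @ [a], s')"
  shows "sim (p, a # s) (p', a # s')"
proof -
  interpret r: bifix_code "rev ` Y" "rev ` L" by (rule bifix_code_rev)
  have "r.sim (rev s, a # rev p) (rev s', a # rev p')"
    using sim_flip[OF sim] by (simp add: flip_cut_def)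
  moreover have "(rev s, a # rev p) \<in> r.cuts" "(rev s', a # rev p') \<in> r.cuts"
    using cuts imageI[of "p @ a # s" Y rev] imageI[of "p' @ a # s'" Y rev]
    by (simp_all add: r.cuts_def cuts_def)
  ultimately have "r.sim (rev s @ [a], rev p) (rev s' @ [a], rev p')" by (intro r.sim_step)
  from r.sim_flip[OF this] show ?thesis
    by (simp add: rev_rev_image r.flip_cut_def)
qed

lemma finite_cuts: "finite cuts"
proof -
  have "cuts \<subseteq> (\<Union>y \<in> Y. (\<lambda>k. (take k y, drop k y)) ` {..length y})"
  proof
    fix c assume "c \<in> cuts"
    then obtain p s where c: "c = (p, s)" "p @ s \<in> Y" by (auto simp: cuts_def)
    then have "c = (take (length p) (p @ s), drop (length p) (p @ s))" "length p \<le> length (p @ s)" by auto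
    then show "c \<in> (\<Union>y \<in> Y. (\<lambda>k. (take k y, drop k y)) ` {..length y})" using c(2) by blast
  qed
  then show ?thesis using finite_Y by (auto elim: finite_subset)
qed

definition cut_class :: "'a list \<times> 'a list \<Rightarrow> ('a list \<times> 'a list) set" where
  "cut_class c = {d \<in> cuts. sim c d}"

lemma cut_class_eq_iff: "c \<in> cuts \<Longrightarrow> d \<in> cuts \<Longrightarrow> cut_class c = cut_class d \<longleftrightarrow> sim c d"
  unfolding cut_class_def using sim_refl sim_sym sim_trans by blast

end

section \<open>The free group acting on classes of cuts\<close>

lemma extend_partial_bijection:
  assumes Q: "finite Q" and I: "D \<subseteq> Q" "f ` D \<subseteq> Q" "inj_on f D"
  obtains \<sigma> where "bij_betw \<sigma> Q Q" "\<And>x. x \<in> D \<Longrightarrow> \<sigma> x = f x"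
proof -
  have "card (Q - D) = card (Q - f ` D)"
    using Q I by (simp add: card_Diff_subset finite_subset card_image)
  then obtain g where g: "bij_betw g (Q - D) (Q - f ` D)"
    using Q finite_same_card_bij by (metis finite_Diff)
  have "bij_betw (\<lambda>x. if x \<in> D then f x else g x) (D \<union> (Q - D)) (f ` D \<union> (Q - f ` D))"
    by (rule bij_betw_disjoint_Un) (use I g in \<open>auto simp: bij_betw_def\<close>)
  moreover have "D \<union> (Q - D) = Q" "f ` D \<union> (Q - f ` D) = Q" using I by auto
  ultimately show ?thesis using that[of "\<lambda>x. if x \<in> D then f x else g x"] by simp
qed

context bifix_code
begin

text \<open>Reading words of \<open>Y\<close> from right to left, each letter acts on the classes of cuts by a partial
  injection. Completing these to permutations makes the free group act, and \<open>Y\<close> fixes the class of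
  the trivial cuts; a last letter of a longer word of \<open>Y\<close> does not.\<close>

theorem generating_imp_letters:
  assumes Y: "Y \<subseteq> lists A" and gen: "generate (free_group A) (pos ` Y) = carrier (free_group A)"
    and y: "y \<in> Y"
  shows "length y \<le> 1"
proof (rule ccontr)
  assume "\<not> length y \<le> 1"
  let ?F = "free_group A"
  define Q where "Q = cut_class ` cuts"
  have Q: "finite Q" using finite_cuts by (simp add: Q_def)
  have "\<exists>\<sigma>. bij_betw \<sigma> Q Q \<and> (\<forall>p s. (p @ [a], s) \<in> cuts \<longrightarrow> \<sigma> (cut_class (p @ [a], s)) = cut_class (p, a # s))" for a
  proof -
    define T where "T = {(p, s). (p @ [a], s) \<in> cuts}"
    have T: "(p, a # s) \<in> cuts" "(p @ [a], s) \<in> cuts" if "(p, s) \<in> T" for p s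
      using that by (auto simp: T_def cuts_def)
    \<comment> \<open>The classes entered by an edge labelled \<open>a\<close>, with
      \<open>f\<close> going back along it: \<open>sim_step_back\<close> makes \<open>f\<close>
      independent of the representative and \<open>sim_step\<close> makes it injective.\<close>
    define D where "D = (\<lambda>(p, s). cut_class (p @ [a], s)) ` T"
    define f where "f = (\<lambda>c. cut_class ((\<lambda>(p, s). (p, a # s)) (SOME t. t \<in> T \<and> c = (\<lambda>(p, s). cut_class (p @ [a], s)) t)))"
    have f: "f (cut_class (p @ [a], s)) = cut_class (p, a # s)" if ps: "(p, s) \<in> T" for p s
    proof -
      obtain p' s' where t: "(SOME t. t \<in> T \<and> cut_class (p @ [a], s) = (\<lambda>(p, s). cut_class (p @ [a], s)) t) = (p', s')"
        by force
      have "(p', s') \<in> T \<and> cut_class (p @ [a], s) = cut_class (p' @ [a], s')"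
        using someI[of "\<lambda>t. t \<in> T \<and> cut_class (p @ [a], s) = (\<lambda>(p, s). cut_class (p @ [a], s)) t" "(p, s)"] ps
        unfolding t by simp
      then have "(p', s') \<in> T" "sim (p @ [a], s) (p' @ [a], s')"
        using cut_class_eq_iff T[OF ps] T by blast+
      then have "cut_class (p, a # s) = cut_class (p', a # s')"
        using cut_class_eq_iff T[OF ps] T sim_step_back by blast
      then show ?thesis unfolding f_def t by simp
    qed
    have "D \<subseteq> Q" "f ` D \<subseteq> Q" using T f by (auto simp: D_def Q_def)
    moreover have "inj_on f D"
    proof (rule inj_onI)
      fix c d assume "c \<in> D" "d \<in> D" and eq: "f c = f d"
      then obtain p s p' s' where ps: "(p, s) \<in> T" "c = cut_class (p @ [a], s)" "(p', s') \<in> T" "d = cut_class (p' @ [a], s')"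
        by (auto simp: D_def)
      then have "sim (p, a # s) (p', a # s')" using eq f cut_class_eq_iff T by simp
      then have "sim (p @ [a], s) (p' @ [a], s')" using sim_step T ps by blast
      then show "c = d" using ps cut_class_eq_iff T by simp
    qed
    ultimately obtain \<sigma> where \<sigma>: "bij_betw \<sigma> Q Q" "\<And>x. x \<in> D \<Longrightarrow> \<sigma> x = f x"
      using extend_partial_bijection[OF Q] by blast
    have "\<sigma> (cut_class (p @ [a], s)) = cut_class (p, a # s)" if "(p @ [a], s) \<in> cuts" for p s
    proof -
      have ps: "(p, s) \<in> T" using that by (simp add: T_def)
      then have "cut_class (p @ [a], s) \<in> D" unfolding D_def by force
      then show ?thesis using \<sigma>(2) f[OF ps] by simp
    qed
    then show ?thesis using \<sigma>(1) by blast
  qed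
  then obtain \<sigma> where \<sigma>: "\<And>a. bij_betw (\<sigma> a) Q Q"
    "\<And>a p s. (p @ [a], s) \<in> cuts \<Longrightarrow> \<sigma> a (cut_class (p @ [a], s)) = cut_class (p, a # s)" by metis
  define \<tau> where "\<tau> = (\<lambda>a. restrict (\<sigma> a) Q)"
  have \<tau>: "\<tau> a \<in> carrier (BijGroup Q)" for a
    using \<sigma>(1)[of a] by (auto simp: BijGroup_def Bij_def \<tau>_def cong: bij_betw_cong)
  define \<psi> where "\<psi> = lift (BijGroup Q) \<tau>"
  have hom: "\<psi> \<in> hom ?F (BijGroup Q)"
    unfolding \<psi>_def using \<tau> by (intro lift_hom group_BijGroup) auto
  have \<psi>_gen: "\<psi> (gen a) = \<tau> a" for a
    unfolding \<psi>_def by (intro lift_gen group_BijGroup \<tau>)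
  interpret \<psi>: group_hom ?F "BijGroup Q" \<psi>
    using hom by (simp add: group_free_group group_BijGroup group_hom_def group_hom_axioms_def)
  \<comment> \<open>The right factor acts first, which fits the action of letters from the end of a
    word.\<close>
  have \<psi>_mult: "\<psi> (u \<otimes>\<^bsub>?F\<^esub> v) c = \<psi> u (\<psi> v c)" if "u \<in> carrier ?F" "v \<in> carrier ?F" "c \<in> Q" for u v c
    using that \<psi>.hom_closed[of u] \<psi>.hom_closed[of v] by (simp add: BijGroup_def compose_def)
  have \<psi>_one: "\<psi> \<one>\<^bsub>?F\<^esub> c = c" if "c \<in> Q" for c
    using that by (simp add: BijGroup_def)
  define base where "base = cut_class ([], y)"
  have y_cuts: "([], y) \<in> cuts" "(y, []) \<in> cuts" using y by (auto simp: cuts_def)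
  have base: "base \<in> Q" using y_cuts by (auto simp: base_def Q_def)
  have trivial: "cut_class ([], z) = base" "cut_class (z, []) = base" if "z \<in> Y" for z
    using that y_cuts cut_class_eq_iff[of _ "([], y)"] unfolding base_def
    by (auto simp: cuts_def sim_def inner_cuts_def)
  have path: "\<psi> (pos p) (cut_class (p, s)) = cut_class ([], p @ s)" if "(p, s) \<in> cuts" for p s
    using that
  proof (induction p arbitrary: s rule: rev_induct)
    case Nil
    then have "cut_class ([], s) \<in> Q" by (simp add: Q_def)
    then show ?case using \<psi>_one by (simp add: pos_Nil[of A] del: \<psi>.hom_one)
  next
    case (snoc a p)
    have in_lists: "p @ a # s \<in> lists A" using snoc.prems Y by (auto simp: cuts_def)
    then have "pos p \<in> carrier ?F" "gen a \<in> carrier ?F" by (auto intro!: pos_in_carrier)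
    moreover have cQ: "cut_class (p @ [a], s) \<in> Q" using snoc.prems by (simp add: Q_def)
    ultimately have "\<psi> (pos (p @ [a])) (cut_class (p @ [a], s)) = \<psi> (pos p) (\<tau> a (cut_class (p @ [a], s)))"
      using \<psi>_mult by (simp add: pos_append[of p "[a]" A] \<psi>_gen del: \<psi>.hom_mult)
    also have "\<tau> a (cut_class (p @ [a], s)) = cut_class (p, a # s)"
      using \<sigma>(2)[OF snoc.prems] cQ by (simp add: \<tau>_def)
    also have "\<psi> (pos p) \<dots> = cut_class ([], p @ a # s)"
      using snoc by (simp add: cuts_def)
    finally show ?case by simp
  qed
  have fixed: "\<psi> u base = base" if "u \<in> carrier ?F" for u
    using that[folded gen]
  proof (induction rule: generate.induct)
    case one
    then show ?case using \<psi>_one base by (simp del: \<psi>.hom_one)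
  next
    case (incl u)
    then obtain z where "z \<in> Y" "u = pos z" by blast
    then show ?case using path[of z "[]"] trivial[of z] by (simp add: cuts_def)
  next
    case (inv u)
    then obtain z where z: "z \<in> Y" "u = pos z" by blast
    have u: "u \<in> carrier ?F" using z Y by (auto intro!: pos_in_carrier)
    have "\<psi> u base = base" using z path[of z "[]"] trivial[of z] by (simp add: cuts_def)
    then have "\<psi> (inv\<^bsub>?F\<^esub> u) base = \<psi> (inv\<^bsub>?F\<^esub> u \<otimes>\<^bsub>?F\<^esub> u) base"
      using \<psi>_mult[of "inv\<^bsub>?F\<^esub> u" u base] u base by (simp del: \<psi>.hom_mult \<psi>.hom_inv)
    then show ?case using u \<psi>_one base by (simp del: \<psi>.hom_mult \<psi>.hom_inv \<psi>.hom_one)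
  next
    case (eng u v)
    have "u \<in> carrier ?F" "v \<in> carrier ?F" using eng.hyps gen by auto
    then show ?case using \<psi>_mult eng.IH base by (simp del: \<psi>.hom_mult)
  qed
  \<comment> \<open>The letter \<open>a\<close> fixes the base class as every group element does,
    but it carries the trivial cut after \<open>y\<close> to the inner cut before its last letter,
    and trivial and inner cuts are never identified.\<close>
  obtain z a where za: "y = z @ [a]" "z \<noteq> []"
    using \<open>\<not> length y \<le> 1\<close> by (cases y rule: rev_cases) auto
  have "a \<in> A" using y Y za(1) by auto
  then have "\<tau> a base = base" using fixed[OF gen_in_carrier] \<psi>_gen by simp
  moreover have "base = cut_class (z @ [a], [])" using trivial(2)[OF y] za(1) by simp
  moreover have "\<tau> a (cut_class (z @ [a], [])) = cut_class (z, [a])"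
    using \<sigma>(2)[of z a "[]"] y_cuts(2) za(1) base calculation(2) by (simp add: \<tau>_def)
  ultimately have "cut_class (z, [a]) = cut_class ([], y)" by (simp add: base_def)
  then have "sim (z, [a]) ([], y)"
    using y za(1) y_cuts(1) cut_class_eq_iff[of "(z, [a])" "([], y)"] by (simp add: cuts_def)
  moreover have "(z, [a]) \<in> inner_cuts" "([], y) \<notin> inner_cuts"
    using y za by (auto simp: inner_cuts_def cuts_def)
  ultimately show False using sim_inner_iff by blast
qed

end

section \<open>Tameness\<close>

context minimal_shift
begin

lemma bifix_code_language:
  assumes forest: "\<And>v. forest_rel (bi_ext X v)"
    and "finite Y" "Y \<subseteq> L" "prefix_code Y" "suffix_code Y"
  shows "bifix_code Y L"
proof
  show "w \<in> L" if "p @ w @ s \<in> Y" for p w s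
    using that assms(3) language_factor by blast
qed (use assms forest_suffix_prefix_code in auto)

text \<open>Replacing \<open>z = yt\<close> or \<open>z = ty\<close> by \<open>t\<close> in a generating set of minimal size; the inverse
  replacement is an elementary tame morphism.\<close>

lemma tame_replace:
  assumes Y: "finite Y" "Y \<subseteq> lists A" "card Y = card A"
    and gen: "generate (free_group A) (pos ` Y) = carrier (free_group A)"
    and yz: "y \<in> Y" "z \<in> Y" "y \<noteq> z" "z = y @ t \<or> z = t @ y"
  shows "card (insert t (Y - {z})) = card A"
    "generate (free_group A) (pos ` insert t (Y - {z})) = carrier (free_group A)"
    "\<phi> \<in> tame_morphisms A \<Longrightarrow> pos ` insert t (Y - {z}) = \<phi> ` gen ` A \<Longrightarrow>
      \<exists>\<phi> \<in> tame_morphisms A. pos ` Y = \<phi> ` gen ` A"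
proof -
  let ?F = "free_group A" and ?Y = "insert t (Y - {z})"
  interpret G: group ?F by (rule group_free_group)
  have yt: "y \<in> lists A" "t \<in> lists A" using yz Y(2) by auto
  have sub: "pos ` ?Y \<subseteq> carrier ?F" using Y(2) yt by (auto intro!: pos_in_carrier)
  have in_gen: "pos u \<in> generate ?F (pos ` ?Y)" if "u \<in> ?Y" for u
    using that by (intro generate.incl) auto
  have "pos z \<in> generate ?F (pos ` ?Y)"
    using yz in_gen[of y] in_gen[of t] by (auto simp: pos_append[of _ _ A] intro!: generate.eng)
  then have "pos ` Y \<subseteq> generate ?F (pos ` ?Y)" using in_gen by auto
  then have "generate ?F (pos ` Y) \<subseteq> generate ?F (pos ` ?Y)"
    using G.generate_subgroup_incl[OF _ G.generate_is_subgroup[OF sub]] by blast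
  then show gen': "generate ?F (pos ` ?Y) = carrier ?F"
    using gen G.generate_incl[OF sub] by blast
  have "card A \<le> card (pos ` ?Y)"
    using finite_A Y(1) sub gen' by (intro card_generators_ge) auto
  also have "\<dots> = card ?Y" by (rule card_image[OF inj_on_subset[OF inj_pos]]) simp
  finally have ge: "card A \<le> card ?Y" .
  have card_Yz: "Suc (card (Y - {z})) = card A" using card_Suc_Diff1[OF Y(1) yz(2)] Y(3) by (simp only:)
  \<comment> \<open>Otherwise fewer than \<open>card A\<close> words would generate.\<close>
  have t_new: "t \<notin> Y - {z}"
  proof
    assume "t \<in> Y - {z}"
    then have "?Y = Y - {z}" by (rule insert_absorb)
    then show False using ge card_Yz by simp
  qed
  then show "card ?Y = card A"
    using card_Yz Y(1) by simp
  assume \<phi>: "\<phi> \<in> tame_morphisms A" and img: "pos ` ?Y = \<phi> ` gen ` A"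
  have "\<phi> \<in> iso ?F ?F" using \<phi> by (rule tame_morphism_iso)
  then have hom: "\<phi> \<in> hom ?F ?F" and inj: "inj_on \<phi> (carrier ?F)" by (auto simp: iso_def bij_betw_def)
  have "pos y \<in> \<phi> ` gen ` A" "pos t \<in> \<phi> ` gen ` A" unfolding img[symmetric] using yz by auto
  then obtain a b where ab: "a \<in> A" "b \<in> A" "pos t = \<phi> (gen a)" "pos y = \<phi> (gen b)" by auto
  have "y \<noteq> t" using t_new yz by blast
  then have neq: "a \<noteq> b" using ab inj_eq[OF inj_pos, of y t] by metis
  have rest: "pos ` (Y - {z}) = \<phi> ` gen ` (A - {a})"
  proof -
    have "pos ` (Y - {z}) = pos ` ?Y - {pos t}" using t_new by (auto simp: inj_eq[OF inj_pos])
    also have "\<dots> = \<phi> ` gen ` A - {\<phi> (gen a)}" using img ab by simp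
    also have "\<dots> = \<phi> ` gen ` (A - {a})"
    proof -
      have "c = a" if "c \<in> A" "\<phi> (gen c) = \<phi> (gen a)" for c
      proof -
        have "gen c = gen a" by (rule inj_onD[OF inj that(2)]) (use that(1) ab(1) in \<open>auto intro: gen_in_carrier\<close>)
        then show ?thesis by (simp add: inj_eq[OF inj_pos])
      qed
      then show ?thesis by auto
    qed
    finally show ?thesis .
  qed
  \<comment> \<open>The elementary morphism acts first and alters only \<open>a\<close>, the letter
    that \<open>\<phi>\<close> sends to \<open>t\<close>; then \<open>\<phi>\<close> turns its image
    into \<open>z\<close> and leaves the other words as they were.\<close>
  have *: "\<exists>\<phi> \<in> tame_morphisms A. pos ` Y = \<phi> ` gen ` A"
    if \<psi>: "extend A f \<in> tame_morphisms A" and fa: "\<phi> (pos (f a)) = pos z"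
      and fc: "\<And>c. c \<noteq> a \<Longrightarrow> f c = [c]" and f: "set (f a) \<subseteq> A" for f
  proof (rule bexI)
    have "(\<phi> \<circ> extend A f) (gen a) = pos z"
      using fa extend_gen[of a A f, OF ab(1) f] by simp
    moreover have "(\<phi> \<circ> extend A f) (gen c) = \<phi> (gen c)" if "c \<in> A - {a}" for c
      using that fc[of c] extend_gen[of c A f] by simp
    ultimately have "(\<phi> \<circ> extend A f) ` gen ` A = insert (pos z) (\<phi> ` gen ` (A - {a}))"
    proof -
      assume h: "(\<phi> \<circ> extend A f) (gen a) = pos z"
        "\<And>c. c \<in> A - {a} \<Longrightarrow> (\<phi> \<circ> extend A f) (gen c) = \<phi> (gen c)"
      have "(\<phi> \<circ> extend A f) ` gen ` A =
          insert ((\<phi> \<circ> extend A f) (gen a)) ((\<lambda>c. (\<phi> \<circ> extend A f) (gen c)) ` (A - {a}))"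
        using ab(1) by auto
      also have "(\<lambda>c. (\<phi> \<circ> extend A f) (gen c)) ` (A - {a}) = (\<lambda>c. \<phi> (gen c)) ` (A - {a})"
        using h(2) by (rule image_cong[OF refl])
      finally show ?thesis using h(1) by (simp add: image_image)
    qed
    then show "pos ` Y = (\<phi> \<circ> extend A f) ` gen ` A"
      using rest yz(2) by (metis image_insert insert_Diff)
    show "\<phi> \<circ> extend A f \<in> tame_morphisms A" using \<phi> \<psi> by (rule tame_morphisms.comp)
  qed
  have car: "gen a \<in> carrier ?F" "gen b \<in> carrier ?F" using ab by (auto intro: gen_in_carrier)
  show "\<exists>\<phi> \<in> tame_morphisms A. pos ` Y = \<phi> ` gen ` A"
  proof (cases "z = y @ t")
    case True
    have "pos (alpha_tilde a b a) = gen b \<otimes>\<^bsub>?F\<^esub> gen a"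
      by (simp add: alpha_tilde_def pos_Cons[of b "[a]" A])
    then have "\<phi> (pos (alpha_tilde a b a)) = pos z"
      using hom car ab True by (simp add: hom_mult pos_append[of y t A])
    then show ?thesis
      using ab neq by (intro *[of "alpha_tilde a b"] tame_morphisms.alpha_tilde) (auto simp: alpha_tilde_def)
  next
    case False
    have "pos (alpha a b a) = gen a \<otimes>\<^bsub>?F\<^esub> gen b"
      by (simp add: alpha_def pos_Cons[of a "[b]" A])
    then have "\<phi> (pos (alpha a b a)) = pos z"
      using hom car ab False yz(4) by (simp add: hom_mult pos_append[of t y A])
    then show ?thesis
      using ab neq by (intro *[of "alpha a b"] tame_morphisms.alpha) (auto simp: alpha_def)
  qed
qed

text \<open>The total length drops because \<open>y\<close> is nonempty, and \<open>t\<close> stays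
  in the language as a factor of \<open>z\<close>. When no replacement is left, \<open>Y\<close> is
  a bifix code, consists of letters by \<open>generating_imp_letters\<close>, and contains all of
  them by its size.\<close>

lemma generating_words_tame:
  assumes forest: "\<And>v. forest_rel (bi_ext X v)"
    and "finite Y" "Y \<subseteq> L" "[] \<notin> Y" "card Y = card A"
    and "generate (free_group A) (pos ` Y) = carrier (free_group A)"
  shows "\<exists>\<phi> \<in> tame_morphisms A. pos ` Y = \<phi> ` gen ` A"
  using assms(2-)
proof (induction "sum length Y" arbitrary: Y rule: less_induct)
  case less
  have Y_lists: "Y \<subseteq> lists A" using less.prems(2) language_letters by blast
  show ?case
  proof (cases "prefix_code Y \<and> suffix_code Y")
    case True
    then interpret bifix_code Y L
      using bifix_code_language[OF forest] less.prems by blast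
    have "Y \<subseteq> (\<lambda>a. [a]) ` A"
    proof
      fix y assume y: "y \<in> Y"
      then have "length y = 1"
        using generating_imp_letters[OF Y_lists less.prems(5)] less.prems(3)
        by (metis One_nat_def le_antisym length_0_conv less_one not_less)
      then obtain a where "y = [a]" by (auto simp: length_Suc_conv)
      then show "y \<in> (\<lambda>a. [a]) ` A" using y Y_lists by auto
    qed
    moreover have "card ((\<lambda>a. [a]) ` A) = card Y"
      using less.prems(4) by (simp add: card_image inj_on_def)
    ultimately have "Y = (\<lambda>a. [a]) ` A"
      using finite_A by (intro card_subset_eq) auto
    moreover have "extend A (\<lambda>a. [id a]) (gen a) = gen a" if "a \<in> A" for a
      using extend_gen[of a A "\<lambda>a. [id a]"] that by simp
    ultimately have "pos ` Y = extend A (\<lambda>a. [id a]) ` gen ` A" by (simp add: image_image)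
    moreover have "extend A (\<lambda>a. [id a]) \<in> tame_morphisms A"
      by (rule tame_morphisms.perm) (rule permutes_id)
    ultimately show ?thesis by blast
  next
    case False
    then obtain y z where yz: "y \<in> Y" "z \<in> Y" "y \<noteq> z" "prefix y z \<or> suffix y z"
      by (auto simp: prefix_code_def suffix_code_def)
    then obtain t where t: "z = y @ t \<or> z = t @ y" by (auto simp: prefix_def suffix_def)
    let ?Y = "insert t (Y - {z})"
    note rep = tame_replace[OF less.prems(1) Y_lists less.prems(4,5) yz(1-3) t]
    have "t \<noteq> []" using t yz(3) by auto
    have "t \<in> L" using t yz(2) less.prems(2) language_appendD1 language_appendD2 by blast
    have "sum length ?Y \<le> length t + sum length (Y - {z})"
      using less.prems(1) by (simp add: sum.insert_if)
    also have "\<dots> < length z + sum length (Y - {z})"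
      using t yz(1) less.prems(3) by (cases y) auto
    also have "\<dots> = sum length Y" using less.prems(1) yz(2) by (simp add: sum.remove)
    finally have "\<exists>\<phi> \<in> tame_morphisms A. pos ` ?Y = \<phi> ` gen ` A"
      using less.prems rep(1,2) \<open>t \<noteq> []\<close> \<open>t \<in> L\<close> by (intro less.hyps) auto
    then show ?thesis using rep(3) by blast
  qed
qed

theorem dendric_imp_tame:
  assumes dend: "dendric X" and w: "w \<in> L"
  shows "tame_basis A (pos ` R w)"
proof -
  have conn: "connected_rel (left_ext X v) (right_ext X v) (bi_ext X v)" and forest: "forest_rel (bi_ext X v)"
    if "v \<in> L" for v
    using dend dendric_word_iff that by (auto simp: dendric_def)
  \<comment> \<open>The collapsing arguments may meet words outside the language too, which have no
    two-sided extensions.\<close>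
  have forest': "forest_rel (bi_ext X v)" for v
  proof (cases "v \<in> L")
    case False
    then have "bi_ext X v = {}" using language_factor[of "[_]" v "[_]" X] by (auto simp: bi_ext_def)
    then show ?thesis by (simp add: forest_rel_def)
  qed (rule forest)
  have "R w \<subseteq> L" using language_appendD1 by (blast dest: return_wordD(2))
  moreover have "[] \<notin> R w" by (auto dest: return_wordD(1))
  ultimately obtain \<phi> where "\<phi> \<in> tame_morphisms A" "pos ` R w = \<phi> ` gen ` A"
    using generating_words_tame[OF forest' finite_return_words[OF w]]
      dendric_card_return_words[OF dend w] generate_return_words[OF conn w] by blast
  then show ?thesis by (rule tame_basisI)
qed

end

theorem theorem1:
  fixes A :: "'a set" and X :: "(int \<Rightarrow> 'a) set"
  assumes "finite A"
    and "minimal_shift_space A X"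
    and "\<forall>a \<in> A. [a] \<in> language X"
  shows "(dendric X \<longleftrightarrow> (\<forall>w \<in> language X. tame_basis A (pos ` return_words X w))) \<and>
         ((\<forall>w \<in> language X. tame_basis A (pos ` return_words X w)) \<longleftrightarrow>
          (\<forall>w \<in> language X. free_basis (free_group A) (pos ` return_words X w)))"
proof -
  interpret minimal_shift A X using assms by unfold_locales auto
  show ?thesis
    using dendric_imp_tame bases_imp_dendric by (auto simp: tame_basis_def)
qed

end
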